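(* In the setting described in the context (a stationary bivariate point process $N=(N_1,N_2)$ with true intensities $\lambda_1^*,\lambda_2^*>0$ and true cross-correlation function $g(\cdot;\theta^* )$, $\theta^*\in\Theta\subset\mathbb{R}^p$, a fixed $r>0$, and observation windows $W_n$), assume the following. (Windows) $W_1\subset W_2\subset\cdots\subset\mathbb{R}$, each $W_n$ is bounded, $\mathrm{Leb}\big(\bigcup_{n\ge1}(W_n\ominus r)\big)=\infty$, and $\#D_n/a_n\to1$ as $n\to\infty$. (Parameter space) $\Theta\subset\mathbb{R}^p$ is bounded, open and convex. (Identifiability) For all $\theta\in\overline{\Theta}$, $g(\cdot;\theta)=g(\cdot;\theta^* )$ a.e. on $[-r,r]$ implies $\theta=\theta^*$. (Regularity) (i) $\operatorname{ess\,inf}_{|u|\le r}\inf_{\theta\in\overline{\Theta}}g(u;\theta)>0$; (ii) $g(u;\cdot)\in C(\overline{\Theta})\cap C^2(\Theta)$ for all $u\in[-r,r]$; (iii) there is a measurable $f_{B,1}:[-r,r]\to\mathbb{R}_{\ge0}$ with $\max_{0\le i\le2}\sup_{\theta\in\Theta}|\partial_\theta^i g(\cdot;\theta)|\le f_{B,1}(\cdot)$ on $[-r,r]$ and $\int_{|u|\le r}f_{B,1}(u)\,du<\infty$; (iv) there is a measurable $f_{B,2}:[-r,r]\to\mathbb{R}_{\ge0}$ with $\max_{0\le i\le2}\sup_{\theta\in\Theta}|\partial_\theta^i\log g(\cdot;\theta)|\le f_{B,2}(\cdot)$ on $[-r,r]$ and $\int_{|u|\le r}f_{B,2}(u)g(u;\theta^*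 )\,du<\infty$. (Mixing and moments) There exists $\delta>0$ such that $\sum_{m=1}^\infty\alpha^N_{2,\infty}(m;r)^{\frac{\delta}{2+\delta}}<\infty$, $\|N_i(C(0))\|_{2+\delta}<\infty$ for $i=1,2$, and $\big\|F_2^N\big(|\partial_\theta^j\log g(\cdot;\theta)|;C(0)\big)\big\|_{2+\delta}<\infty$ for $j=0,1,2$ and $\theta\in\Theta$. Then the quasi-maximum likelihood estimator is consistent: $\widehat\theta_n\to\theta^*$ in probability as $n\to\infty$.
   Context: A point process on $\mathbb{R}$ is a random locally finite $\mathbb{Z}_{\ge0}\cup\{\infty\}$-valued measure; it is identified with a countable random set of points, and $x\in N$ means $x$ is a point of $N$. A bivariate point process $N=(N_1,N_2)$ is a pair of point processes on one probability space such that $N_1+N_2$ is a.s. simple. It is stationary if the joint laws of finitely many counts $N_{i_1}(A_1),\dots,N_{i_l}(A_l)$ are unchanged when all bounded Borel sets $A_j$ are translated by the same $u\in\mathbb{R}$. Its intensities are $\lambda_i=E[N_i([0,1])]$. Its cross-intensity function $\lambda_{1,2}$ is characterized by $E\big[\sum_{x\in N_1,y\in N_2,x\in D}h(y-x)\big]=\mathrm{Leb}(D)\int_{\mathbb{R}}h(u)\lambda_{1,2}(u)\,du$ for Borel $D$ and nonnegative Borel $h$. Its cross-correlation function is $\lambda_{1,2}(u)/(\lambda_1\lambda_2)$. Setting. $N=(N_1,N_2)$ is a stationary bivariate point process on $\mathbb{R}$ with true intensities $\lambda_1^*,\lambda_2^*>0$. $\Theta\subset\mathbb{R}^p$ is a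 bounded open set, $g(\cdot;\theta)$, $\theta\in\overline{\Theta}$, is a parametric family of cross-correlation functions, and the true cross-correlation function of $N$ is $g(\cdot;\theta^* )$ with $\theta^*\in\Theta$. $r>0$ is fixed, and $\{W_n\}$ is an increasing sequence of compact subsets of $\mathbb{R}$ (observation windows). Notation. $B(x,r)$ is the open ball. $W\ominus r=\{x\in W:B(x,r)\subset W\}$. $W\oplus r=\{x\in\mathbb{R}:\exists y\in W,\ y\in B(x,r)\}$. $a_n=\mathrm{Leb}(W_n\ominus r)$. $C(l)=(l-\frac12,l+\frac12]$ for $l\in\mathbb{Z}$. $D_n=\{l\in\mathbb{Z}:C(l)\cap(W_n\ominus r)\ne\emptyset\}$. $\|\cdot\|_p$ is the $L^p$-norm of a random variable. $|\cdot|$ is the Euclidean norm of vectors and matrices. $\partial_\theta^i$ denotes the $i$-th order derivative in $\theta$. For Borel $V$ and measurable $h$, $F_2^N(h;V)=\sum_{x\in N_1,\,y\in N_2,\,|y-x|\le r,\,x\in V}h(y-x)$. Mixing. For $\sigma$-algebras, $\alpha(\mathcal{G},\mathcal{H})=\sup\{|P(C\cap D)-P(C)P(D)|:C\in\mathcal{G},D\in\mathcal{H}\}$. $\alpha^N_{c_1,c_2}(m;r)$ is the supremum of $\alpha\big(\sigma(N_1\cap E_1,N_2\cap E_1),\sigma(N_1\cap E_2,N_2\cap E_2)\big)$ over $E_k=\bigcup_{l\in M_k}C(l)\oplus r$ ($k=1,2$), $M_1,M_2\subset\mathbb{Z}$, $\#M_1\le c_1$, $\#M_2\le c_2$, $d(M_1,M_2)\ge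 m$. Here $N_i\cap E=N_i(\cdot\cap E)$, and $c_2=\infty$ means no restriction on $\#M_2$. Estimator. $\widehat\lambda_{i,n}=a_n^{-1}N_i(W_n\ominus r)$ and $$\mathbb{H}_n(\theta)=\sum_{\substack{x\in N_1,\,y\in N_2\\|y-x|\le r,\ x\in W_n\ominus r}}\big(\log g(y-x;\theta)+\log\widehat\lambda_{1,n}+\log\widehat\lambda_{2,n}\big)-a_n\widehat\lambda_{1,n}\widehat\lambda_{2,n}\int_{|u|\le r}g(u;\theta)\,du.$$ The quasi-maximum likelihood estimator (QMLE) $\widehat\theta_n$ is a measurable map with $\widehat\theta_n\in\operatorname{argmax}_{\theta\in\overline{\Theta}}\mathbb{H}_n(\theta)$. *)

theory Defs
  imports "HOL-Probability.Probability"
begin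

section \<open>Bivariate point processes on the line\<close>

definition point_process :: "'w measure \<Rightarrow> ('w \<Rightarrow> real measure) \<Rightarrow> bool" where
  "point_process M X \<longleftrightarrow>
     (\<forall>\<omega>\<in>space M. sets (X \<omega>) = sets borel \<and>
        (\<forall>A\<in>sets borel. emeasure (X \<omega>) A \<in> \<nat> \<union> {\<infinity>}) \<and>
        (\<forall>A\<in>sets borel. bounded A \<longrightarrow> emeasure (X \<omega>) A < \<infinity>)) \<and>
     (\<forall>A\<in>sets borel. (\<lambda>\<omega>. emeasure (X \<omega>) A) \<in> borel_measurable M)"

definition points :: "real measure \<Rightarrow> real set" where
  "points \<nu> = {x. emeasure \<nu> {x} \<noteq> 0}"

text \<open>The pair $(N_1,N_2)$ is encoded as a family indexed by natural numbers, of which only the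
  members with index 1 and 2 are used.\<close>

definition bivariate_point_process :: "'w measure \<Rightarrow> (nat \<Rightarrow> 'w \<Rightarrow> real measure) \<Rightarrow> bool" where
  "bivariate_point_process M N \<longleftrightarrow>
     point_process M (N 1) \<and> point_process M (N 2) \<and>
     (AE \<omega> in M. \<forall>x. emeasure (N 1 \<omega>) {x} + emeasure (N 2 \<omega>) {x} \<le> 1)"

definition stationary :: "'w measure \<Rightarrow> (nat \<Rightarrow> 'w \<Rightarrow> real measure) \<Rightarrow> bool" where
  "stationary M N \<longleftrightarrow>
     (\<forall>(k::nat) i A u. (\<forall>j<k. i j \<in> {1,2} \<and> A j \<in> sets borel \<and> bounded (A j)) \<longrightarrow>
        distr M (Pi\<^sub>M {..<k} (\<lambda>_. borel)) (\<lambda>\<omega>. \<lambda>j\<in>{..<k}. emeasure (N (i j) \<omega>) (A j)) =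
        distr M (Pi\<^sub>M {..<k} (\<lambda>_. borel)) (\<lambda>\<omega>. \<lambda>j\<in>{..<k}. emeasure (N (i j) \<omega>) ((+) u ` A j)))"

text \<open>This is 0 when the expected count is infinite, so positivity of an intensity includes its
  finiteness.\<close>

definition intensity :: "'w measure \<Rightarrow> (nat \<Rightarrow> 'w \<Rightarrow> real measure) \<Rightarrow> nat \<Rightarrow> real" where
  "intensity M N i = (\<integral>\<omega>. measure (N i \<omega>) {0..1} \<partial>M)"

definition is_cross_intensity ::
    "'w measure \<Rightarrow> (nat \<Rightarrow> 'w \<Rightarrow> real measure) \<Rightarrow> (real \<Rightarrow> real) \<Rightarrow> bool" where
  "is_cross_intensity M N lam \<longleftrightarrow>
     lam \<in> borel_measurable borel \<and> (\<forall>u. 0 \<le> lam u) \<and>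
     (\<forall>D\<in>sets borel. \<forall>h\<in>borel_measurable borel.
        (\<integral>\<^sup>+\<omega>. (\<integral>\<^sup>+(x, y). h (y - x)
            \<partial>count_space {(x, y). x \<in> points (N 1 \<omega>) \<and> y \<in> points (N 2 \<omega>) \<and> x \<in> D}) \<partial>M) =
        emeasure lborel D * (\<integral>\<^sup>+u. h u * ennreal (lam u) \<partial>lborel))"

definition is_cross_correlation ::
    "'w measure \<Rightarrow> (nat \<Rightarrow> 'w \<Rightarrow> real measure) \<Rightarrow> (real \<Rightarrow> real) \<Rightarrow> bool" where
  "is_cross_correlation M N f \<longleftrightarrow>
     (\<exists>lam. is_cross_intensity M N lam \<and>
        (\<forall>u. f u = lam u / (intensity M N 1 * intensity M N 2)))"


section \<open>Windows and pair sums\<close>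

definition erosion :: "real set \<Rightarrow> real \<Rightarrow> real set" where
  "erosion W r = {x \<in> W. ball x r \<subseteq> W}"

definition dilation :: "real set \<Rightarrow> real \<Rightarrow> real set" where
  "dilation W r = {x. \<exists>y\<in>W. y \<in> ball x r}"

definition cell :: "int \<Rightarrow> real set" where
  "cell l = {real_of_int l - 1/2 <.. real_of_int l + 1/2}"

definition window_area :: "real set \<Rightarrow> real \<Rightarrow> real" where
  "window_area W r = measure lborel (erosion W r)"

definition window_cells :: "real set \<Rightarrow> real \<Rightarrow> int set" where
  "window_cells W r = {l. cell l \<inter> erosion W r \<noteq> {}}"

definition close_pairs ::
    "real \<Rightarrow> (nat \<Rightarrow> 'w \<Rightarrow> real measure) \<Rightarrow> real set \<Rightarrow> 'w \<Rightarrow> (real \<times> real) set" where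
  "close_pairs r N V \<omega> =
     {(x, y). x \<in> points (N 1 \<omega>) \<and> y \<in> points (N 2 \<omega>) \<and> \<bar>y - x\<bar> \<le> r \<and> x \<in> V}"

text \<open>For bounded \<open>V\<close> the index set is finite by local finiteness, and this is an ordinary finite
  sum.\<close>

definition pair_sum ::
    "real \<Rightarrow> (nat \<Rightarrow> 'w \<Rightarrow> real measure) \<Rightarrow> (real \<Rightarrow> real) \<Rightarrow> real set \<Rightarrow> 'w \<Rightarrow> real" where
  "pair_sum r N h V \<omega> = (\<Sum>\<^sub>\<infinity>(x, y)\<in>close_pairs r N V \<omega>. h (y - x))"


section \<open>Moments, mixing, convergence in probability\<close>

text \<open>$\|X\|_q < \infty$.\<close>

definition finite_Lp_norm :: "'w measure \<Rightarrow> real \<Rightarrow> ('w \<Rightarrow> real) \<Rightarrow> bool" where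
  "finite_Lp_norm M q X \<longleftrightarrow> (\<integral>\<^sup>+\<omega>. ennreal (\<bar>X \<omega>\<bar> powr q) \<partial>M) < \<infinity>"

definition alpha_coeff :: "'w measure \<Rightarrow> 'w set set \<Rightarrow> 'w set set \<Rightarrow> real" where
  "alpha_coeff M \<G> \<H> =
     (SUP (C, D)\<in>\<G> \<times> \<H>. \<bar>measure M (C \<inter> D) - measure M C * measure M D\<bar>)"

definition sigma_on ::
    "'w measure \<Rightarrow> (nat \<Rightarrow> 'w \<Rightarrow> real measure) \<Rightarrow> real set \<Rightarrow> 'w set set" where
  "sigma_on M N E = sigma_sets (space M)
     {(\<lambda>\<omega>. emeasure (N i \<omega>) (A \<inter> E)) -` B \<inter> space M | i A B.
        i \<in> {1,2} \<and> A \<in> sets borel \<and> B \<in> sets borel}"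

definition card_at_most :: "'a set \<Rightarrow> enat \<Rightarrow> bool" where
  "card_at_most L c \<longleftrightarrow> c = \<infinity> \<or> (finite L \<and> enat (card L) \<le> c)"

text \<open>The distance to the empty set counts as infinite; empty index sets only contribute the
  value 0 to the supremum.\<close>

definition mixing_coeff ::
    "'w measure \<Rightarrow> (nat \<Rightarrow> 'w \<Rightarrow> real measure) \<Rightarrow> enat \<Rightarrow> enat \<Rightarrow> nat \<Rightarrow> real \<Rightarrow> real" where
  "mixing_coeff M N c1 c2 m r =
     Sup {alpha_coeff M (sigma_on M N (\<Union>l\<in>L1. dilation (cell l) r))
                        (sigma_on M N (\<Union>l\<in>L2. dilation (cell l) r)) | L1 L2.
            card_at_most L1 c1 \<and> card_at_most L2 c2 \<and>
            (\<forall>l1\<in>L1. \<forall>l2\<in>L2. int m \<le> \<bar>l1 - l2\<bar>)}"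

definition tendsto_in_prob ::
    "'w measure \<Rightarrow> (nat \<Rightarrow> 'w \<Rightarrow> 'b::metric_space) \<Rightarrow> 'b \<Rightarrow> bool" where
  "tendsto_in_prob M X c \<longleftrightarrow>
     (\<forall>\<epsilon>>0. (\<lambda>n. measure M {\<omega> \<in> space M. dist (X n \<omega>) c > \<epsilon>}) \<longlonglongrightarrow> 0)"


section \<open>Derivatives in the parameter\<close>

definition grad :: "(real^'p \<Rightarrow> real) \<Rightarrow> real^'p \<Rightarrow> real^'p" where
  "grad f x = (\<chi> i. frechet_derivative f (at x) (axis i 1))"

definition hess :: "(real^'p \<Rightarrow> real) \<Rightarrow> real^'p \<Rightarrow> real^'p^'p" where
  "hess f x = matrix (frechet_derivative (grad f) (at x))"

text \<open>Meant for open \<open>S\<close>.\<close>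

definition C2_on :: "(real^'p \<Rightarrow> real) \<Rightarrow> (real^'p) set \<Rightarrow> bool" where
  "C2_on f S \<longleftrightarrow>
     (\<forall>x\<in>S. f differentiable (at x)) \<and> (\<forall>x\<in>S. grad f differentiable (at x)) \<and>
     continuous_on S (hess f)"

text \<open>$|\partial^i f(x)|$ for $i \le 2$; the norm of a matrix is the Euclidean norm of its
  entries.\<close>

definition deriv_norm :: "nat \<Rightarrow> (real^'p \<Rightarrow> real) \<Rightarrow> real^'p \<Rightarrow> real" where
  "deriv_norm i f x =
     (if i = 0 then \<bar>f x\<bar> else if i = 1 then norm (grad f x) else norm (hess f x))"


section \<open>The quasi-likelihood\<close>

text \<open>The essential infimum, in parallel to \<^const>\<open>esssup\<close>.\<close>

definition essinf :: "'a measure \<Rightarrow> ('a \<Rightarrow> ereal) \<Rightarrow> ereal" where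
  "essinf M f = Liminf (ae_filter M) f"

text \<open>The logarithm on $[0,\infty)$ with $\log 0 = -\infty$. Estimated intensities may vanish, so
  the quasi-likelihood takes values in $[-\infty,\infty)$.\<close>

definition elog :: "real \<Rightarrow> ereal" where
  "elog x = (if x \<le> 0 then - \<infinity> else ereal (ln x))"

definition intensity_est ::
    "real \<Rightarrow> (nat \<Rightarrow> 'w \<Rightarrow> real measure) \<Rightarrow> real set \<Rightarrow> nat \<Rightarrow> 'w \<Rightarrow> real" where
  "intensity_est r N W i \<omega> = measure (N i \<omega>) (erosion W r) / window_area W r"

definition quasi_loglik ::
    "real \<Rightarrow> (nat \<Rightarrow> 'w \<Rightarrow> real measure) \<Rightarrow> (real \<Rightarrow> real^'p \<Rightarrow> real) \<Rightarrow> real set \<Rightarrow> 'w \<Rightarrow>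
     real^'p \<Rightarrow> ereal" where
  "quasi_loglik r N g W \<omega> \<theta> =
     (\<Sum>(x, y)\<in>close_pairs r N (erosion W r) \<omega>.
        elog (g (y - x) \<theta>) + elog (intensity_est r N W 1 \<omega>) + elog (intensity_est r N W 2 \<omega>)) -
     ereal (window_area W r * intensity_est r N W 1 \<omega> * intensity_est r N W 2 \<omega> *
        (LINT u:{-r..r}|lborel. g u \<theta>))"

definition is_QMLE ::
    "'w measure \<Rightarrow> real \<Rightarrow> (nat \<Rightarrow> 'w \<Rightarrow> real measure) \<Rightarrow> (real \<Rightarrow> real^'p \<Rightarrow> real) \<Rightarrow>
     (real^'p) set \<Rightarrow> real set \<Rightarrow> ('w \<Rightarrow> real^'p) \<Rightarrow> bool" where
  "is_QMLE M r N g \<Theta> W \<theta>' \<longleftrightarrow>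
     \<theta>' \<in> borel_measurable M \<and>
     (\<forall>\<omega>\<in>space M. is_arg_max (quasi_loglik r N g W \<omega>) (\<lambda>\<theta>. \<theta> \<in> closure \<Theta>) (\<theta>' \<omega>))"

end

theory Submission
  imports Defs
begin

text \<open>With probability tending to 1, the criterion maximised by the estimator is, up to a term that does
  not depend on the parameter and a factor equal to the area of the eroded window, the random
  function \<open>normalized_loglik\<close>. Consistency follows by Wald's argument for maximisers on a compact set
  (\<open>m_estimator_consistent\<close>): this function converges in probability at every parameter to a
  deterministic \<open>contrast\<close>, the true parameter is the only maximiser of the contrast, and the
  random function is Lipschitz in the parameter with a factor that converges in probability.

  The contrast is, up to a positive factor, the integral of $g^* \log g - g$ over $[-r,r]$. For
  positive numbers $b \log a - a$ is largest exactly when $a = b$; hence the contrast is largest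
  exactly when $g = g^*$ almost everywhere, that is, at the true parameter. The Lipschitz factor
  comes from the gradient bounds through the mean value inequality on the convex parameter space.

  Everything else is a law of large numbers for pair sums over growing windows
  (\<open>pair_sum_weak_law\<close>) and one for counts (\<open>intensity_est_consistent\<close>). Cut the line into unit
  cells. Up to the cells that the window only meets in part, a pair sum over the window is the sum
  of the contributions of the cells, and the contribution of a cell depends only on the points at
  distance less than $r$ from this cell. Three facts make the average of the contributions converge in
  mean (\<open>mixing_weak_law\<close>).

  First, the contributions have the same mean, by the defining identity of the cross-intensity.

  Second, contributions truncated at a common level $L$ have covariances of at most $L^2$ times a
  mixing coefficient, so that the variance of the average of $k$ of them is of order $1/k$.

  Third, truncation changes the contributions little in mean, uniformly over the cells. Replace the
  weight $h$ by $\min(h,K)$: by the cross-intensity identity again, the error in mean is small for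
  large $K$. The contribution of a weight bounded by $K$ is at most $K$ times a product of two counts, the law
  of this product is the same for all cells by stationarity, and it is integrable since counts
  have second moments.

  The cells that are not contained in the window have total excess area $\# D_n - a_n$, which is
  $o(a_n)$. The means of the corresponding sums are proportional to that area, for pair sums by the
  cross-intensity identity and for counts because the mean measure of a stationary process is a
  multiple of Lebesgue measure (\<open>mean_count\<close>).

  Pair sums involve the sets of points of the two configurations and need not be measurable in the
  outcome. Two devices deal with this. Convergence in probability is convergence along
  a filter on pairs of an index and an outcome, for which measurability is not an issue and the
  calculus of limits is available. And almost surely, where the configurations are simple, pair
  sums agree with iterated integrals against the two measures, which are measurable even for the
  $\sigma$-algebra generated by the points near the cell.\<close>

section \<open>Convergence in probability as convergence along a filter\<close>

text \<open>An event holds eventually along this filter when it fails, for each $n$, only on a measurable set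
  whose probability tends to 0 with $n$. Convergence of real functions along the filter is thus
  convergence in outer probability, and sums, products and finite conjunctions of such statements
  are covered by the general theory of filters.\<close>

definition whp_filter :: "'w measure \<Rightarrow> (nat \<times> 'w) filter" where
  "whp_filter M = Abs_filter (\<lambda>P. \<exists>B. (\<forall>n. B n \<in> sets M) \<and> (\<lambda>n. measure M (B n)) \<longlonglongrightarrow> 0 \<and>
     (\<forall>n. \<forall>\<omega>\<in>space M - B n. P (n, \<omega>)))"

lemma eventually_whp_filter:
  "eventually P (whp_filter M) \<longleftrightarrow>
     (\<exists>B. (\<forall>n. B n \<in> sets M) \<and> (\<lambda>n. measure M (B n)) \<longlonglongrightarrow> 0 \<and>
       (\<forall>n. \<forall>\<omega>\<in>space M - B n. P (n, \<omega>)))"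
  unfolding whp_filter_def
proof (rule eventually_Abs_filter, rule is_filter.intro, goal_cases)
  case 1
  show ?case by (rule exI[of _ "\<lambda>_. {}"]) auto
next
  case (2 P Q)
  then obtain B C where B: "\<forall>n. B n \<in> sets M" "(\<lambda>n. measure M (B n)) \<longlonglongrightarrow> 0"
      "\<forall>n. \<forall>\<omega>\<in>space M - B n. P (n, \<omega>)"
    and C: "\<forall>n. C n \<in> sets M" "(\<lambda>n. measure M (C n)) \<longlonglongrightarrow> 0"
      "\<forall>n. \<forall>\<omega>\<in>space M - C n. Q (n, \<omega>)" by blast
  have "(\<lambda>n. measure M (B n \<union> C n)) \<longlonglongrightarrow> 0"
  proof (rule tendsto_sandwich[OF _ _ tendsto_const])
    show "\<forall>\<^sub>F n in sequentially. measure M (B n \<union> C n) \<le> measure M (B n) + measure M (C n)"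
      using B(1) C(1) by (intro always_eventually allI measure_Un_le) auto
    show "(\<lambda>n. measure M (B n) + measure M (C n)) \<longlonglongrightarrow> 0"
      using tendsto_add[OF B(2) C(2)] by simp
  qed auto
  then show ?case using B C by (intro exI[of _ "\<lambda>n. B n \<union> C n"]) auto
next
  case (3 P Q)
  then show ?case by blast
qed

lemma eventually_whp_sequentially:
  assumes "eventually P sequentially"
  shows "eventually (\<lambda>(n, \<omega>). P n) (whp_filter M)"
  unfolding eventually_whp_filter
proof (intro exI conjI)
  let ?B = "\<lambda>n. if P n then {} else space M"
  show "(\<lambda>n. measure M (?B n)) \<longlonglongrightarrow> 0"
    by (rule tendsto_eventually, rule eventually_mono[OF assms]) auto
qed (auto split: if_splits)

lemma tendsto_whp_deterministic:
  assumes "(f \<longlongrightarrow> c) sequentially"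
  shows "((\<lambda>(n, \<omega>). f n) \<longlongrightarrow> c) (whp_filter M)"
proof (rule topological_tendstoI)
  fix S assume "open S" "c \<in> S"
  then show "\<forall>\<^sub>F x in whp_filter M. (case x of (n, \<omega>) \<Rightarrow> f n) \<in> S"
    using eventually_whp_sequentially[OF topological_tendstoD[OF assms, of S]]
    by (simp add: case_prod_unfold)
qed

lemma eventually_whp_AE:
  assumes "AE \<omega> in M. P \<omega>"
  shows "eventually (\<lambda>(n, \<omega>). P \<omega>) (whp_filter M)"
proof -
  from AE_E[OF assms] obtain Z where "{\<omega> \<in> space M. \<not> P \<omega>} \<subseteq> Z" "emeasure M Z = 0" "Z \<in> sets M" .
  then show ?thesis unfolding eventually_whp_filter
    by (intro exI[of _ "\<lambda>_. Z"]) (auto simp: measure_def)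
qed

lemma eventually_whp_space: "eventually (\<lambda>(n, \<omega>). \<omega> \<in> space M) (whp_filter M)"
  by (rule eventually_whp_AE) simp

lemma (in prob_space) tendsto_whp_L1:
  fixes X :: "nat \<Rightarrow> 'a \<Rightarrow> real"
  assumes int: "\<And>n. integrable M (X n)" and lim: "(\<lambda>n. expectation (\<lambda>\<omega>. \<bar>X n \<omega> - c\<bar>)) \<longlonglongrightarrow> 0"
  shows "((\<lambda>(n, \<omega>). X n \<omega>) \<longlongrightarrow> c) (whp_filter M)"
proof (rule tendstoI)
  fix e :: real assume e: "e > 0"
  let ?B = "\<lambda>n. {\<omega> \<in> space M. e \<le> \<bar>X n \<omega> - c\<bar>}"
  have m[measurable]: "X n \<in> borel_measurable M" for n using int by auto
  have le: "prob (?B n) \<le> expectation (\<lambda>\<omega>. \<bar>X n \<omega> - c\<bar>) / e" for n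
  proof -
    show ?thesis using integral_Markov_inequality_measure[of M "\<lambda>\<omega>. \<bar>X n \<omega> - c\<bar>" "space M" e] int e
      by simp
  qed
  have "(\<lambda>n. prob (?B n)) \<longlonglongrightarrow> 0"
  proof (rule tendsto_sandwich[OF _ _ tendsto_const])
    show "(\<lambda>n. expectation (\<lambda>\<omega>. \<bar>X n \<omega> - c\<bar>) / e) \<longlonglongrightarrow> 0"
      using tendsto_divide[OF lim tendsto_const, of e] e by simp
  qed (use le in auto)
  then show "\<forall>\<^sub>F x in whp_filter M. dist (case x of (n, \<omega>) \<Rightarrow> X n \<omega>) c < e"
    unfolding eventually_whp_filter by (intro exI[of _ ?B]) (auto simp: dist_real_def)
qed

text \<open>The event in the definition of convergence in probability lies in the exceptional set of the filter.\<close>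

lemma tendsto_in_prob_whp:
  assumes "prob_space M"
    and "\<And>\<epsilon>. \<epsilon> > 0 \<Longrightarrow> \<forall>\<^sub>F (n, \<omega>) in whp_filter M. dist (X n \<omega>) c \<le> \<epsilon>"
  shows "tendsto_in_prob M X c"
  unfolding tendsto_in_prob_def
proof (intro allI impI)
  interpret prob_space M by fact
  fix e :: real assume "e > 0"
  from assms(2)[OF this] obtain B where B: "\<And>n. B n \<in> sets M" "(\<lambda>n. measure M (B n)) \<longlonglongrightarrow> 0"
      "\<And>n \<omega>. \<omega>\<in>space M - B n \<Longrightarrow> dist (X n \<omega>) c \<le> e"
    unfolding eventually_whp_filter by auto
  show "(\<lambda>n. measure M {\<omega> \<in> space M. dist (X n \<omega>) c > e}) \<longlonglongrightarrow> 0"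
  proof (rule tendsto_sandwich[OF _ _ tendsto_const B(2)])
    have "{\<omega> \<in> space M. dist (X n \<omega>) c > e} \<subseteq> B n" for n
      using B(3) by force
    then show "\<forall>\<^sub>F n in sequentially. measure M {\<omega> \<in> space M. dist (X n \<omega>) c > e} \<le> measure M (B n)"
      using B(1) by (intro always_eventually allI finite_measure_mono) auto
  qed auto
qed

section \<open>A weak law of large numbers for mixing arrays\<close>

text \<open>Layer cake: $X = \int_0^L 1_{s<X}\,ds$ and likewise for $Y$, so by Fubini's theorem
  $E[XY]$ is the integral of $P(s<X, t<Y)$ over $[0,L]^2$. Replacing the joint probabilities by
  products costs at most $a$ at every point of this square. Only the upper bound matters, as it
  serves to bound variances.\<close>

lemma (in prob_space) expectation_product_le_of_mixing:
  fixes X Y :: "'a \<Rightarrow> real"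
  assumes [measurable]: "X \<in> borel_measurable M" "Y \<in> borel_measurable M"
    and X: "\<And>\<omega>. \<omega> \<in> space M \<Longrightarrow> 0 \<le> X \<omega> \<and> X \<omega> \<le> L"
    and Y: "\<And>\<omega>. \<omega> \<in> space M \<Longrightarrow> 0 \<le> Y \<omega> \<and> Y \<omega> \<le> L"
    and mix: "\<And>s t. 0 \<le> s \<Longrightarrow> s < L \<Longrightarrow> 0 \<le> t \<Longrightarrow> t < L \<Longrightarrow>
      prob {\<omega>\<in>space M. s < X \<omega> \<and> t < Y \<omega>} \<le> prob {\<omega>\<in>space M. s < X \<omega>} * prob {\<omega>\<in>space M. t < Y \<omega>} + a"
    and a: "0 \<le> a" and L: "0 \<le> L"
  shows "expectation (\<lambda>\<omega>. X \<omega> * Y \<omega>) \<le> expectation X * expectation Y + a * L\<^sup>2"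
proof -
  interpret L: sigma_finite_measure "lborel :: real measure" by (rule sigma_finite_lborel)
  interpret P: pair_sigma_finite M "lborel :: real measure" ..
  let ?I = "\<lambda>s. indicator {0..<L} s :: ennreal"
  let ?A = "\<lambda>s. {\<omega>\<in>space M. s < X \<omega>}" and ?B = "\<lambda>t. {\<omega>\<in>space M. t < Y \<omega>}"
  have len: "(\<integral>\<^sup>+s. ?I s \<partial>lborel) = ennreal L" using L by simp
  \<comment> \<open>The indicator of \<open>{0..<L}\<close> keeps the layer variable in a set of finite length, on which the error
    \<open>a\<close> can be integrated.\<close>
  have layer: "ennreal z = (\<integral>\<^sup>+s. ?I s * indicator {..<z} s \<partial>lborel)" if "0 \<le> z" "z \<le> L" for z
  proof -
    have "(\<integral>\<^sup>+s. ?I s * indicator {..<z} s \<partial>lborel) = (\<integral>\<^sup>+s. indicator {0..<z} s \<partial>lborel)"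
      using that by (intro nn_integral_cong) (auto simp: indicator_def)
    also have "\<dots> = ennreal z" using that by simp
    finally show ?thesis ..
  qed
  have iX: "integrable M X" and iY: "integrable M Y"
    using X Y by (auto intro!: integrable_const_bound[where B=L])
  have iXY: "integrable M (\<lambda>\<omega>. X \<omega> * Y \<omega>)"
    using X Y L by (intro integrable_const_bound[where B="L*L"] AE_I2) (auto simp: abs_mult intro!: mult_mono)
  have EX: "(\<integral>\<^sup>+s. ?I s * emeasure M {\<omega>\<in>space M. s < X \<omega>} \<partial>lborel) = ennreal (expectation X)"
    if Xm[measurable]: "X \<in> borel_measurable M" and X: "\<And>\<omega>. \<omega> \<in> space M \<Longrightarrow> 0 \<le> X \<omega> \<and> X \<omega> \<le> L"
      and iX: "integrable M X" for X :: "'a \<Rightarrow> real"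
  proof -
    let ?A = "\<lambda>s. {\<omega>\<in>space M. s < X \<omega>}"
    have "ennreal (expectation X) = (\<integral>\<^sup>+\<omega>. ennreal (X \<omega>) \<partial>M)"
      using X iX by (intro nn_integral_eq_integral[symmetric]) auto
    also have "\<dots> = (\<integral>\<^sup>+\<omega>. (\<integral>\<^sup>+s. ?I s * indicator {..<X \<omega>} s \<partial>lborel) \<partial>M)"
      using X by (intro nn_integral_cong layer) auto
    also have "\<dots> = (\<integral>\<^sup>+s. (\<integral>\<^sup>+\<omega>. ?I s * indicator {..<X \<omega>} s \<partial>M) \<partial>lborel)"
      by (rule P.Fubini'[symmetric]) (simp add: indicator_def)
    also have "\<dots> = (\<integral>\<^sup>+s. ?I s * emeasure M (?A s) \<partial>lborel)"
    proof (rule nn_integral_cong)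
      fix s
      have "(\<integral>\<^sup>+\<omega>. ?I s * indicator {..<X \<omega>} s \<partial>M) = ?I s * (\<integral>\<^sup>+\<omega>. indicator (?A s) \<omega> \<partial>M)"
        by (subst nn_integral_cmult[symmetric]) (auto simp: indicator_def intro!: nn_integral_cong)
      then show "(\<integral>\<^sup>+\<omega>. ?I s * indicator {..<X \<omega>} s \<partial>M) = ?I s * emeasure M (?A s)" by simp
    qed
    finally show ?thesis by simp
  qed
  have "ennreal (expectation (\<lambda>\<omega>. X \<omega> * Y \<omega>)) = (\<integral>\<^sup>+\<omega>. ennreal (X \<omega> * Y \<omega>) \<partial>M)"
    using X Y iXY by (intro nn_integral_eq_integral[symmetric]) auto
  also have "\<dots> = (\<integral>\<^sup>+\<omega>. (\<integral>\<^sup>+s. ?I s * indicator {..<X \<omega>} s * ennreal (Y \<omega>) \<partial>lborel) \<partial>M)"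
    using X Y by (intro nn_integral_cong) (simp add: nn_integral_multc layer[symmetric] ennreal_mult)
  also have "\<dots> = (\<integral>\<^sup>+s. (\<integral>\<^sup>+\<omega>. ?I s * indicator {..<X \<omega>} s * ennreal (Y \<omega>) \<partial>M) \<partial>lborel)"
    by (rule P.Fubini'[symmetric]) (simp add: indicator_def)
  also have "\<dots> = (\<integral>\<^sup>+s. (\<integral>\<^sup>+\<omega>. (\<integral>\<^sup>+t. ?I s * indicator {..<X \<omega>} s * (?I t * indicator {..<Y \<omega>} t) \<partial>lborel) \<partial>M) \<partial>lborel)"
    using Y by (intro nn_integral_cong) (simp add: nn_integral_cmult layer[symmetric])
  also have "\<dots> = (\<integral>\<^sup>+s. (\<integral>\<^sup>+t. (\<integral>\<^sup>+\<omega>. ?I s * indicator {..<X \<omega>} s * (?I t * indicator {..<Y \<omega>} t) \<partial>M) \<partial>lborel) \<partial>lborel)"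
    by (intro nn_integral_cong P.Fubini'[symmetric]) (simp add: indicator_def)
  also have "\<dots> \<le> (\<integral>\<^sup>+s. (\<integral>\<^sup>+t. (?I s * emeasure M (?A s)) * (?I t * emeasure M (?B t)) + ennreal a * ?I s * ?I t \<partial>lborel) \<partial>lborel)"
  proof (intro nn_integral_mono)
    fix s t
    have *: "(\<integral>\<^sup>+\<omega>. ?I s * indicator {..<X \<omega>} s * (?I t * indicator {..<Y \<omega>} t) \<partial>M)
        = ?I s * ?I t * emeasure M {\<omega>\<in>space M. s < X \<omega> \<and> t < Y \<omega>}"
      by (subst nn_integral_cmult_indicator[symmetric]) (auto simp: indicator_def intro!: nn_integral_cong)
    show "(\<integral>\<^sup>+\<omega>. ?I s * indicator {..<X \<omega>} s * (?I t * indicator {..<Y \<omega>} t) \<partial>M)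
       \<le> (?I s * emeasure M (?A s)) * (?I t * emeasure M (?B t)) + ennreal a * ?I s * ?I t"
    proof (cases "s \<in> {0..<L} \<and> t \<in> {0..<L}")
      case True
      then show ?thesis unfolding * using mix[of s t] a
        by (simp add: emeasure_eq_measure ennreal_mult''[symmetric] ennreal_plus[symmetric] del: ennreal_plus)
    qed (unfold *, auto)
  qed
  also have "\<dots> = (\<integral>\<^sup>+s. (?I s * emeasure M (?A s)) * ennreal (expectation Y) + ennreal a * ?I s * ennreal L \<partial>lborel)"
    using Y iY by (intro nn_integral_cong)
      (simp add: nn_integral_add nn_integral_cmult EX L)
  also have "\<dots> = ennreal (expectation X) * ennreal (expectation Y) + ennreal a * ennreal L * ennreal L"
    using X iX by (simp add: nn_integral_add nn_integral_cmult nn_integral_multc EX L)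
  also have "\<dots> = ennreal (expectation X * expectation Y + a * L\<^sup>2)"
    using a L X Y by (simp add: ennreal_mult'[symmetric] ennreal_mult''[symmetric] power2_eq_square mult.assoc integral_nonneg_AE)
  finally show ?thesis
    using a L X Y by (subst (asm) ennreal_le_iff) (auto intro!: add_nonneg_nonneg mult_nonneg_nonneg integral_nonneg_AE)
qed

lemma sum_two_sided_le_suminf:
  fixes a :: "nat \<Rightarrow> real"
  assumes a: "\<And>m. 0 \<le> a m" "summable a" and D: "finite D"
  shows "(\<Sum>l'\<in>D. if l = l' then 1 else a (nat \<bar>l - l'\<bar>)) \<le> 1 + 2 * suminf a"
proof -
  let ?f = "\<lambda>l'. a (nat \<bar>l - l'\<bar>)"
  have one: "sum ?f E \<le> suminf a" if E: "E \<subseteq> D" "inj_on (\<lambda>l'. nat \<bar>l - l'\<bar>) E" for E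
  proof -
    have "finite E" using E D finite_subset by auto
    have "sum ?f E = sum a ((\<lambda>l'. nat \<bar>l - l'\<bar>) ` E)"
      using sum.reindex[OF E(2), of a] by (simp add: o_def)
    also have "\<dots> \<le> suminf a" using a \<open>finite E\<close> by (intro sum_le_suminf) auto
    finally show ?thesis .
  qed
  have "(\<Sum>l'\<in>D. if l = l' then 1 else ?f l')
      \<le> (\<Sum>l'\<in>D. (if l = l' then 1 else 0) + ((if l' < l then ?f l' else 0) + (if l < l' then ?f l' else 0)))"
    using a by (intro sum_mono) auto
  also have "\<dots> = (\<Sum>l'\<in>D. if l = l' then 1 else 0)
      + (sum ?f {l'\<in>D. l' < l} + sum ?f {l'\<in>D. l < l'})"
    using D by (simp add: sum.distrib sum.inter_filter cong: if_cong)
  also have "\<dots> \<le> 1 + (suminf a + suminf a)"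
    using D by (intro add_mono one) (auto simp: inj_on_def sum.delta')
  finally show ?thesis by simp
qed

lemma (in prob_space) expectation_abs_le_sqrt:
  fixes X :: "'a \<Rightarrow> real"
  assumes "integrable M X" "integrable M (\<lambda>\<omega>. (X \<omega>)\<^sup>2)"
  shows "expectation (\<lambda>\<omega>. \<bar>X \<omega>\<bar>) \<le> sqrt (expectation (\<lambda>\<omega>. (X \<omega>)\<^sup>2))"
proof (rule real_le_rsqrt)
  have "variance (\<lambda>\<omega>. \<bar>X \<omega>\<bar>) = expectation (\<lambda>\<omega>. \<bar>X \<omega>\<bar>\<^sup>2) - (expectation (\<lambda>\<omega>. \<bar>X \<omega>\<bar>))\<^sup>2"
    using assms by (intro variance_eq) auto
  then show "(expectation (\<lambda>\<omega>. \<bar>X \<omega>\<bar>))\<^sup>2 \<le> expectation (\<lambda>\<omega>. (X \<omega>)\<^sup>2)"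
    using variance_positive[of "\<lambda>\<omega>. \<bar>X \<omega>\<bar>"] by simp
qed

text \<open>The mean of $|S|$ is at most the root of the variance of $S$. In the double sum of covariances each
  row is bounded by $L^2$ for the diagonal plus twice $L^2 \sum_m a_m$, one for each side.\<close>

lemma (in prob_space) bounded_mixing_sum_deviation:
  fixes T :: "int \<Rightarrow> 'a \<Rightarrow> real" and a :: "nat \<Rightarrow> real"
  assumes [measurable]: "\<And>l. T l \<in> borel_measurable M"
    and T: "\<And>l \<omega>. \<omega> \<in> space M \<Longrightarrow> 0 \<le> T l \<omega> \<and> T l \<omega> \<le> L"
    and mix: "\<And>l l' s t. l \<noteq> l' \<Longrightarrow> 0 \<le> s \<Longrightarrow> s < L \<Longrightarrow> 0 \<le> t \<Longrightarrow> t < L \<Longrightarrow>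
      prob {\<omega>\<in>space M. s < T l \<omega> \<and> t < T l' \<omega>}
        \<le> prob {\<omega>\<in>space M. s < T l \<omega>} * prob {\<omega>\<in>space M. t < T l' \<omega>} + a (nat \<bar>l - l'\<bar>)"
    and a: "\<And>m. 0 \<le> a m" "summable a"
    and L: "0 \<le> L" and D: "finite D"
  shows "expectation (\<lambda>\<omega>. \<bar>\<Sum>l\<in>D. T l \<omega> - expectation (T l)\<bar>)
    \<le> L * sqrt ((1 + 2 * suminf a) * card D)"
proof -
  let ?c = "\<lambda>l. expectation (T l)"
  let ?w = "\<lambda>l l'. if l = l' then 1 else a (nat \<bar>l - l'\<bar>)"
  have iT[simp]: "integrable M (T l)" for l
    using T by (auto intro!: integrable_const_bound[where B=L])
  have iTT[simp]: "integrable M (\<lambda>\<omega>. T l \<omega> * T l' \<omega>)" for l l'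
    using T L by (intro integrable_const_bound[where B="L*L"] AE_I2) (auto simp: abs_mult intro!: mult_mono)
  have cov: "expectation (\<lambda>\<omega>. (T l \<omega> - ?c l) * (T l' \<omega> - ?c l')) = expectation (\<lambda>\<omega>. T l \<omega> * T l' \<omega>) - ?c l * ?c l'"
    for l l'
  proof -
    have "(\<lambda>\<omega>. (T l \<omega> - ?c l) * (T l' \<omega> - ?c l'))
       = (\<lambda>\<omega>. T l \<omega> * T l' \<omega> - ?c l' * T l \<omega> - ?c l * T l' \<omega> + ?c l * ?c l')"
      by (auto simp: algebra_simps)
    then show ?thesis by (simp add: prob_space)
  qed
  have cov_le: "expectation (\<lambda>\<omega>. T l \<omega> * T l' \<omega>) - ?c l * ?c l' \<le> ?w l l' * L\<^sup>2" for l l'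
  proof (cases "l = l'")
    case True
    have "expectation (\<lambda>\<omega>. T l \<omega> * T l \<omega>) \<le> expectation (\<lambda>\<omega>. L * L)"
      using T L by (intro integral_mono) (auto intro!: mult_mono)
    then have "expectation (\<lambda>\<omega>. T l \<omega> * T l \<omega>) - ?c l * ?c l \<le> L * L"
      using zero_le_square[of "?c l"] by (simp add: prob_space del: zero_le_square)
    then show ?thesis using True by (simp add: power2_eq_square)
  next
    case False
    then show ?thesis
      using expectation_product_le_of_mixing[of "T l" "T l'" L "a (nat \<bar>l - l'\<bar>)"] T mix[OF False] a L
      by auto
  qed
  let ?S = "\<lambda>\<omega>. \<Sum>l\<in>D. T l \<omega> - ?c l"
  have sq: "(?S \<omega>)\<^sup>2 = (\<Sum>l\<in>D. \<Sum>l'\<in>D. (T l \<omega> - ?c l) * (T l' \<omega> - ?c l'))" for \<omega>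
    by (simp add: power2_eq_square sum_product)
  have icov: "integrable M (\<lambda>\<omega>. (T l \<omega> - ?c l) * (T l' \<omega> - ?c l'))" for l l'
    by (simp add: algebra_simps)
  have "expectation (\<lambda>\<omega>. (?S \<omega>)\<^sup>2) = (\<Sum>l\<in>D. \<Sum>l'\<in>D. expectation (\<lambda>\<omega>. (T l \<omega> - ?c l) * (T l' \<omega> - ?c l')))"
    unfolding sq using icov by (simp add: Bochner_Integration.integral_sum)
  also have "\<dots> \<le> (\<Sum>l\<in>D. \<Sum>l'\<in>D. ?w l l' * L\<^sup>2)"
    unfolding cov by (intro sum_mono cov_le)
  also have "\<dots> = (\<Sum>l\<in>D. L\<^sup>2 * (\<Sum>l'\<in>D. ?w l l'))"
    by (simp add: sum_distrib_left mult.commute)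
  also have "\<dots> \<le> (\<Sum>l\<in>D. L\<^sup>2 * (1 + 2 * suminf a))"
    using a D by (intro sum_mono mult_left_mono sum_two_sided_le_suminf) auto
  finally have "expectation (\<lambda>\<omega>. (?S \<omega>)\<^sup>2) \<le> L\<^sup>2 * ((1 + 2 * suminf a) * card D)"
    by (simp add: mult_ac)
  then have "sqrt (expectation (\<lambda>\<omega>. (?S \<omega>)\<^sup>2)) \<le> sqrt (L\<^sup>2 * ((1 + 2 * suminf a) * card D))"
    by (rule real_sqrt_le_mono)
  moreover have "sqrt (L\<^sup>2 * ((1 + 2 * suminf a) * card D)) = L * sqrt ((1 + 2 * suminf a) * card D)"
    unfolding real_sqrt_mult using L by (simp add: real_sqrt_abs)
  moreover have "integrable M (\<lambda>\<omega>. (?S \<omega>)\<^sup>2)"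
    unfolding sq using icov by auto
  ultimately show ?thesis
    using expectation_abs_le_sqrt[of ?S] by auto
qed

text \<open>Truncation at $L$ splits the error in three: the excess of the variables over $L$ and the resulting
  shift of the mean, each at most $\epsilon/4$ by uniform integrability, and the deviation of the
  average of the truncated variables, which is of order $1/\sqrt{k}$ for $k$ terms.\<close>

lemma (in prob_space) mixing_weak_law:
  fixes Y :: "int \<Rightarrow> 'a \<Rightarrow> real" and a :: "nat \<Rightarrow> real" and D :: "nat \<Rightarrow> int set"
  assumes Y: "\<And>l. integrable M (Y l)" "\<And>l \<omega>. \<omega> \<in> space M \<Longrightarrow> 0 \<le> Y l \<omega>"
    and mean: "\<And>l. expectation (Y l) = \<mu>"
    and ui: "\<And>\<epsilon>. 0 < \<epsilon> \<Longrightarrow> \<exists>L\<ge>0. \<forall>l. expectation (\<lambda>\<omega>. max 0 (Y l \<omega> - L)) \<le> \<epsilon>"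
    and mix: "\<And>l l' s t. l \<noteq> l' \<Longrightarrow>
      prob {\<omega>\<in>space M. s < Y l \<omega> \<and> t < Y l' \<omega>}
        \<le> prob {\<omega>\<in>space M. s < Y l \<omega>} * prob {\<omega>\<in>space M. t < Y l' \<omega>} + a (nat \<bar>l - l'\<bar>)"
    and a: "\<And>m. 0 \<le> a m" "summable a"
    and D: "\<And>n. finite (D n)" "filterlim (\<lambda>n. card (D n)) at_top sequentially"
  shows "(\<lambda>n. expectation (\<lambda>\<omega>. \<bar>(\<Sum>l\<in>D n. Y l \<omega>) / card (D n) - \<mu>\<bar>)) \<longlonglongrightarrow> 0"
proof (rule LIMSEQ_I)
  fix \<epsilon> :: real assume \<epsilon>: "0 < \<epsilon>"
  obtain L where L: "L \<ge> 0" "\<And>l. expectation (\<lambda>\<omega>. max 0 (Y l \<omega> - L)) \<le> \<epsilon> / 4"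
    using ui[of "\<epsilon> / 4"] \<epsilon> by auto
  have Ym[measurable]: "Y l \<in> borel_measurable M" for l using Y(1) by auto
  define T where "T l \<omega> = min (Y l \<omega>) L" for l \<omega>
  have Tm[measurable]: "T l \<in> borel_measurable M" for l unfolding T_def by simp
  have Tb: "0 \<le> T l \<omega> \<and> T l \<omega> \<le> L" if "\<omega> \<in> space M" for l \<omega>
    using Y(2)[OF that] L by (auto simp: T_def)
  have iT[simp]: "integrable M (T l)" for l
    using Tb by (auto intro!: integrable_const_bound[where B=L])
  note Y(1)[simp]
  let ?c = "\<lambda>l. expectation (T l)"
  have YT: "max 0 (Y l \<omega> - L) = Y l \<omega> - T l \<omega>" for l \<omega> by (auto simp: T_def)
  have c: "0 \<le> \<mu> - ?c l" "\<mu> - ?c l \<le> \<epsilon> / 4" for l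
    using L(2)[of l] mean[of l] Bochner_Integration.integral_nonneg[of M "\<lambda>\<omega>. Y l \<omega> - T l \<omega>"]
    by (auto simp: YT) (simp add: T_def)
  have dev: "expectation (\<lambda>\<omega>. \<bar>\<Sum>l\<in>D n. T l \<omega> - ?c l\<bar>) \<le> L * sqrt ((1 + 2 * suminf a) * card (D n))" for n
  proof (rule bounded_mixing_sum_deviation[OF Tm Tb _ a L(1) D(1)])
    fix l l' :: int and s t :: real assume "l \<noteq> l'" "s < L" "t < L"
    then show "prob {\<omega> \<in> space M. s < T l \<omega> \<and> t < T l' \<omega>}
         \<le> prob {\<omega> \<in> space M. s < T l \<omega>} * prob {\<omega> \<in> space M. t < T l' \<omega>} + a (nat \<bar>l - l'\<bar>)"
      using mix[of l l' s t] by (simp add: T_def)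
  qed
  have bound: "expectation (\<lambda>\<omega>. \<bar>(\<Sum>l\<in>D n. Y l \<omega>) / card (D n) - \<mu>\<bar>)
      \<le> \<epsilon> / 2 + L * sqrt (1 + 2 * suminf a) / sqrt (card (D n))"
    if pos: "card (D n) > 0" for n
  proof -
    let ?k = "real (card (D n))"
    have k: "?k > 0" using pos by simp
    have pt: "\<bar>(\<Sum>l\<in>D n. Y l \<omega>) / ?k - \<mu>\<bar>
        \<le> ((\<Sum>l\<in>D n. Y l \<omega> - T l \<omega>) + \<bar>\<Sum>l\<in>D n. T l \<omega> - ?c l\<bar> + (\<Sum>l\<in>D n. \<mu> - ?c l)) / ?k" for \<omega>
    proof -
      have "(\<Sum>l\<in>D n. Y l \<omega>) / ?k - \<mu> = ((\<Sum>l\<in>D n. Y l \<omega>) - ?k * \<mu>) / ?k"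
        using k by (simp add: field_simps)
      also have "(\<Sum>l\<in>D n. Y l \<omega>) - ?k * \<mu> =
         (\<Sum>l\<in>D n. Y l \<omega> - T l \<omega>) + (\<Sum>l\<in>D n. T l \<omega> - ?c l) - (\<Sum>l\<in>D n. \<mu> - ?c l)"
        by (simp add: sum_subtractf)
      finally have eq: "\<bar>(\<Sum>l\<in>D n. Y l \<omega>) / ?k - \<mu>\<bar> =
         \<bar>(\<Sum>l\<in>D n. Y l \<omega> - T l \<omega>) + (\<Sum>l\<in>D n. T l \<omega> - ?c l) - (\<Sum>l\<in>D n. \<mu> - ?c l)\<bar> / ?k"
        by simp
      have "0 \<le> (\<Sum>l\<in>D n. Y l \<omega> - T l \<omega>)" by (intro sum_nonneg) (simp add: T_def)
      moreover have "0 \<le> (\<Sum>l\<in>D n. \<mu> - ?c l)" using c by (intro sum_nonneg) auto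
      ultimately show ?thesis unfolding eq using k by (intro divide_right_mono) auto
    qed
    have "expectation (\<lambda>\<omega>. \<bar>(\<Sum>l\<in>D n. Y l \<omega>) / ?k - \<mu>\<bar>)
        \<le> expectation (\<lambda>\<omega>. ((\<Sum>l\<in>D n. Y l \<omega> - T l \<omega>) + \<bar>\<Sum>l\<in>D n. T l \<omega> - ?c l\<bar> + (\<Sum>l\<in>D n. \<mu> - ?c l)) / ?k)"
      using pt by (intro integral_mono) auto
    also have "\<dots> = ((\<Sum>l\<in>D n. \<mu> - ?c l) + expectation (\<lambda>\<omega>. \<bar>\<Sum>l\<in>D n. T l \<omega> - ?c l\<bar>) + (\<Sum>l\<in>D n. \<mu> - ?c l)) / ?k"
      by (simp add: mean prob_space)
    also have "\<dots> \<le> ((\<Sum>l\<in>D n. \<epsilon> / 4) + L * sqrt ((1 + 2 * suminf a) * card (D n)) + (\<Sum>l\<in>D n. \<epsilon> / 4)) / ?k"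
      using c(2) dev k by (intro divide_right_mono add_mono sum_mono) auto
    also have "\<dots> = \<epsilon> / 2 + L * sqrt (1 + 2 * suminf a) * (sqrt ?k / ?k)"
      using k by (simp add: real_sqrt_mult add_divide_distrib)
    also have "sqrt ?k / ?k = 1 / sqrt ?k" by (simp add: sqrt_divide_self_eq inverse_eq_divide)
    finally show ?thesis by simp
  qed
  have lim: "(\<lambda>n. \<epsilon> / 2 + L * sqrt (1 + 2 * suminf a) / sqrt (card (D n))) \<longlonglongrightarrow> \<epsilon> / 2 + 0"
    by (intro tendsto_add tendsto_const tendsto_divide_0[OF tendsto_const] filterlim_at_top_imp_at_infinity
        filterlim_compose[OF sqrt_at_top] filterlim_compose[OF filterlim_real_sequentially] D(2))
  have "\<forall>\<^sub>F n in sequentially. \<epsilon> / 2 + L * sqrt (1 + 2 * suminf a) / sqrt (card (D n)) < \<epsilon>"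
    using order_tendstoD(2)[OF lim, of \<epsilon>] \<epsilon> by simp
  moreover have "\<forall>\<^sub>F n in sequentially. card (D n) > 0"
    using D(2)[unfolded filterlim_at_top, rule_format, of 1] by eventually_elim simp
  ultimately have "\<forall>\<^sub>F n in sequentially. norm (expectation (\<lambda>\<omega>. \<bar>(\<Sum>l\<in>D n. Y l \<omega>) / card (D n) - \<mu>\<bar>) - 0) < \<epsilon>"
  proof eventually_elim
    case (elim n)
    then show ?case using bound[of n] Bochner_Integration.integral_nonneg[of M "\<lambda>\<omega>. \<bar>(\<Sum>l\<in>D n. Y l \<omega>) / card (D n) - \<mu>\<bar>"]
      by simp
  qed
  then show "\<exists>no. \<forall>n\<ge>no. norm (expectation (\<lambda>\<omega>. \<bar>(\<Sum>l\<in>D n. Y l \<omega>) / card (D n) - \<mu>\<bar>) - 0) < \<epsilon>"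
    by (simp add: eventually_sequentially)
qed

section \<open>Locally finite integer-valued measures as point configurations\<close>

text \<open>One realisation of a point process.\<close>

locale point_configuration =
  fixes \<nu> :: "real measure"
  assumes sets_eq [measurable_cong, simp]: "sets \<nu> = sets borel"
    and integer_valued: "A \<in> sets borel \<Longrightarrow> emeasure \<nu> A \<in> \<nat> \<union> {\<infinity>}"
    and locally_finite: "A \<in> sets borel \<Longrightarrow> bounded A \<Longrightarrow> emeasure \<nu> A < \<infinity>"
begin

lemma space_eq [simp]: "space \<nu> = UNIV"
  using sets_eq_imp_space_eq[OF sets_eq] by simp

text \<open>Values are integers, so a set of measure less than 1 is null. Hence atoms have mass at
  least 1, and a decreasing sequence of sets with null intersection is eventually null.\<close>

lemma emeasure_less_1_iff: "A \<in> sets borel \<Longrightarrow> emeasure \<nu> A < 1 \<longleftrightarrow> emeasure \<nu> A = 0"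
  using integer_valued[of A] by (auto simp: Nats_def)

lemma emeasure_point_ge_1: "x \<in> points \<nu> \<Longrightarrow> 1 \<le> emeasure \<nu> {x}"
  using emeasure_less_1_iff[of "{x}"] by (auto simp: points_def not_less[symmetric])

lemma finite_points_bounded:
  assumes "bounded A"
  shows "finite (points \<nu> \<inter> A)"
proof (rule ccontr)
  assume inf: "infinite (points \<nu> \<inter> A)"
  obtain R where "\<forall>x\<in>A. norm x \<le> R" using assms unfolding bounded_iff by blast
  then have R: "A \<subseteq> cball 0 R" by auto
  have "emeasure \<nu> (cball 0 R) < \<infinity>" by (rule locally_finite) auto
  with integer_valued[of "cball 0 R"] obtain n :: nat where n: "emeasure \<nu> (cball 0 R) = of_nat n"
    by (auto simp: Nats_def)
  obtain F where F: "F \<subseteq> points \<nu> \<inter> A" "finite F" "card F = Suc n"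
    using infinite_arbitrarily_large[OF inf] by blast
  have "of_nat (Suc n) = (\<Sum>x\<in>F. 1 :: ennreal)" using F by simp
  also have "\<dots> \<le> (\<Sum>x\<in>F. emeasure \<nu> {x})" using F by (intro sum_mono emeasure_point_ge_1) auto
  also have "\<dots> = emeasure \<nu> F" using F by (intro emeasure_eq_sum_singleton[symmetric]) auto
  also have "\<dots> \<le> emeasure \<nu> (cball 0 R)" using F R by (intro emeasure_mono) auto
  finally show False unfolding n by (simp only: of_nat_le_iff)
qed

lemma countable_points: "countable (points \<nu>)"
proof -
  have "\<exists>n. x \<in> cball 0 (real n)" for x :: real
    using real_arch_simple[of "norm x"] by simp
  then have "points \<nu> = (\<Union>n. points \<nu> \<inter> cball 0 (real n))" by blast
  moreover have "countable (\<Union>n. points \<nu> \<inter> cball 0 (real n))"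
    by (rule countable_UN) (auto intro: countable_finite finite_points_bounded)
  ultimately show ?thesis by simp
qed

lemma points_borel [measurable]: "points \<nu> \<in> sets borel"
  by (rule sets.countable) (auto intro: countable_points)

lemma sigma_finite: "sigma_finite_measure \<nu>"
proof
  have "emeasure \<nu> (cball 0 (real n)) \<noteq> \<infinity>" for n
    using locally_finite[of "cball 0 (real n)"] by (simp add: less_top)
  moreover have "\<exists>n. x \<in> cball 0 (real n)" for x :: real
    using real_arch_simple[of "norm x"] by simp
  ultimately show "\<exists>F. countable F \<and> F \<subseteq> sets \<nu> \<and> \<Union> F = space \<nu> \<and> (\<forall>a\<in>F. emeasure \<nu> a \<noteq> \<infinity>)"
    by (intro exI[of _ "range (\<lambda>n::nat. cball 0 (real n))"]) (auto simp del: mem_cball)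
qed

text \<open>Off its atoms the measure of the balls around any point decreases to 0, hence is less than 1 and so
  vanishes for a small ball. By the Lindelof property countably many such balls cover the line.\<close>

lemma emeasure_outside_points: "emeasure \<nu> (UNIV - points \<nu>) = 0"
proof -
  define F where "F = {U. open U \<and> emeasure \<nu> (U - points \<nu>) = 0}"
  have "\<exists>U\<in>F. x \<in> U" for x
  proof -
    let ?B = "\<lambda>n. ball x (1 / Suc n) - points \<nu>"
    have "(\<lambda>n. emeasure \<nu> (?B n)) \<longlonglongrightarrow> emeasure \<nu> (\<Inter>n. ?B n)"
    proof (rule Lim_emeasure_decseq)
      show "decseq ?B"
        unfolding decseq_def by (intro allI impI Diff_mono subset_ball order_refl) (simp add: frac_le)
      have "emeasure \<nu> (?B n) < \<infinity>" for n
        by (rule locally_finite) (auto intro: bounded_diff)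
      then show "emeasure \<nu> (?B n) \<noteq> \<infinity>" for n by (simp add: less_top)
    qed auto
    moreover have "(\<Inter>n. ?B n) \<subseteq> {x} - points \<nu>"
    proof
      fix y assume y: "y \<in> (\<Inter>n. ?B n)"
      have "y = x"
      proof (rule ccontr)
        assume "y \<noteq> x"
        then obtain n where "1 / real (Suc n) < dist x y"
          using reals_Archimedean[of "dist x y"] by (auto simp: inverse_eq_divide)
        moreover have "dist x y < 1 / real (Suc n)" using y by auto
        ultimately show False by simp
      qed
      then show "y \<in> {x} - points \<nu>" using y by auto
    qed
    then have "emeasure \<nu> (\<Inter>n. ?B n) \<le> emeasure \<nu> ({x} - points \<nu>)"
      by (rule emeasure_mono) auto
    moreover have "emeasure \<nu> ({x} - points \<nu>) = 0"
    proof (cases "x \<in> points \<nu>")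
      case False
      then have "{x} - points \<nu> = {x}" "emeasure \<nu> {x} = 0" by (auto simp: points_def)
      then show ?thesis by simp
    qed simp
    ultimately have "(\<lambda>n. emeasure \<nu> (?B n)) \<longlonglongrightarrow> 0" by simp
    then have "\<forall>\<^sub>F n in sequentially. emeasure \<nu> (?B n) < 1"
      by (rule order_tendstoD) simp
    then obtain n where "emeasure \<nu> (?B n) < 1" by (auto simp: eventually_sequentially)
    then have "ball x (1 / Suc n) \<in> F" by (simp add: F_def emeasure_less_1_iff)
    then show ?thesis by (rule bexI[rotated]) simp
  qed
  then have "\<Union>F = UNIV" by auto
  moreover obtain G where G: "G \<subseteq> F" "countable G" "\<Union>G = \<Union>F"
    using Lindelof[of F] by (auto simp: F_def)
  ultimately have eq: "UNIV - points \<nu> = (\<Union>U\<in>G. U - points \<nu>)" by auto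
  have "U - points \<nu> \<in> null_sets \<nu>" if "U \<in> G" for U
  proof -
    from that G have "open U" "emeasure \<nu> (U - points \<nu>) = 0" by (auto simp: F_def)
    then show ?thesis by (intro null_setsI) auto
  qed
  then have "(\<Union>U\<in>G. U - points \<nu>) \<in> null_sets \<nu>"
    using G by (intro null_sets_UN') auto
  then show ?thesis by (auto simp: eq)
qed

lemma emeasure_eq_count_points:
  assumes simple: "\<And>x. emeasure \<nu> {x} \<le> 1" and A: "A \<in> sets borel"
  shows "emeasure \<nu> A = emeasure (count_space (points \<nu>)) (A \<inter> points \<nu>)"
proof -
  have [measurable]: "A \<in> sets borel" by fact
  have one: "emeasure \<nu> {x} = 1" if "x \<in> points \<nu>" for x
    using simple emeasure_point_ge_1[OF that] by (rule antisym)
  have "emeasure \<nu> A = emeasure \<nu> ((A \<inter> points \<nu>) \<union> (A - points \<nu>))"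
    by (rule arg_cong[where f="emeasure \<nu>"]) auto
  also have "\<dots> = emeasure \<nu> (A \<inter> points \<nu>)"
  proof (rule emeasure_Un_null_set)
    have "emeasure \<nu> (A - points \<nu>) \<le> emeasure \<nu> (UNIV - points \<nu>)"
      by (rule emeasure_mono) auto
    then show "A - points \<nu> \<in> null_sets \<nu>" by (auto simp: emeasure_outside_points)
  qed auto
  also have "\<dots> = (\<integral>\<^sup>+x. emeasure \<nu> {x} \<partial>count_space (A \<inter> points \<nu>))"
    by (rule emeasure_countable_singleton) (auto intro: countable_points)
  also have "\<dots> = (\<integral>\<^sup>+x. 1 \<partial>count_space (A \<inter> points \<nu>))"
    using one by (intro nn_integral_cong) auto
  also have "\<dots> = emeasure (count_space (points \<nu>)) (A \<inter> points \<nu>)"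
    by (simp add: nn_integral_const emeasure_count_space)
  finally show ?thesis .
qed

lemma nn_integral_eq_count_points:
  assumes simple: "\<And>x. emeasure \<nu> {x} \<le> 1" and [measurable]: "f \<in> borel_measurable borel"
  shows "(\<integral>\<^sup>+x. f x \<partial>\<nu>) = (\<integral>\<^sup>+x. f x \<partial>count_space (points \<nu>))"
proof -
  have "\<nu> = distr (count_space (points \<nu>)) borel (\<lambda>x. x)"
  proof (rule measure_eqI)
    fix A assume "A \<in> sets \<nu>"
    then have "A \<in> sets borel" by simp
    then show "emeasure \<nu> A = emeasure (distr (count_space (points \<nu>)) borel (\<lambda>x. x)) A"
      by (simp add: emeasure_eq_count_points[OF simple] emeasure_distr Int_commute vimage_def Int_def conj_commute)
  qed simp
  then have "(\<integral>\<^sup>+x. f x \<partial>\<nu>) = (\<integral>\<^sup>+x. f x \<partial>distr (count_space (points \<nu>)) borel (\<lambda>x. x))" by simp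
  also have "\<dots> = (\<integral>\<^sup>+x. f x \<partial>count_space (points \<nu>))" by (rule nn_integral_distr) auto
  finally show ?thesis .
qed

end

text \<open>The measures need not be subprobabilities, nor bounded uniformly in the outcome, which is why the
  theory of probability kernels does not apply.\<close>

lemma measurable_nn_integral_of_measurable_emeasure:
  assumes sets: "\<And>\<omega>. \<omega> \<in> space M \<Longrightarrow> sets (\<kappa> \<omega>) = sets K"
    and meas: "\<And>A. A \<in> sets K \<Longrightarrow> (\<lambda>\<omega>. emeasure (\<kappa> \<omega>) A) \<in> borel_measurable M"
    and f: "f \<in> borel_measurable K"
  shows "(\<lambda>\<omega>. \<integral>\<^sup>+x. f x \<partial>\<kappa> \<omega>) \<in> borel_measurable M"
  using f
proof (induct rule: borel_measurable_induct)
  case (cong f g)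
  then have "(\<integral>\<^sup>+x. f x \<partial>\<kappa> \<omega>) = (\<integral>\<^sup>+x. g x \<partial>\<kappa> \<omega>)" if "\<omega> \<in> space M" for \<omega>
    using sets_eq_imp_space_eq[OF sets[OF that]] by (intro nn_integral_cong) auto
  then show ?case using cong(4) by (simp cong: measurable_cong)
next
  case (set A)
  then show ?case
    using meas[OF set] sets by (subst measurable_cong[where g="\<lambda>\<omega>. emeasure (\<kappa> \<omega>) A"]) (auto)
next
  case (mult u c)
  then have "(\<integral>\<^sup>+x. c * u x \<partial>\<kappa> \<omega>) = c * (\<integral>\<^sup>+x. u x \<partial>\<kappa> \<omega>)" if "\<omega> \<in> space M" for \<omega>
    by (intro nn_integral_cmult) (simp add: measurable_cong_sets[OF sets[OF that] refl])
  then show ?case using mult by (simp cong: measurable_cong)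
next
  case (add u v)
  then have "(\<integral>\<^sup>+x. v x + u x \<partial>\<kappa> \<omega>) = (\<integral>\<^sup>+x. v x \<partial>\<kappa> \<omega>) + (\<integral>\<^sup>+x. u x \<partial>\<kappa> \<omega>)"
    if "\<omega> \<in> space M" for \<omega>
    by (intro nn_integral_add) (simp_all add: measurable_cong_sets[OF sets[OF that] refl])
  then show ?case using add by (simp cong: measurable_cong)
next
  case (seq U)
  then have "(\<integral>\<^sup>+x. (SUP i. U i) x \<partial>\<kappa> \<omega>) = (SUP i. \<integral>\<^sup>+x. U i x \<partial>\<kappa> \<omega>)"
    if "\<omega> \<in> space M" for \<omega>
    unfolding SUP_apply
    by (intro nn_integral_monotone_convergence_SUP) (simp_all add: measurable_cong_sets[OF sets[OF that] refl])
  then show ?case using seq by (simp cong: measurable_cong)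
qed

text \<open>Rectangles form an intersection-stable generator on which the product measure is a product of
  measurable functions; finiteness makes the class of good sets closed under complements.\<close>

lemma measurable_emeasure_pair_kernel:
  fixes R1 R2 :: "'w \<Rightarrow> real measure"
  assumes sets: "\<And>\<omega>. \<omega> \<in> space M \<Longrightarrow> sets (R1 \<omega>) = sets borel" "\<And>\<omega>. \<omega> \<in> space M \<Longrightarrow> sets (R2 \<omega>) = sets borel"
    and fin: "\<And>\<omega>. \<omega> \<in> space M \<Longrightarrow> finite_measure (R1 \<omega>)" "\<And>\<omega>. \<omega> \<in> space M \<Longrightarrow> finite_measure (R2 \<omega>)"
    and meas: "\<And>A. A \<in> sets borel \<Longrightarrow> (\<lambda>\<omega>. emeasure (R1 \<omega>) A) \<in> borel_measurable M"
       "\<And>A. A \<in> sets borel \<Longrightarrow> (\<lambda>\<omega>. emeasure (R2 \<omega>) A) \<in> borel_measurable M"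
    and A: "A \<in> sets (borel \<Otimes>\<^sub>M borel)"
  shows "(\<lambda>\<omega>. emeasure (R1 \<omega> \<Otimes>\<^sub>M R2 \<omega>) A) \<in> borel_measurable M"
proof -
  let ?K = "borel \<Otimes>\<^sub>M borel :: (real \<times> real) measure"
  let ?G = "{A \<times> B | A B. A \<in> sets borel \<and> B \<in> sets borel} :: (real \<times> real) set set"
  have setsK: "sets (R1 \<omega> \<Otimes>\<^sub>M R2 \<omega>) = sets ?K" if "\<omega> \<in> space M" for \<omega>
    using sets[OF that] by (rule sets_pair_measure_cong)
  have gen: "sets ?K = sigma_sets UNIV ?G"
    by (simp add: sets_pair_measure)
  have rect: "emeasure (R1 \<omega> \<Otimes>\<^sub>M R2 \<omega>) (A \<times> B) = emeasure (R1 \<omega>) A * emeasure (R2 \<omega>) B"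
    if "\<omega> \<in> space M" "A \<in> sets borel" "B \<in> sets borel" for \<omega> A B
  proof -
    interpret R2: finite_measure "R2 \<omega>" using fin that by simp
    show ?thesis using that sets by (intro R2.emeasure_pair_measure_Times) auto
  qed
  have finK: "finite_measure (R1 \<omega> \<Otimes>\<^sub>M R2 \<omega>)" if "\<omega> \<in> space M" for \<omega>
    using fin that by (intro finite_measure_pair_measure) auto
  have Int: "Int_stable ?G"
    unfolding Int_stable_def
  proof safe
    fix A B A' B' :: "real set"
    assume "A \<in> sets borel" "B \<in> sets borel" "A' \<in> sets borel" "B' \<in> sets borel"
    then show "\<exists>C D. (A \<times> B) \<inter> (A' \<times> B') = C \<times> D \<and> C \<in> sets borel \<and> D \<in> sets borel"
      by (intro exI[of _ "A \<inter> A'"] exI[of _ "B \<inter> B'"]) auto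
  qed
  have G: "?G \<subseteq> Pow UNIV" by simp
  show ?thesis
    using Int G A[unfolded gen]
  proof (induct rule: sigma_sets_induct_disjoint)
    case (basic A)
    then obtain B C where BC: "A = B \<times> C" "B \<in> sets borel" "C \<in> sets borel" by auto
    have "(\<lambda>\<omega>. emeasure (R1 \<omega>) B * emeasure (R2 \<omega>) C) \<in> borel_measurable M"
      using meas BC by measurable
    then show ?case using BC by (simp add: rect cong: measurable_cong)
  next
    case empty
    then show ?case by simp
  next
    case (compl A)
    have U: "UNIV = (UNIV :: real set) \<times> (UNIV :: real set)" by simp
    have "(\<lambda>\<omega>. emeasure (R1 \<omega>) UNIV * emeasure (R2 \<omega>) UNIV - emeasure (R1 \<omega> \<Otimes>\<^sub>M R2 \<omega>) A) \<in> borel_measurable M"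
      using meas[of UNIV] compl(2) by measurable
    moreover have "emeasure (R1 \<omega> \<Otimes>\<^sub>M R2 \<omega>) (UNIV - A)
        = emeasure (R1 \<omega>) UNIV * emeasure (R2 \<omega>) UNIV - emeasure (R1 \<omega> \<Otimes>\<^sub>M R2 \<omega>) A" if w: "\<omega> \<in> space M" for \<omega>
    proof -
      interpret finite_measure "R1 \<omega> \<Otimes>\<^sub>M R2 \<omega>" using finK w .
      have "space (R1 \<omega> \<Otimes>\<^sub>M R2 \<omega>) = UNIV"
        using sets_eq_imp_space_eq[OF setsK[OF w]] by (simp add: space_pair_measure)
      then show ?thesis
        using emeasure_compl[of A "R1 \<omega> \<Otimes>\<^sub>M R2 \<omega>"] compl(1) rect[OF w, of UNIV UNIV]
        by (simp add: setsK[OF w] gen)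
    qed
    ultimately show ?case by (simp cong: measurable_cong)
  next
    case (union F)
    have "(\<lambda>\<omega>. \<Sum>i. emeasure (R1 \<omega> \<Otimes>\<^sub>M R2 \<omega>) (F i)) \<in> borel_measurable M"
      using union(3) by measurable
    moreover have "emeasure (R1 \<omega> \<Otimes>\<^sub>M R2 \<omega>) (\<Union>i. F i) = (\<Sum>i. emeasure (R1 \<omega> \<Otimes>\<^sub>M R2 \<omega>) (F i))"
      if w: "\<omega> \<in> space M" for \<omega>
      using union by (intro suminf_emeasure[symmetric]) (auto simp: setsK[OF w] gen)
    ultimately show ?case by (simp cong: measurable_cong)
  qed
qed

section \<open>Stationary pairs and their mean measures\<close>

(* Facts about the components are stated for N 1; rewriting 1 to Suc 0 would keep them from
   applying. *)
declare One_nat_def [simp del]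

lemma cell_ceiling: "x \<in> cell \<lceil>x - 1/2\<rceil>"
  unfolding cell_def by (simp, linarith)

lemma cell_unique:
  assumes "x \<in> cell l" "x \<in> cell l'"
  shows "l = l'"
proof -
  have "real_of_int l < real_of_int l' + 1" "real_of_int l' < real_of_int l + 1"
    using assms by (auto simp: cell_def)
  then show ?thesis by linarith
qed

lemma disjoint_cells: "disjoint_family_on cell D"
  using cell_unique by (auto simp: disjoint_family_on_def)

lemma cell_borel [measurable, simp]: "cell l \<in> sets borel"
  by (simp add: cell_def)

lemma bounded_cell [simp]: "bounded (cell l)"
  unfolding cell_def by (rule bounded_subset[OF bounded_closed_interval[of "real_of_int l - 1/2" "real_of_int l + 1/2"]]) auto

lemma emeasure_cell [simp]: "emeasure lborel (cell l) = 1"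
  by (simp add: cell_def)

lemma translate_cell: "(+) (real_of_int l) ` cell l' = cell (l + l')"
  by (force simp: cell_def image_iff intro: bexI[of _ "_ - real_of_int l"])

lemma finite_cell_cover:
  assumes "bounded A"
  shows "finite {l. cell l \<inter> A \<noteq> {}}"
proof -
  obtain R where R: "\<And>x. x \<in> A \<Longrightarrow> \<bar>x\<bar> \<le> R" using assms by (auto simp: bounded_iff)
  have "{l. cell l \<inter> A \<noteq> {}} \<subseteq> {\<lfloor>- R - 1\<rfloor>..\<lceil>R + 1\<rceil>}"
  proof
    fix l assume "l \<in> {l. cell l \<inter> A \<noteq> {}}"
    then obtain x where "x \<in> cell l" "x \<in> A" by auto
    with R[of x] show "l \<in> {\<lfloor>- R - 1\<rfloor>..\<lceil>R + 1\<rceil>}" by (auto simp: cell_def) linarith+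
  qed
  then show ?thesis by (rule finite_subset) simp
qed

lemma subset_cell_cover: "A \<subseteq> (\<Union>l\<in>{l. cell l \<inter> A \<noteq> {}}. cell l)"
  using cell_ceiling by blast

lemma translate_borel: "A \<in> sets borel \<Longrightarrow> (+) (u::real) ` A \<in> sets borel"
proof -
  assume A: "A \<in> sets borel"
  have "(+) u ` A = (\<lambda>x. x - u) -` A \<inter> space borel"
    by (auto simp: image_iff intro!: bexI[of _ "_ - u"])
  also have "\<dots> \<in> sets borel" by (rule measurable_sets[OF _ A]) simp
  finally show ?thesis .
qed

text \<open>The cross-intensity is a parameter here; for the pair of the theorem it is a multiple of the true
  cross-correlation function.\<close>

locale mixing_pair = prob_space M for M :: "'w measure" +
  fixes N :: "nat \<Rightarrow> 'w \<Rightarrow> real measure" and r \<delta> :: real and lam :: "real \<Rightarrow> real"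
  assumes process: "bivariate_point_process M N" "stationary M N"
    and positive_intensity: "intensity M N 1 > 0" "intensity M N 2 > 0"
    and r_pos: "r > 0"
    and cross_intensity: "is_cross_intensity M N lam"
    and delta_pos: "\<delta> > 0"
    and mixing: "summable (\<lambda>m. mixing_coeff M N 2 \<infinity> (Suc m) r powr (\<delta> / (2 + \<delta>)))"
    and moments: "\<And>i. i \<in> {1,2} \<Longrightarrow> finite_Lp_norm M (2 + \<delta>) (\<lambda>\<omega>. measure (N i \<omega>) (cell 0))"
begin

lemma point_process_component: "i \<in> {1,2} \<Longrightarrow> point_process M (N i)"
  using process(1) by (auto simp: bivariate_point_process_def)

lemma configuration: "i \<in> {1,2} \<Longrightarrow> \<omega> \<in> space M \<Longrightarrow> point_configuration (N i \<omega>)"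
  using point_process_component[of i] by (auto simp: point_process_def point_configuration_def)

lemma measurable_count: "i \<in> {1,2} \<Longrightarrow> A \<in> sets borel \<Longrightarrow> (\<lambda>\<omega>. emeasure (N i \<omega>) A) \<in> borel_measurable M"
  using point_process_component[of i] by (auto simp: point_process_def)

lemma finite_count: "i \<in> {1,2} \<Longrightarrow> \<omega> \<in> space M \<Longrightarrow> A \<in> sets borel \<Longrightarrow> bounded A \<Longrightarrow> emeasure (N i \<omega>) A < \<infinity>"
  using configuration[of i \<omega>] by (auto simp: point_configuration_def)

lemma AE_simple: "AE \<omega> in M. \<forall>i\<in>{1,2}. \<forall>x. emeasure (N i \<omega>) {x} \<le> 1"
proof -
  have "AE \<omega> in M. \<forall>x. emeasure (N 1 \<omega>) {x} + emeasure (N 2 \<omega>) {x} \<le> 1"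
    using process(1) by (auto simp: bivariate_point_process_def)
  then show ?thesis
  proof eventually_elim
    case (elim \<omega>)
    have "emeasure (N 1 \<omega>) {x} \<le> 1" "emeasure (N 2 \<omega>) {x} \<le> 1" for x
      by (rule order_trans[OF _ elim[rule_format, of x]], simp)+
    then show ?case by auto
  qed
qed

text \<open>Single counts serve to identify the mean measure, pairs of counts to bound contributions of cells
  to pair sums uniformly.\<close>

lemma stationary_two_counts:
  assumes i: "i \<in> {1,2}" "j \<in> {1,2}"
    and AB: "A \<in> sets borel" "bounded A" "B \<in> sets borel" "bounded B"
    and f: "f \<in> borel_measurable (borel \<Otimes>\<^sub>M borel)"
  shows "(\<integral>\<^sup>+\<omega>. f (emeasure (N i \<omega>) ((+) u ` A), emeasure (N j \<omega>) ((+) u ` B)) \<partial>M)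
    = (\<integral>\<^sup>+\<omega>. f (emeasure (N i \<omega>) A, emeasure (N j \<omega>) B) \<partial>M)"
proof -
  let ?P = "Pi\<^sub>M {..<2::nat} (\<lambda>_. borel) :: (nat \<Rightarrow> ennreal) measure"
  define k where "k n = (if n = 0 then i else j)" for n :: nat
  define C where "C n = (if n = 0 then A else B)" for n :: nat
  have k: "k n \<in> {1,2}" and C: "C n \<in> sets borel" "bounded (C n)" for n
    using i AB by (auto simp: k_def C_def)
  let ?X = "\<lambda>C \<omega>. \<lambda>n\<in>{..<2::nat}. emeasure (N (k n) \<omega>) (C n)"
  have X: "?X C' \<in> measurable M ?P" if "\<And>n. C' n \<in> sets borel" for C'
    using k that by (intro measurable_restrict measurable_count)
  have f': "(\<lambda>z. f (z 0, z 1)) \<in> borel_measurable ?P"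
    by (rule measurable_compose[OF _ f]) measurable
  have int: "(\<integral>\<^sup>+\<omega>. f (emeasure (N i \<omega>) (C' 0), emeasure (N j \<omega>) (C' 1)) \<partial>M)
      = (\<integral>\<^sup>+z. f (z 0, z 1) \<partial>distr M ?P (?X C'))" if "\<And>n. C' n \<in> sets borel" for C'
    by (subst nn_integral_distr[OF X[OF that]]) (use f' in \<open>auto simp: k_def\<close>)
  have "distr M ?P (?X C) = distr M ?P (?X (\<lambda>n. (+) u ` C n))"
    using process(2) k C unfolding stationary_def by blast
  then show ?thesis
    using int[of C] int[of "\<lambda>n. (+) u ` C n"] C by (simp add: C_def translate_borel)
qed

lemma stationary_count:
  assumes "i \<in> {1,2}" "A \<in> sets borel" "bounded A" "f \<in> borel_measurable borel"
  shows "(\<integral>\<^sup>+\<omega>. f (emeasure (N i \<omega>) ((+) u ` A)) \<partial>M) = (\<integral>\<^sup>+\<omega>. f (emeasure (N i \<omega>) A) \<partial>M)"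
proof -
  have "(\<lambda>z. f (fst z)) \<in> borel_measurable (borel \<Otimes>\<^sub>M borel :: (ennreal \<times> ennreal) measure)"
    using assms(4) by measurable
  from stationary_two_counts[OF assms(1,1,2,3,2,3) this] show ?thesis by simp
qed

text \<open>By stationarity the moment condition on the cell of 0 holds for every cell, and
  $x^2 \le 1 + x^{2+\delta}$.\<close>

lemma count_cell_square_finite:
  assumes i: "i \<in> {1,2}"
  shows "(\<integral>\<^sup>+\<omega>. (emeasure (N i \<omega>) (cell l))\<^sup>2 \<partial>M) < \<infinity>"
proof -
  have "(\<integral>\<^sup>+\<omega>. (emeasure (N i \<omega>) (cell l))\<^sup>2 \<partial>M) = (\<integral>\<^sup>+\<omega>. (emeasure (N i \<omega>) (cell 0))\<^sup>2 \<partial>M)"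
    using stationary_count[OF i, of "cell 0" "\<lambda>x. x\<^sup>2" "real_of_int l"] by (simp add: translate_cell)
  also have "\<dots> \<le> (\<integral>\<^sup>+\<omega>. 1 + ennreal (\<bar>measure (N i \<omega>) (cell 0)\<bar> powr (2 + \<delta>)) \<partial>M)"
  proof (rule nn_integral_mono)
    fix \<omega> assume w: "\<omega> \<in> space M"
    define x where "x = measure (N i \<omega>) (cell 0)"
    have x: "0 \<le> x" "emeasure (N i \<omega>) (cell 0) = ennreal x"
      using finite_count[OF i w, of "cell 0"] by (auto simp: x_def emeasure_eq_ennreal_measure)
    have "x\<^sup>2 \<le> 1 + x powr (2 + \<delta>)"
    proof (cases "x \<le> 1")
      case True
      then have "x\<^sup>2 \<le> 1" using x by (simp add: power_le_one)
      then show ?thesis by (simp add: add_increasing2)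
    next
      case False
      then have "x powr 2 \<le> x powr (2 + \<delta>)" using delta_pos by (intro powr_mono) auto
      then show ?thesis using False by simp
    qed
    then show "(emeasure (N i \<omega>) (cell 0))\<^sup>2 \<le> 1 + ennreal (\<bar>measure (N i \<omega>) (cell 0)\<bar> powr (2 + \<delta>))"
      unfolding x x_def[symmetric] using x
      by (simp add: ennreal_power ennreal_1[symmetric] ennreal_plus[symmetric] del: ennreal_plus ennreal_1)
  qed
  also have "\<dots> = 1 + (\<integral>\<^sup>+\<omega>. ennreal (\<bar>measure (N i \<omega>) (cell 0)\<bar> powr (2 + \<delta>)) \<partial>M)"
  proof -
    have [measurable]: "(\<lambda>\<omega>. measure (N i \<omega>) (cell 0)) \<in> borel_measurable M"
      unfolding measure_def using measurable_count[OF i] by simp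
    show ?thesis by (subst nn_integral_add) (auto simp: emeasure_space_1)
  qed
  also have "\<dots> < \<infinity>" using moments[OF i] by (simp add: finite_Lp_norm_def)
  finally show ?thesis .
qed

lemma mean_count_finite:
  assumes i: "i \<in> {1,2}" and A: "A \<in> sets borel" "bounded A"
  shows "(\<integral>\<^sup>+\<omega>. emeasure (N i \<omega>) A \<partial>M) < \<infinity>"
proof -
  let ?J = "{l. cell l \<inter> A \<noteq> {}}"
  note [measurable] = measurable_count[OF i]
  have J: "finite ?J" by (rule finite_cell_cover) fact
  have "(\<integral>\<^sup>+\<omega>. emeasure (N i \<omega>) A \<partial>M) \<le> (\<integral>\<^sup>+\<omega>. (\<Sum>l\<in>?J. 1 + (emeasure (N i \<omega>) (cell l))\<^sup>2) \<partial>M)"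
  proof (rule nn_integral_mono)
    fix \<omega> assume w: "\<omega> \<in> space M"
    interpret point_configuration "N i \<omega>" using configuration[OF i w] .
    have "emeasure (N i \<omega>) A \<le> emeasure (N i \<omega>) (\<Union>l\<in>?J. cell l)"
      by (intro emeasure_mono subset_cell_cover) (use J in auto)
    also have "\<dots> \<le> (\<Sum>l\<in>?J. emeasure (N i \<omega>) (cell l))"
      using J by (intro emeasure_subadditive_finite) auto
    also have "\<dots> \<le> (\<Sum>l\<in>?J. 1 + (emeasure (N i \<omega>) (cell l))\<^sup>2)"
    proof (rule sum_mono)
      fix l
      show "emeasure (N i \<omega>) (cell l) \<le> 1 + (emeasure (N i \<omega>) (cell l))\<^sup>2" (is "?x \<le> _")
      proof (cases "?x \<le> 1")
        case False
        then have "1 * ?x \<le> ?x * ?x" by (intro mult_right_mono) auto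
        then show ?thesis by (simp add: power2_eq_square add_increasing)
      qed (simp add: add_increasing2)
    qed
    finally show "emeasure (N i \<omega>) A \<le> (\<Sum>l\<in>?J. 1 + (emeasure (N i \<omega>) (cell l))\<^sup>2)" .
  qed
  also have "\<dots> = (\<Sum>l\<in>?J. 1 + (\<integral>\<^sup>+\<omega>. (emeasure (N i \<omega>) (cell l))\<^sup>2 \<partial>M))"
    by (simp add: nn_integral_sum nn_integral_add emeasure_space_1)
  also have "\<dots> < \<infinity>"
    using count_cell_square_finite[OF i] J by (simp add: less_top)
  finally show ?thesis .
qed

text \<open>The intensity measure of the component with index $i$.\<close>

definition mean_measure :: "nat \<Rightarrow> real measure" where
  "mean_measure i = measure_of UNIV (sets borel) (\<lambda>A. \<integral>\<^sup>+\<omega>. emeasure (N i \<omega>) A \<partial>M)"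

lemma sets_mean_measure [simp, measurable_cong]: "sets (mean_measure i) = sets borel"
  unfolding mean_measure_def using sets.sigma_sets_eq[of "borel :: real measure"]
  by (simp add: sets_measure_of_conv)

lemma space_mean_measure [simp]: "space (mean_measure i) = UNIV"
  using sets_eq_imp_space_eq[OF sets_mean_measure[of i]] by simp

lemma emeasure_mean_measure:
  assumes i: "i \<in> {1,2}" and A: "A \<in> sets borel"
  shows "emeasure (mean_measure i) A = (\<integral>\<^sup>+\<omega>. emeasure (N i \<omega>) A \<partial>M)"
proof (rule emeasure_measure_of[OF mean_measure_def])
  show "countably_additive (sets (mean_measure i)) (\<lambda>A. \<integral>\<^sup>+\<omega>. emeasure (N i \<omega>) A \<partial>M)"
  proof (rule countably_additiveI)
    fix F :: "nat \<Rightarrow> real set"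
    assume F: "range F \<subseteq> sets (mean_measure i)" "disjoint_family F"
    then have Fb: "F n \<in> sets borel" for n by auto
    have "(\<Sum>n. \<integral>\<^sup>+\<omega>. emeasure (N i \<omega>) (F n) \<partial>M) = (\<integral>\<^sup>+\<omega>. (\<Sum>n. emeasure (N i \<omega>) (F n)) \<partial>M)"
      using Fb by (intro nn_integral_suminf[symmetric] measurable_count[OF i])
    also have "\<dots> = (\<integral>\<^sup>+\<omega>. emeasure (N i \<omega>) (\<Union>n. F n) \<partial>M)"
    proof (intro nn_integral_cong suminf_emeasure)
      fix \<omega> assume "\<omega> \<in> space M"
      then interpret point_configuration "N i \<omega>" using configuration[OF i] by simp
      show "range F \<subseteq> sets (N i \<omega>)" using Fb by auto
    qed (rule F(2))
    finally show "(\<Sum>n. \<integral>\<^sup>+\<omega>. emeasure (N i \<omega>) (F n) \<partial>M) = (\<integral>\<^sup>+\<omega>. emeasure (N i \<omega>) (\<Union>n. F n) \<partial>M)" .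
  qed
qed (use A in \<open>auto simp: positive_def\<close>)

text \<open>The mean measure $\mu$ is translation invariant on bounded sets, and such a measure is a multiple of
  Lebesgue measure: integrate $1_{[0,1)}(y)\,1_A(x+y)$ over $\mu(dx)\,dy$. Integrating over $x$
  first gives $\mu(A)$ by invariance of $\mu$. Substituting $z = x + y$ for fixed $x$, which uses the
  invariance of Lebesgue measure, and then integrating over $x$ first gives
  $\mu((-1,0])\,\mathrm{Leb}(A)$. The set $[0,1]$ identifies the constant.\<close>

lemma mean_count:
  assumes i: "i \<in> {1,2}" and A: "A \<in> sets borel" "bounded A"
  shows "(\<integral>\<^sup>+\<omega>. emeasure (N i \<omega>) A \<partial>M) = ennreal (intensity M N i) * emeasure lborel A"
proof -
  let ?\<mu> = "mean_measure i"
  let ?I = "indicator {0..<1::real} :: real \<Rightarrow> ennreal"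
  have fin: "emeasure ?\<mu> A < \<infinity>" if "A \<in> sets borel" "bounded A" for A
    using mean_count_finite[OF i that] by (simp add: emeasure_mean_measure[OF i that(1)])
  have transl: "emeasure ?\<mu> ((+) u ` A) = emeasure ?\<mu> A" if "A \<in> sets borel" "bounded A" for A u
    using stationary_count[OF i that, of "\<lambda>x. x" u] that by (simp add: emeasure_mean_measure[OF i] translate_borel)
  interpret \<mu>: sigma_finite_measure ?\<mu>
  proof
    show "\<exists>F. countable F \<and> F \<subseteq> sets ?\<mu> \<and> \<Union> F = space ?\<mu> \<and> (\<forall>a\<in>F. emeasure ?\<mu> a \<noteq> \<infinity>)"
      using fin[of "cell _"] cell_ceiling
      by (intro exI[of _ "range cell"]) (auto simp: less_top)
  qed
  interpret L: sigma_finite_measure "lborel :: real measure" by (rule sigma_finite_lborel)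
  interpret P: pair_sigma_finite ?\<mu> "lborel :: real measure" ..
  define c where "c = emeasure ?\<mu> {-1<..0}"
  have main: "emeasure ?\<mu> A = c * emeasure lborel A" if A[measurable]: "A \<in> sets borel" "bounded A" for A
  proof -
    have "emeasure ?\<mu> A = (\<integral>\<^sup>+y. ?I y * emeasure ?\<mu> A \<partial>lborel)"
      by (simp add: nn_integral_multc)
    also have "\<dots> = (\<integral>\<^sup>+y. (\<integral>\<^sup>+x. ?I y * indicator A (x + y) \<partial>?\<mu>) \<partial>lborel)"
    proof (rule nn_integral_cong)
      fix y
      have "(\<integral>\<^sup>+x. indicator A (x + y) \<partial>?\<mu>) = (\<integral>\<^sup>+x. indicator ((+) (- y) ` A) x \<partial>?\<mu>)"
        by (intro nn_integral_cong) (auto simp: indicator_def image_iff intro: bexI[of _ "_ + y"])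
      also have "\<dots> = emeasure ?\<mu> ((+) (- y) ` A)"
        by (rule nn_integral_indicator) (simp only: sets_mean_measure translate_borel[OF A(1)])
      also have "\<dots> = emeasure ?\<mu> A" by (rule transl[OF A])
      finally show "?I y * emeasure ?\<mu> A = (\<integral>\<^sup>+x. ?I y * indicator A (x + y) \<partial>?\<mu>)"
        by (subst nn_integral_cmult) auto
    qed
    also have "\<dots> = (\<integral>\<^sup>+x. (\<integral>\<^sup>+y. ?I y * indicator A (x + y) \<partial>lborel) \<partial>?\<mu>)"
      by (rule P.Fubini') measurable
    also have "\<dots> = (\<integral>\<^sup>+x. (\<integral>\<^sup>+z. ?I (z - x) * indicator A z \<partial>lborel) \<partial>?\<mu>)"
    proof (rule nn_integral_cong)
      fix x
      have "(\<integral>\<^sup>+z. ?I (z - x) * indicator A z \<partial>lborel) = (\<integral>\<^sup>+z. ?I (z - x) * indicator A z \<partial>distr lborel borel ((+) x))"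
        by (simp add: lborel_distr_plus)
      also have "\<dots> = (\<integral>\<^sup>+y. ?I y * indicator A (x + y) \<partial>lborel)"
        by (subst nn_integral_distr) auto
      finally show "(\<integral>\<^sup>+y. ?I y * indicator A (x + y) \<partial>lborel) = (\<integral>\<^sup>+z. ?I (z - x) * indicator A z \<partial>lborel)" ..
    qed
    also have "\<dots> = (\<integral>\<^sup>+z. (\<integral>\<^sup>+x. ?I (z - x) * indicator A z \<partial>?\<mu>) \<partial>lborel)"
      by (rule P.Fubini'[symmetric]) measurable
    also have "\<dots> = (\<integral>\<^sup>+z. c * indicator A z \<partial>lborel)"
    proof (rule nn_integral_cong)
      fix z
      have "(\<integral>\<^sup>+x. ?I (z - x) \<partial>?\<mu>) = (\<integral>\<^sup>+x. indicator ((+) z ` {-1<..0}) x \<partial>?\<mu>)"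
        by (intro nn_integral_cong) (auto simp: indicator_def)
      also have "\<dots> = emeasure ?\<mu> ((+) z ` {-1<..0})"
        by (rule nn_integral_indicator) (simp only: sets_mean_measure translate_borel greaterThanAtMost_borel)
      also have "\<dots> = c"
        unfolding c_def by (rule transl) (auto intro: bounded_subset[OF bounded_closed_interval[of "-1" 0]])
      finally show "(\<integral>\<^sup>+x. ?I (z - x) * indicator A z \<partial>?\<mu>) = c * indicator A z"
        by (subst nn_integral_multc) auto
    qed
    also have "\<dots> = c * emeasure lborel A" by (simp add: nn_integral_cmult_indicator)
    finally show ?thesis .
  qed
  have "c = (\<integral>\<^sup>+\<omega>. emeasure (N i \<omega>) {0..1} \<partial>M)"
    using main[of "{0..1}"] by (simp add: emeasure_mean_measure[OF i])
  also have "\<dots> = (\<integral>\<^sup>+\<omega>. ennreal (measure (N i \<omega>) {0..1}) \<partial>M)"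
    using finite_count[OF i, of _ "{0..1}"] by (intro nn_integral_cong emeasure_eq_ennreal_measure) (auto simp: less_top)
  also have "\<dots> = ennreal (intensity M N i)"
    unfolding intensity_def
  proof (rule nn_integral_eq_integral)
    show "integrable M (\<lambda>\<omega>. measure (N i \<omega>) {0..1})"
      using positive_intensity i unfolding intensity_def
      by (rule_tac ccontr) (auto dest: not_integrable_integral_eq)
  qed simp
  finally show ?thesis using main[OF A] by (simp add: emeasure_mean_measure[OF i A(1)])
qed

end

section \<open>Sums over pairs of points and mixing\<close>

text \<open>The sum over pairs of points as it occurs in the identity that defines the cross-intensity.\<close>

definition cross_sum :: "(nat \<Rightarrow> 'w \<Rightarrow> real measure) \<Rightarrow> (real \<Rightarrow> ennreal) \<Rightarrow> real set \<Rightarrow> 'w \<Rightarrow> ennreal" where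
  "cross_sum N h V \<omega> = (\<integral>\<^sup>+(x, y). h (y - x)
     \<partial>count_space {(x, y). x \<in> points (N 1 \<omega>) \<and> y \<in> points (N 2 \<omega>) \<and> x \<in> V})"

text \<open>The same sum as an iterated integral against the two measures. The set \<open>E\<close> is meant to contain
  all partners \<open>y\<close> with a nonzero term; it makes visible that only the points of the second process in \<open>E\<close> matter.\<close>

definition cross_integral ::
    "(nat \<Rightarrow> 'w \<Rightarrow> real measure) \<Rightarrow> (real \<Rightarrow> ennreal) \<Rightarrow> real set \<Rightarrow> real set \<Rightarrow> 'w \<Rightarrow> ennreal" where
  "cross_integral N h V E \<omega> =
     (\<integral>\<^sup>+x. (\<integral>\<^sup>+y. h (y - x) * indicator E y \<partial>N 2 \<omega>) * indicator V x \<partial>N 1 \<omega>)"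

lemma dilation_cell: "r > 0 \<Longrightarrow> dilation (cell l) r = {real_of_int l - 1/2 - r <..< real_of_int l + 1/2 + r}"
proof (intro set_eqI iffI)
  fix x assume r: "r > 0" and "x \<in> dilation (cell l) r"
  then show "x \<in> {real_of_int l - 1/2 - r <..< real_of_int l + 1/2 + r}"
    by (auto simp: dilation_def cell_def dist_real_def)
next
  fix x assume r: "r > 0" and x: "x \<in> {real_of_int l - 1/2 - r <..< real_of_int l + 1/2 + r}"
  let ?a = "real_of_int l - 1/2" and ?b = "real_of_int l + 1/2"
  have "\<exists>y. y \<in> {?a<..?b} \<and> \<bar>x - y\<bar> < r"
  proof -
    consider "x \<le> ?a" | "x \<in> {?a<..?b}" | "x > ?b" by fastforce
    then show ?thesis
    proof cases
      case 1
      define y where "y = min ?b ((?a + (x + r)) / 2)"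
      have "?a < y" "y \<le> ?b" "x \<le> y" "y < x + r"
        using 1 x by (auto simp: y_def min_def field_simps)
      then show ?thesis by (intro exI[of _ y]) auto
    qed (use x r in \<open>auto intro: exI[of _ x] exI[of _ ?b]\<close>)
  qed
  then show "x \<in> dilation (cell l) r"
    by (auto simp: dilation_def cell_def dist_real_def)
qed

lemma cell_subset_dilation: "r > 0 \<Longrightarrow> cell l \<subseteq> dilation (cell l) r"
  by (force simp: dilation_def)

text \<open>Suprema of reals are meaningful only for bounded sets, so the trivial bound 1 is needed along with
  the bound from below by each member.\<close>

lemma alpha_coeff_bounds:
  assumes "prob_space M" "C \<in> \<G>" "D \<in> \<H>"
  shows "\<bar>measure M (C \<inter> D) - measure M C * measure M D\<bar> \<le> alpha_coeff M \<G> \<H>"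
    and "alpha_coeff M \<G> \<H> \<le> 1"
proof -
  interpret prob_space M by fact
  have le: "\<bar>prob (C \<inter> D) - prob C * prob D\<bar> \<le> 1" for C D
  proof -
    have "0 \<le> prob C * prob D" "prob C * prob D \<le> 1 * 1"
      by (simp, rule mult_mono) auto
    moreover have "0 \<le> prob (C \<inter> D)" "prob (C \<inter> D) \<le> 1" by auto
    ultimately show ?thesis by linarith
  qed
  show "\<bar>measure M (C \<inter> D) - measure M C * measure M D\<bar> \<le> alpha_coeff M \<G> \<H>"
    unfolding alpha_coeff_def using assms le
    by (intro cSUP_upper2[where x="(C, D)"]) (auto intro!: bdd_aboveI2[where M=1])
  show "alpha_coeff M \<G> \<H> \<le> 1"
    unfolding alpha_coeff_def using assms le by (intro cSUP_least) auto
qed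

lemma alpha_sigma_on_bounds:
  assumes "prob_space M"
  shows "0 \<le> alpha_coeff M (sigma_on M N E) (sigma_on M N E')"
    and "alpha_coeff M (sigma_on M N E) (sigma_on M N E') \<le> 1"
proof -
  have e: "{} \<in> sigma_on M N E" for E unfolding sigma_on_def by (rule sigma_sets.Empty)
  show "0 \<le> alpha_coeff M (sigma_on M N E) (sigma_on M N E')"
    using alpha_coeff_bounds(1)[OF assms e[of E] e[of E']] by simp
  show "alpha_coeff M (sigma_on M N E) (sigma_on M N E') \<le> 1"
    by (rule alpha_coeff_bounds(2)[OF assms e e])
qed

lemma alpha_le_mixing_coeff:
  assumes "prob_space M"
    and "card_at_most L1 c1" "card_at_most L2 c2" "\<And>l1 l2. l1 \<in> L1 \<Longrightarrow> l2 \<in> L2 \<Longrightarrow> int m \<le> \<bar>l1 - l2\<bar>"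
  shows "alpha_coeff M (sigma_on M N (\<Union>l\<in>L1. dilation (cell l) r)) (sigma_on M N (\<Union>l\<in>L2. dilation (cell l) r))
    \<le> mixing_coeff M N c1 c2 m r"
  unfolding mixing_coeff_def
  by (rule cSup_upper) (use assms in \<open>auto intro!: bdd_aboveI[where M=1] alpha_sigma_on_bounds\<close>)

lemma mixing_coeff_bounds:
  assumes "prob_space M"
  shows "0 \<le> mixing_coeff M N c1 c2 m r" "mixing_coeff M N c1 c2 m r \<le> 1"
proof -
  have c: "card_at_most {} c" for c :: enat by (auto simp: card_at_most_def zero_enat_def[symmetric])
  show "0 \<le> mixing_coeff M N c1 c2 m r"
    using alpha_sigma_on_bounds(1)[OF assms] alpha_le_mixing_coeff[OF assms c c, where m=m]
    by (rule order_trans) auto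
  show "mixing_coeff M N c1 c2 m r \<le> 1"
    unfolding mixing_coeff_def using assms c
    by (intro cSup_least) (auto intro: alpha_sigma_on_bounds)
qed

text \<open>The measurable space of events that are determined by the points of both processes in \<open>E\<close>.\<close>

definition region_sigma :: "'w measure \<Rightarrow> (nat \<Rightarrow> 'w \<Rightarrow> real measure) \<Rightarrow> real set \<Rightarrow> 'w measure" where
  "region_sigma M N E = sigma (space M)
     {(\<lambda>\<omega>. emeasure (N i \<omega>) (A \<inter> E)) -` B \<inter> space M | i A B.
        i \<in> {1,2} \<and> A \<in> sets borel \<and> B \<in> sets borel}"

lemma space_region_sigma [simp]: "space (region_sigma M N E) = space M"
  unfolding region_sigma_def by (rule space_measure_of) auto

lemma sets_region_sigma: "sets (region_sigma M N E) = sigma_on M N E"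
  unfolding region_sigma_def sigma_on_def by (rule sets_measure_of) auto

lemma measurable_count_region_sigma:
  assumes "i \<in> {1,2}" "A \<in> sets borel"
  shows "(\<lambda>\<omega>. emeasure (N i \<omega>) (A \<inter> E)) \<in> borel_measurable (region_sigma M N E)"
proof (rule measurableI)
  fix B :: "ennreal set" assume "B \<in> sets borel"
  then show "(\<lambda>\<omega>. emeasure (N i \<omega>) (A \<inter> E)) -` B \<inter> space (region_sigma M N E) \<in> sets (region_sigma M N E)"
    unfolding sets_region_sigma space_region_sigma sigma_on_def
    using assms by (intro sigma_sets.Basic) blast
qed simp

context mixing_pair
begin

text \<open>The two cells form index sets of cardinality 1, so the coefficients with bounds 2 and $\infty$ on the
  cardinalities apply.\<close>

lemma mixing_product_bound:
  fixes X Y :: "'w \<Rightarrow> real"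
  assumes X: "X \<in> borel_measurable (region_sigma M N (dilation (cell l) r))"
    and Y: "Y \<in> borel_measurable (region_sigma M N (dilation (cell l') r))"
  shows "prob {\<omega>\<in>space M. s < X \<omega> \<and> t < Y \<omega>}
    \<le> prob {\<omega>\<in>space M. s < X \<omega>} * prob {\<omega>\<in>space M. t < Y \<omega>} + mixing_coeff M N 2 \<infinity> (nat \<bar>l - l'\<bar>) r"
proof -
  let ?E = "\<lambda>l. dilation (cell l) r"
  let ?C = "{\<omega>\<in>space M. s < X \<omega>}" and ?D = "{\<omega>\<in>space M. t < Y \<omega>}"
  have "{\<omega>\<in>space (region_sigma M N (?E l)). s < X \<omega>} \<in> sets (region_sigma M N (?E l))"
    using X by measurable
  moreover have "{\<omega>\<in>space (region_sigma M N (?E l')). t < Y \<omega>} \<in> sets (region_sigma M N (?E l'))"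
    using Y by measurable
  ultimately have CD: "?C \<in> sigma_on M N (?E l)" "?D \<in> sigma_on M N (?E l')"
    by (simp_all add: sets_region_sigma)
  have eq: "{\<omega>\<in>space M. s < X \<omega> \<and> t < Y \<omega>} = ?C \<inter> ?D" by auto
  have "\<bar>prob (?C \<inter> ?D) - prob ?C * prob ?D\<bar> \<le> alpha_coeff M (sigma_on M N (?E l)) (sigma_on M N (?E l'))"
    by (rule alpha_coeff_bounds(1)[OF prob_space_axioms CD])
  moreover have "alpha_coeff M (sigma_on M N (?E l)) (sigma_on M N (?E l')) \<le> mixing_coeff M N 2 \<infinity> (nat \<bar>l - l'\<bar>) r"
    using alpha_le_mixing_coeff[OF prob_space_axioms, of "{l}" 2 "{l'}" \<infinity> "nat \<bar>l - l'\<bar>" N r]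
    by (simp add: card_at_most_def one_enat_def numeral_eq_enat)
  ultimately show ?thesis unfolding eq by linarith
qed

text \<open>Coefficients lie in $[0,1]$ and the exponent is less than 1, so each coefficient is at most its power.\<close>

lemma summable_mixing_coeff: "summable (\<lambda>m. mixing_coeff M N 2 \<infinity> m r)"
proof -
  let ?a = "\<lambda>m. mixing_coeff M N 2 \<infinity> m r"
  note b = mixing_coeff_bounds[OF prob_space_axioms, of N 2 \<infinity> _ r]
  have le: "?a m \<le> ?a m powr (\<delta> / (2 + \<delta>))" for m
  proof (cases "?a m = 0")
    case False
    then have "0 < ?a m" using b(1)[of m] by simp
    then have "?a m powr 1 \<le> ?a m powr (\<delta> / (2 + \<delta>))"
      using b(2)[of m] delta_pos by (intro powr_mono') auto
    then show ?thesis using \<open>0 < ?a m\<close> by simp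
  qed simp
  have "summable (\<lambda>m. ?a (Suc m))"
    by (rule summable_comparison_test'[OF mixing, of 0]) (use le b in auto)
  then show ?thesis using summable_Suc_iff[of ?a] by simp
qed

text \<open>Stated for an arbitrary $\sigma$-algebra \<open>M'\<close> on the sample space: it is used for the whole one and
  for the one generated by the points near a cell. Restricted to bounded sets the
  two random measures are finite, and the iterated integral is an integral against their product.\<close>

lemma measurable_cross_integral:
  assumes space: "space M' = space M"
    and h[measurable]: "h \<in> borel_measurable borel"
    and V[measurable]: "V \<in> sets borel" "bounded V" and E[measurable]: "E \<in> sets borel" "bounded E"
    and meas: "\<And>A. A \<in> sets borel \<Longrightarrow> (\<lambda>\<omega>. emeasure (N 1 \<omega>) (A \<inter> V)) \<in> borel_measurable M'"
      "\<And>A. A \<in> sets borel \<Longrightarrow> (\<lambda>\<omega>. emeasure (N 2 \<omega>) (A \<inter> E)) \<in> borel_measurable M'"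
  shows "cross_integral N h V E \<in> borel_measurable M'"
proof -
  define R1 where "R1 \<omega> = density (N 1 \<omega>) (indicator V)" for \<omega>
  define R2 where "R2 \<omega> = density (N 2 \<omega>) (indicator E)" for \<omega>
  have R: "sets (R1 \<omega>) = sets borel" "sets (R2 \<omega>) = sets borel"
      "finite_measure (R1 \<omega>)" "finite_measure (R2 \<omega>)"
      "\<And>A. A \<in> sets borel \<Longrightarrow> emeasure (R1 \<omega>) A = emeasure (N 1 \<omega>) (A \<inter> V)"
      "\<And>A. A \<in> sets borel \<Longrightarrow> emeasure (R2 \<omega>) A = emeasure (N 2 \<omega>) (A \<inter> E)"
      "cross_integral N h V E \<omega> = (\<integral>\<^sup>+z. h (snd z - fst z) \<partial>(R1 \<omega> \<Otimes>\<^sub>M R2 \<omega>))"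
    if w: "\<omega> \<in> space M" for \<omega>
  proof -
    interpret N1: point_configuration "N 1 \<omega>" using configuration[of 1 \<omega>] w by simp
    interpret N2: point_configuration "N 2 \<omega>" using configuration[of 2 \<omega>] w by simp
    show s[measurable_cong]: "sets (R1 \<omega>) = sets borel" "sets (R2 \<omega>) = sets borel"
      by (simp_all add: R1_def R2_def)
    show e1: "emeasure (R1 \<omega>) A = emeasure (N 1 \<omega>) (A \<inter> V)" if "A \<in> sets borel" for A
      using that by (simp add: R1_def emeasure_density indicator_inter_arith[symmetric] Int_commute)
    show e2: "emeasure (R2 \<omega>) A = emeasure (N 2 \<omega>) (A \<inter> E)" if "A \<in> sets borel" for A
      using that by (simp add: R2_def emeasure_density indicator_inter_arith[symmetric] Int_commute)
    have "space (R1 \<omega>) = UNIV" "space (R2 \<omega>) = UNIV" by (simp_all add: R1_def R2_def)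
    then show f: "finite_measure (R1 \<omega>)" "finite_measure (R2 \<omega>)"
      using e1[of UNIV] e2[of UNIV] N1.locally_finite[of V] N2.locally_finite[of E] V E
      by (auto intro!: finite_measureI)
    interpret R2: sigma_finite_measure "R2 \<omega>"
      using f(2) by (rule finite_measure.axioms)
    interpret S2: sigma_finite_measure "N 2 \<omega>" by (rule N2.sigma_finite)
    have "(\<integral>\<^sup>+z. h (snd z - fst z) \<partial>(R1 \<omega> \<Otimes>\<^sub>M R2 \<omega>)) = (\<integral>\<^sup>+x. (\<integral>\<^sup>+y. h (y - x) \<partial>R2 \<omega>) \<partial>R1 \<omega>)"
      by (subst R2.nn_integral_fst[symmetric]) auto
    also have "\<dots> = (\<integral>\<^sup>+x. (\<integral>\<^sup>+y. h (y - x) * indicator E y \<partial>N 2 \<omega>) \<partial>R1 \<omega>)"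
      unfolding R2_def by (intro nn_integral_cong) (simp add: nn_integral_density mult.commute)
    also have "\<dots> = cross_integral N h V E \<omega>"
      unfolding R1_def cross_integral_def by (subst nn_integral_density) (auto simp: mult.commute)
    finally show "cross_integral N h V E \<omega> = (\<integral>\<^sup>+z. h (snd z - fst z) \<partial>(R1 \<omega> \<Otimes>\<^sub>M R2 \<omega>))" ..
  qed
  have R_meas: "(\<lambda>\<omega>. emeasure (R1 \<omega>) A) \<in> borel_measurable M'" "(\<lambda>\<omega>. emeasure (R2 \<omega>) A) \<in> borel_measurable M'"
    if A: "A \<in> sets borel" for A
  proof -
    show "(\<lambda>\<omega>. emeasure (R1 \<omega>) A) \<in> borel_measurable M'"
      by (subst measurable_cong[where g="\<lambda>\<omega>. emeasure (N 1 \<omega>) (A \<inter> V)"])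
        (use R(5)[OF _ A] meas(1)[OF A] space in auto)
    show "(\<lambda>\<omega>. emeasure (R2 \<omega>) A) \<in> borel_measurable M'"
      by (subst measurable_cong[where g="\<lambda>\<omega>. emeasure (N 2 \<omega>) (A \<inter> E)"])
        (use R(6)[OF _ A] meas(2)[OF A] space in auto)
  qed
  have "(\<lambda>\<omega>. \<integral>\<^sup>+z. h (snd z - fst z) \<partial>(R1 \<omega> \<Otimes>\<^sub>M R2 \<omega>)) \<in> borel_measurable M'"
  proof (rule measurable_nn_integral_of_measurable_emeasure[where K="borel \<Otimes>\<^sub>M borel"])
    show "sets (R1 \<omega> \<Otimes>\<^sub>M R2 \<omega>) = sets (borel \<Otimes>\<^sub>M borel)" if "\<omega> \<in> space M'" for \<omega>
      using that by (intro sets_pair_measure_cong R(1,2)) (simp_all add: space)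
    show "(\<lambda>\<omega>. emeasure (R1 \<omega> \<Otimes>\<^sub>M R2 \<omega>) A) \<in> borel_measurable M'"
      if "A \<in> sets (borel \<Otimes>\<^sub>M borel)" for A
      by (rule measurable_emeasure_pair_kernel[OF _ _ _ _ _ _ that])
         (use R(1-4) R_meas in \<open>auto simp: space\<close>)
  qed measurable
  then show ?thesis
    by (subst measurable_cong[where g="\<lambda>\<omega>. \<integral>\<^sup>+z. h (snd z - fst z) \<partial>(R1 \<omega> \<Otimes>\<^sub>M R2 \<omega>)"])
      (use R(7) space in auto)
qed

text \<open>Where both configurations are simple each of them is the counting measure on its points.\<close>

lemma cross_sum_eq_integral:
  assumes w: "\<omega> \<in> space M" and simple: "\<forall>i\<in>{1,2}. \<forall>x. emeasure (N i \<omega>) {x} \<le> 1"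
    and [measurable]: "h \<in> borel_measurable borel" "V \<in> sets borel" "E \<in> sets borel"
    and E: "\<And>x y. x \<in> V \<Longrightarrow> h (y - x) \<noteq> 0 \<Longrightarrow> y \<in> E"
  shows "cross_sum N h V \<omega> = cross_integral N h V E \<omega>"
proof -
  interpret N1: point_configuration "N 1 \<omega>" using configuration[of 1 \<omega>] w by simp
  interpret N2: point_configuration "N 2 \<omega>" using configuration[of 2 \<omega>] w by simp
  interpret S2: sigma_finite_measure "N 2 \<omega>" by (rule N2.sigma_finite)
  let ?p1 = "points (N 1 \<omega>)" and ?p2 = "points (N 2 \<omega>)"
  let ?S = "{(x, y). x \<in> ?p1 \<and> y \<in> ?p2 \<and> x \<in> V}"
  let ?f = "\<lambda>(x, y). h (y - x) * indicator ?S (x, y)"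
  have cs: "(\<integral>\<^sup>+x. f x \<partial>count_space A) = (\<integral>\<^sup>+x. f x * indicator A x \<partial>count_space UNIV)" for f and A :: "'x set"
    by (rule nn_integral_count_space_indicator) simp_all
  have "cross_integral N h V E \<omega>
      = (\<integral>\<^sup>+x. (\<integral>\<^sup>+y. h (y - x) * indicator E y \<partial>N 2 \<omega>) * indicator V x \<partial>count_space ?p1)"
    unfolding cross_integral_def using simple by (intro N1.nn_integral_eq_count_points) auto
  also have "\<dots> = (\<integral>\<^sup>+x. (\<integral>\<^sup>+y. h (y - x) * indicator E y \<partial>count_space ?p2) * indicator V x \<partial>count_space ?p1)"
  proof -
    have "(\<integral>\<^sup>+y. h (y - x) * indicator E y \<partial>N 2 \<omega>) = (\<integral>\<^sup>+y. h (y - x) * indicator E y \<partial>count_space ?p2)" for x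
      using simple by (intro N2.nn_integral_eq_count_points) auto
    then show ?thesis by simp
  qed
  also have "\<dots> = (\<integral>\<^sup>+x. (\<integral>\<^sup>+y. ?f (x, y) \<partial>count_space UNIV) \<partial>count_space UNIV)"
  proof (subst cs, rule nn_integral_cong)
    fix x
    show "(\<integral>\<^sup>+y. h (y - x) * indicator E y \<partial>count_space ?p2) * indicator V x * indicator ?p1 x
        = (\<integral>\<^sup>+y. ?f (x, y) \<partial>count_space UNIV)"
    proof (cases "x \<in> V \<and> x \<in> ?p1")
      case True
      have "h (y - x) = 0" if "y \<notin> E" for y using E True that by blast
      then have "(\<integral>\<^sup>+y. h (y - x) * indicator E y \<partial>count_space ?p2) = (\<integral>\<^sup>+y. ?f (x, y) \<partial>count_space UNIV)"
        using True by (subst cs) (auto intro!: nn_integral_cong simp: indicator_def)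
      then show ?thesis using True by simp
    next
      case False
      then have "(\<integral>\<^sup>+y. ?f (x, y) \<partial>count_space UNIV) = (\<integral>\<^sup>+y. 0 \<partial>count_space (UNIV :: real set))"
        by (intro nn_integral_cong) (auto simp: indicator_def)
      then show ?thesis using False by auto
    qed
  qed
  also have "\<dots> = (\<integral>\<^sup>+z. ?f z \<partial>count_space UNIV)" by (rule nn_integral_fst_count_space)
  also have "\<dots> = cross_sum N h V \<omega>"
    unfolding cross_sum_def
    by (subst cs) (auto intro!: nn_integral_cong)
  finally show ?thesis ..
qed

lemma nn_integral_cross_sum:
  "V \<in> sets borel \<Longrightarrow> h \<in> borel_measurable borel \<Longrightarrow>
    (\<integral>\<^sup>+\<omega>. cross_sum N h V \<omega> \<partial>M) = emeasure lborel V * (\<integral>\<^sup>+u. h u * ennreal (lam u) \<partial>lborel)"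
  using cross_intensity unfolding is_cross_intensity_def cross_sum_def by blast

end

lemma cross_sum_as_indicator:
  "cross_sum N h V \<omega> = (\<integral>\<^sup>+z. h (snd z - fst z) *
     indicator {(x, y). x \<in> points (N 1 \<omega>) \<and> y \<in> points (N 2 \<omega>) \<and> x \<in> V} z \<partial>count_space UNIV)"
  unfolding cross_sum_def
  by (subst nn_integral_count_space_indicator) (auto intro!: nn_integral_cong simp: case_prod_unfold)

lemma cross_sum_empty [simp]: "cross_sum N h {} \<omega> = 0"
  by (simp add: cross_sum_as_indicator)

lemma cross_sum_Un:
  assumes "A \<inter> B = {}"
  shows "cross_sum N h (A \<union> B) \<omega> = cross_sum N h A \<omega> + cross_sum N h B \<omega>"
  unfolding cross_sum_as_indicator using assms
  by (subst nn_integral_add[symmetric]) (auto intro!: nn_integral_cong simp: indicator_def)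

lemma cross_sum_UN:
  assumes "finite D" "disjoint_family_on A D"
  shows "cross_sum N h (\<Union>l\<in>D. A l) \<omega> = (\<Sum>l\<in>D. cross_sum N h (A l) \<omega>)"
  using assms
proof (induct D)
  case (insert l D)
  then have "A l \<inter> (\<Union>l\<in>D. A l) = {}" by (auto simp: disjoint_family_on_def)
  moreover have "disjoint_family_on A D" using insert by (auto simp: disjoint_family_on_def)
  ultimately show ?case using insert by (simp add: cross_sum_Un)
qed simp

lemma cross_sum_add:
  "cross_sum N (\<lambda>u. f u + g u) V \<omega> = cross_sum N f V \<omega> + cross_sum N g V \<omega>"
  unfolding cross_sum_as_indicator
  by (subst nn_integral_add[symmetric]) (auto intro!: nn_integral_cong simp: distrib_right)

text \<open>Dominated convergence: the excess over $k$ is at most $f w$ and vanishes once $k$ exceeds the value.\<close>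

lemma nn_integral_excess_tendsto_0:
  fixes f w :: "'a \<Rightarrow> ennreal"
  assumes [measurable]: "f \<in> borel_measurable M" "w \<in> borel_measurable M"
    and f: "\<And>x. x \<in> space M \<Longrightarrow> f x < \<infinity>" and fin: "(\<integral>\<^sup>+x. f x * w x \<partial>M) < \<infinity>"
  shows "(\<lambda>k::nat. \<integral>\<^sup>+x. (f x - of_nat k) * w x \<partial>M) \<longlonglongrightarrow> 0"
proof -
  have "(\<lambda>k::nat. \<integral>\<^sup>+x. (f x - of_nat k) * w x \<partial>M) \<longlonglongrightarrow> (\<integral>\<^sup>+x. 0 \<partial>M)"
  proof (rule nn_integral_dominated_convergence[where w="\<lambda>x. f x * w x"])
    show "AE x in M. (\<lambda>k. (f x - of_nat k) * w x) \<longlonglongrightarrow> 0"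
    proof (rule AE_I2)
      fix x assume "x \<in> space M"
      note fx = f[OF this]
      from fx obtain n :: nat where n: "f x < of_nat n"
        using ennreal_Ex_less_of_nat[of "f x"] by (auto simp: less_top)
      have "\<forall>\<^sub>F k in sequentially. (f x - of_nat k) * w x = 0"
        using eventually_ge_at_top[of n]
      proof eventually_elim
        case (elim k)
        then have "(of_nat n :: ennreal) \<le> of_nat k" by simp
        with n have "f x \<le> of_nat k" by (meson order.strict_implies_order order_trans)
        then show ?case using fx by (simp add: diff_eq_0_iff_ennreal)
      qed
      then show "(\<lambda>k. (f x - of_nat k) * w x) \<longlonglongrightarrow> 0" by (rule tendsto_eventually)
    qed
    show "AE x in M. (f x - of_nat k) * w x \<le> f x * w x" for k
      by (intro AE_I2 mult_right_mono) (auto simp: diff_le_self_ennreal)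
  qed (use fin in auto)
  then show ?thesis by simp
qed

context mixing_pair
begin

lemma measurable_count_cell_region:
  "i \<in> {1,2} \<Longrightarrow> (\<lambda>\<omega>. emeasure (N i \<omega>) (cell l)) \<in> borel_measurable (region_sigma M N (dilation (cell l) r))"
  using measurable_count_region_sigma[where i=i and A="cell l" and E="dilation (cell l) r" and N=N and M=M] cell_subset_dilation[OF r_pos, of l]
  by (simp add: Int_absorb2)

lemma dilation_cell_borel [measurable, simp]: "dilation (cell l) r \<in> sets borel"
  by (simp add: dilation_cell r_pos)

lemma bounded_dilation_cell [simp]: "bounded (dilation (cell l) r)"
  unfolding dilation_cell[OF r_pos]
  by (rule bounded_subset[OF bounded_closed_interval[of "real_of_int l - 1/2 - r" "real_of_int l + 1/2 + r"]]) auto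

lemma translate_dilation_cell: "(+) (real_of_int l) ` dilation (cell 0) r = dilation (cell l) r"
  by (force simp: dilation_cell r_pos image_iff intro: bexI[of _ "_ - real_of_int l"])

lemma expectation_excess_le:
  assumes Y: "integrable M Y" "\<And>\<omega>. \<omega> \<in> space M \<Longrightarrow> 0 \<le> Y \<omega>" and L: "0 \<le> L" and e: "0 \<le> \<epsilon>"
    and le: "(\<integral>\<^sup>+\<omega>. ennreal (Y \<omega>) - ennreal L \<partial>M) \<le> ennreal \<epsilon>"
  shows "expectation (\<lambda>\<omega>. max 0 (Y \<omega> - L)) \<le> \<epsilon>"
proof -
  have "ennreal (expectation (\<lambda>\<omega>. max 0 (Y \<omega> - L))) = (\<integral>\<^sup>+\<omega>. ennreal (max 0 (Y \<omega> - L)) \<partial>M)"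
    using Y by (intro nn_integral_eq_integral[symmetric]) auto
  also have "\<dots> = (\<integral>\<^sup>+\<omega>. ennreal (Y \<omega>) - ennreal L \<partial>M)"
    using L by (intro nn_integral_cong) (auto simp: ennreal_minus max_def ennreal_neg)
  also note le
  finally show ?thesis using e by simp
qed

text \<open>By $xy \le x^2 + y^2$ it suffices that counts in cells have second moments.\<close>

lemma mean_count_product_finite:
  assumes B: "B \<in> sets borel" "bounded B"
  shows "(\<integral>\<^sup>+\<omega>. emeasure (N 1 \<omega>) (cell 0) * emeasure (N 2 \<omega>) B \<partial>M) < \<infinity>"
proof -
  let ?J = "{l. cell l \<inter> B \<noteq> {}}"
  have J: "finite ?J" by (rule finite_cell_cover) fact
  note [measurable] = measurable_count[of 1] measurable_count[of 2]
  have "(\<integral>\<^sup>+\<omega>. emeasure (N 1 \<omega>) (cell 0) * emeasure (N 2 \<omega>) B \<partial>M)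
    \<le> (\<integral>\<^sup>+\<omega>. (\<Sum>l\<in>?J. (emeasure (N 1 \<omega>) (cell 0))\<^sup>2 + (emeasure (N 2 \<omega>) (cell l))\<^sup>2) \<partial>M)"
  proof (rule nn_integral_mono)
    fix \<omega> assume "\<omega> \<in> space M"
    then interpret N2: point_configuration "N 2 \<omega>" using configuration[of 2 \<omega>] by simp
    have "emeasure (N 2 \<omega>) B \<le> emeasure (N 2 \<omega>) (\<Union>l\<in>?J. cell l)"
      by (intro emeasure_mono subset_cell_cover) (use J in auto)
    also have "\<dots> \<le> (\<Sum>l\<in>?J. emeasure (N 2 \<omega>) (cell l))"
      using J by (intro emeasure_subadditive_finite) auto
    finally have "emeasure (N 1 \<omega>) (cell 0) * emeasure (N 2 \<omega>) B
       \<le> emeasure (N 1 \<omega>) (cell 0) * (\<Sum>l\<in>?J. emeasure (N 2 \<omega>) (cell l))"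
      by (intro mult_left_mono) auto
    also have "\<dots> = (\<Sum>l\<in>?J. emeasure (N 1 \<omega>) (cell 0) * emeasure (N 2 \<omega>) (cell l))"
      by (simp add: sum_distrib_left)
    also have "\<dots> \<le> (\<Sum>l\<in>?J. (emeasure (N 1 \<omega>) (cell 0))\<^sup>2 + (emeasure (N 2 \<omega>) (cell l))\<^sup>2)"
    proof (rule sum_mono)
      fix l
      have "x * y \<le> x\<^sup>2 + y\<^sup>2" for x y :: ennreal
      proof (cases "x \<le> y")
        case True
        then have "x * y \<le> y * y" by (intro mult_right_mono) auto
        then show ?thesis by (simp add: power2_eq_square add_increasing)
      next
        case False
        then have "x * y \<le> x * x" by (intro mult_left_mono) auto
        then show ?thesis by (simp add: power2_eq_square add_increasing2)
      qed
      then show "emeasure (N 1 \<omega>) (cell 0) * emeasure (N 2 \<omega>) (cell l)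
        \<le> (emeasure (N 1 \<omega>) (cell 0))\<^sup>2 + (emeasure (N 2 \<omega>) (cell l))\<^sup>2" .
    qed
    finally show "emeasure (N 1 \<omega>) (cell 0) * emeasure (N 2 \<omega>) B
      \<le> (\<Sum>l\<in>?J. (emeasure (N 1 \<omega>) (cell 0))\<^sup>2 + (emeasure (N 2 \<omega>) (cell l))\<^sup>2)" .
  qed
  also have "\<dots> = (\<Sum>l\<in>?J. (\<integral>\<^sup>+\<omega>. (emeasure (N 1 \<omega>) (cell 0))\<^sup>2 \<partial>M) + (\<integral>\<^sup>+\<omega>. (emeasure (N 2 \<omega>) (cell l))\<^sup>2 \<partial>M))"
    by (simp add: nn_integral_sum nn_integral_add)
  also have "\<dots> < \<infinity>"
    using count_cell_square_finite[of 1] count_cell_square_finite[of 2] J by (simp add: less_top)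
  finally show ?thesis .
qed

lemma cross_integral_le_count_product:
  assumes w: "\<omega> \<in> space M" and [measurable]: "V \<in> sets borel" "E \<in> sets borel" and h: "\<And>u. h u \<le> K"
  shows "cross_integral N h V E \<omega> \<le> K * (emeasure (N 1 \<omega>) V * emeasure (N 2 \<omega>) E)"
proof -
  interpret N1: point_configuration "N 1 \<omega>" using configuration[of 1 \<omega>] w by simp
  interpret N2: point_configuration "N 2 \<omega>" using configuration[of 2 \<omega>] w by simp
  have "cross_integral N h V E \<omega> \<le> (\<integral>\<^sup>+x. (\<integral>\<^sup>+y. K * indicator E y \<partial>N 2 \<omega>) * indicator V x \<partial>N 1 \<omega>)"
    unfolding cross_integral_def by (intro nn_integral_mono mult_right_mono h) auto
  also have "\<dots> = (\<integral>\<^sup>+x. (K * emeasure (N 2 \<omega>) E) * indicator V x \<partial>N 1 \<omega>)"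
    by (simp add: nn_integral_cmult_indicator)
  also have "\<dots> = (K * emeasure (N 2 \<omega>) E) * emeasure (N 1 \<omega>) V"
    by (rule nn_integral_cmult_indicator) simp
  also have "\<dots> = K * (emeasure (N 1 \<omega>) V * emeasure (N 2 \<omega>) E)"
    by (simp add: mult_ac)
  finally show ?thesis .
qed

text \<open>The cross-intensity identity computes the mean of the pair sum, which is hence almost surely
  finite. This gives a measurable real version of it with known expectation.\<close>

lemma cross_integral_real:
  fixes h :: "real \<Rightarrow> real"
  assumes h[measurable]: "h \<in> borel_measurable borel" "\<And>u. 0 \<le> h u" and int: "integrable lborel (\<lambda>u. h u * lam u)"
    and V[measurable]: "V \<in> sets borel" "bounded V" and E[measurable]: "E \<in> sets borel" "bounded E"
    and VE: "\<And>x y. x \<in> V \<Longrightarrow> h (y - x) \<noteq> 0 \<Longrightarrow> y \<in> E"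
  shows "integrable M (\<lambda>\<omega>. enn2real (cross_integral N h V E \<omega>))"
    and "expectation (\<lambda>\<omega>. enn2real (cross_integral N h V E \<omega>)) = measure lborel V * (LINT u|lborel. h u * lam u)"
    and "AE \<omega> in M. ennreal (enn2real (cross_integral N h V E \<omega>)) = cross_sum N h V \<omega>"
proof -
  let ?X = "\<lambda>\<omega>. enn2real (cross_integral N h V E \<omega>)"
  let ?I = "LINT u|lborel. h u * lam u"
  have lam: "lam \<in> borel_measurable borel" "\<And>u. 0 \<le> lam u"
    using cross_intensity by (auto simp: is_cross_intensity_def)
  have I: "0 \<le> ?I" using h lam by (intro Bochner_Integration.integral_nonneg) auto
  have m[measurable]: "cross_integral N h V E \<in> borel_measurable M"
    by (rule measurable_cross_integral[OF refl _ V E]) (use measurable_count in auto)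
  \<comment> \<open>Values enter as extended reals, so the support condition is needed in this form, too.\<close>
  have VE': "y \<in> E" if "x \<in> V" "ennreal (h (y - x)) \<noteq> 0" for x y
    using that by (intro VE) auto
  have eq: "AE \<omega> in M. cross_sum N h V \<omega> = cross_integral N h V E \<omega>"
    using AE_simple AE_space by eventually_elim (rule cross_sum_eq_integral[OF _ _ _ _ _ VE'], auto)
  have "(\<integral>\<^sup>+\<omega>. cross_integral N h V E \<omega> \<partial>M) = (\<integral>\<^sup>+\<omega>. cross_sum N h V \<omega> \<partial>M)"
    by (rule nn_integral_cong_AE) (use eq in eventually_elim, simp)
  also have "\<dots> = emeasure lborel V * (\<integral>\<^sup>+u. ennreal (h u) * ennreal (lam u) \<partial>lborel)"
    by (rule nn_integral_cross_sum) auto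
  also have "(\<integral>\<^sup>+u. ennreal (h u) * ennreal (lam u) \<partial>lborel) = (\<integral>\<^sup>+u. ennreal (h u * lam u) \<partial>lborel)"
    using h lam by (intro nn_integral_cong) (simp add: ennreal_mult)
  also have "\<dots> = ennreal ?I"
    using h lam int by (intro nn_integral_eq_integral) auto
  also have "emeasure lborel V = ennreal (measure lborel V)"
    using emeasure_bounded_finite[OF V(2)] by (intro emeasure_eq_ennreal_measure) auto
  finally have tot: "(\<integral>\<^sup>+\<omega>. cross_integral N h V E \<omega> \<partial>M) = ennreal (measure lborel V * ?I)"
    using I by (simp add: ennreal_mult)
  have "AE \<omega> in M. cross_integral N h V E \<omega> \<noteq> \<infinity>"
    by (rule nn_integral_noteq_infinite) (use tot in auto)
  then have real: "AE \<omega> in M. ennreal (?X \<omega>) = cross_integral N h V E \<omega>"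
    by eventually_elim (simp add: less_top)
  then show "AE \<omega> in M. ennreal (?X \<omega>) = cross_sum N h V \<omega>"
    using eq by eventually_elim simp
  have totX: "(\<integral>\<^sup>+\<omega>. ennreal (?X \<omega>) \<partial>M) = ennreal (measure lborel V * ?I)"
    unfolding tot[symmetric] by (rule nn_integral_cong_AE) (use real in eventually_elim, simp)
  show "integrable M ?X"
    by (rule integrableI_nonneg) (auto simp: totX)
  show "expectation ?X = measure lborel V * ?I"
    by (rule integral_eq_nn_integral[THEN trans]) (use I in \<open>auto simp: totX\<close>)
qed

text \<open>Write $h = (h - K)^+ + \min(h,K)$. The first part has a mean that is the same for all cells and small
  for large $K$. The second part is at most \<open>Z l\<close>, that is $K$ times the number of points of the first
  process in the cell times the number of points of the second process near it, and the excess of \<open>Z l\<close> over a level has a mean that does not depend on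
  the cell.\<close>

lemma cross_uniformly_integrable:
  fixes h :: "real \<Rightarrow> real"
  assumes h[measurable]: "h \<in> borel_measurable borel" "\<And>u. 0 \<le> h u" and int: "integrable lborel (\<lambda>u. h u * lam u)"
    and supp: "\<And>u. r \<le> \<bar>u\<bar> \<Longrightarrow> h u = 0" and e: "0 < \<epsilon>"
  shows "\<exists>L\<ge>0. \<forall>l. expectation (\<lambda>\<omega>. max 0 (enn2real (cross_integral N h (cell l) (dilation (cell l) r) \<omega>) - L)) \<le> \<epsilon>"
proof -
  let ?E = "\<lambda>l. dilation (cell l) r"
  note [measurable] = measurable_count[of 1] measurable_count[of 2]
  have lam[measurable]: "lam \<in> borel_measurable borel" "\<And>u. 0 \<le> lam u"
    using cross_intensity by (auto simp: is_cross_intensity_def)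
  have supp': "y \<in> ?E l" if "x \<in> cell l" "h (y - x) \<noteq> 0" for x y l
  proof -
    have "\<bar>y - x\<bar> < r" using supp[of "y - x"] that by force
    then show ?thesis using that(1) by (auto simp: dilation_def dist_real_def)
  qed
  have "(\<integral>\<^sup>+u. ennreal (h u) * ennreal (lam u) \<partial>lborel) = (\<integral>\<^sup>+u. ennreal (h u * lam u) \<partial>lborel)"
    using h lam by (intro nn_integral_cong) (simp add: ennreal_mult)
  also have "\<dots> < \<infinity>" using int h lam by (subst nn_integral_eq_integral) auto
  finally have "(\<lambda>k::nat. \<integral>\<^sup>+u. (ennreal (h u) - of_nat k) * ennreal (lam u) \<partial>lborel) \<longlonglongrightarrow> 0"
    by (intro nn_integral_excess_tendsto_0) auto
  then have "\<forall>\<^sub>F k::nat in sequentially. (\<integral>\<^sup>+u. (ennreal (h u) - of_nat k) * ennreal (lam u) \<partial>lborel) < ennreal (\<epsilon> / 2)"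
    using e by (intro order_tendstoD) auto
  then obtain K :: nat where K: "(\<integral>\<^sup>+u. (ennreal (h u) - of_nat K) * ennreal (lam u) \<partial>lborel) < ennreal (\<epsilon> / 2)"
    by (auto simp: eventually_sequentially)
  \<comment> \<open>The bound for the part of the weight that is at most \<open>K\<close>; \<open>L\<close> below is the level for which its
    excess has small mean.\<close>
  define Z where "Z l \<omega> = of_nat K * (emeasure (N 1 \<omega>) (cell l) * emeasure (N 2 \<omega>) (?E l))" for l \<omega>
  have [measurable]: "Z l \<in> borel_measurable M" for l unfolding Z_def by measurable
  have "(\<lambda>k::nat. \<integral>\<^sup>+\<omega>. (Z 0 \<omega> - of_nat k) * 1 \<partial>M) \<longlonglongrightarrow> 0"
  proof (rule nn_integral_excess_tendsto_0)
    show "Z 0 \<omega> < \<infinity>" if "\<omega> \<in> space M" for \<omega>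
      using finite_count[of 1 \<omega> "cell 0"] finite_count[of 2 \<omega> "?E 0"] that
      by (auto simp: Z_def ennreal_mult_less_top of_nat_less_top)
    show "(\<integral>\<^sup>+\<omega>. Z 0 \<omega> * 1 \<partial>M) < \<infinity>"
      using mean_count_product_finite[of "?E 0"]
      by (simp add: Z_def nn_integral_cmult ennreal_mult_less_top of_nat_less_top)
  qed auto
  then have "\<forall>\<^sub>F k::nat in sequentially. (\<integral>\<^sup>+\<omega>. (Z 0 \<omega> - of_nat k) * 1 \<partial>M) < ennreal (\<epsilon> / 2)"
    using e by (intro order_tendstoD) auto
  then obtain L :: nat where L: "(\<integral>\<^sup>+\<omega>. Z 0 \<omega> - of_nat L \<partial>M) < ennreal (\<epsilon> / 2)"
    by (auto simp: eventually_sequentially)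
  have Zl: "(\<integral>\<^sup>+\<omega>. Z l \<omega> - of_nat L \<partial>M) < ennreal (\<epsilon> / 2)" for l
  proof -
    let ?f = "\<lambda>z. of_nat K * (fst z * snd z) - of_nat L :: ennreal"
    have "?f \<in> borel_measurable (borel \<Otimes>\<^sub>M borel)" by measurable
    from stationary_two_counts[of 1 2 "cell 0" "?E 0", OF _ _ _ _ _ _ this, of "real_of_int l"]
    show ?thesis using L by (simp add: Z_def translate_cell translate_dilation_cell)
  qed
  let ?Y = "\<lambda>l \<omega>. enn2real (cross_integral N h (cell l) (?E l) \<omega>)"
  \<comment> \<open>Half of \<open>\<epsilon>\<close> pays for the weight above \<open>K\<close>, the other half for the excess of \<open>Z l\<close> over \<open>L\<close>.\<close>
  have bound: "expectation (\<lambda>\<omega>. max 0 (?Y l \<omega> - real L)) \<le> \<epsilon>" for l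
  proof (rule expectation_excess_le)
    let ?hi = "\<lambda>u. ennreal (h u) - of_nat K" and ?lo = "\<lambda>u. min (ennreal (h u)) (of_nat K)"
    have split: "ennreal (h u) = ?hi u + ?lo u" for u
    proof (cases "ennreal (h u) \<le> of_nat K")
      case True
      then have "?hi u = 0" by (intro diff_eq_0_ennreal) auto
      then show ?thesis using True by (simp add: min_absorb1)
    next
      case False
      then have "of_nat K \<le> ennreal (h u)" by simp
      then show ?thesis by (simp only: min_absorb2 diff_add_cancel_ennreal)
    qed
    have hi_supp: "y \<in> ?E l" if "x \<in> cell l" "?hi (y - x) \<noteq> 0" for x y
      by (rule supp'[OF that(1)]) (use that(2) in auto)
    have lo_supp: "y \<in> ?E l" if "x \<in> cell l" "?lo (y - x) \<noteq> 0" for x y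
      by (rule supp'[OF that(1)]) (use that(2) in auto)
    have hi_m[measurable]: "cross_integral N ?hi (cell l) (?E l) \<in> borel_measurable M"
      by (rule measurable_cross_integral[OF refl]) (use measurable_count in auto)
    show "integrable M (?Y l)"
      using supp' by (intro cross_integral_real(1)[OF h int]) auto
    have eq: "AE \<omega> in M. ennreal (?Y l \<omega>) = cross_sum N h (cell l) \<omega>"
      using supp' by (intro cross_integral_real(3)[OF h int]) auto
    have "(\<integral>\<^sup>+\<omega>. ennreal (?Y l \<omega>) - ennreal (real L) \<partial>M)
        \<le> (\<integral>\<^sup>+\<omega>. cross_integral N ?hi (cell l) (?E l) \<omega> + (Z l \<omega> - of_nat L) \<partial>M)"
    proof (rule nn_integral_mono_AE)
      show "AE \<omega> in M. ennreal (?Y l \<omega>) - ennreal (real L) \<le> cross_integral N ?hi (cell l) (?E l) \<omega> + (Z l \<omega> - of_nat L)"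
        using eq AE_simple AE_space
      proof eventually_elim
        case (elim \<omega>)
        have "cross_sum N h (cell l) \<omega> = cross_sum N ?hi (cell l) \<omega> + cross_sum N ?lo (cell l) \<omega>"
          unfolding cross_sum_add[symmetric] split[symmetric] ..
        also have "cross_sum N ?hi (cell l) \<omega> = cross_integral N ?hi (cell l) (?E l) \<omega>"
          using elim by (intro cross_sum_eq_integral[OF _ _ _ _ _ hi_supp]) auto
        also have "cross_sum N ?lo (cell l) \<omega> = cross_integral N ?lo (cell l) (?E l) \<omega>"
          using elim by (intro cross_sum_eq_integral[OF _ _ _ _ _ lo_supp]) auto
        also have "\<dots> \<le> Z l \<omega>"
          unfolding Z_def using elim by (intro cross_integral_le_count_product) auto
        finally have "ennreal (?Y l \<omega>) - of_nat L \<le> (cross_integral N ?hi (cell l) (?E l) \<omega> + Z l \<omega>) - of_nat L"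
          unfolding elim(1) by (intro ennreal_minus_mono) (auto intro: add_left_mono)
        also have "\<dots> \<le> cross_integral N ?hi (cell l) (?E l) \<omega> + (Z l \<omega> - of_nat L)"
          by (rule add_diff_le_ennreal)
        finally show ?case by (simp add: ennreal_of_nat_eq_real_of_nat)
      qed
    qed
    also have "\<dots> = (\<integral>\<^sup>+\<omega>. cross_integral N ?hi (cell l) (?E l) \<omega> \<partial>M) + (\<integral>\<^sup>+\<omega>. Z l \<omega> - of_nat L \<partial>M)"
      by (rule nn_integral_add) auto
    also have "(\<integral>\<^sup>+\<omega>. cross_integral N ?hi (cell l) (?E l) \<omega> \<partial>M) = (\<integral>\<^sup>+\<omega>. cross_sum N ?hi (cell l) \<omega> \<partial>M)"
    proof (rule nn_integral_cong_AE)
      show "AE \<omega> in M. cross_integral N ?hi (cell l) (?E l) \<omega> = cross_sum N ?hi (cell l) \<omega>"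
        using AE_simple AE_space
      proof eventually_elim
        case (elim \<omega>)
        then show ?case by (intro cross_sum_eq_integral[symmetric, OF _ _ _ _ _ hi_supp]) auto
      qed
    qed
    also have "\<dots> = (\<integral>\<^sup>+u. (ennreal (h u) - of_nat K) * ennreal (lam u) \<partial>lborel)"
      by (subst nn_integral_cross_sum) auto
    also have "\<dots> + (\<integral>\<^sup>+\<omega>. Z l \<omega> - of_nat L \<partial>M) \<le> ennreal (\<epsilon> / 2) + ennreal (\<epsilon> / 2)"
      using K Zl[of l] by (intro add_mono) auto
    also have "\<dots> = ennreal \<epsilon>" using e by (simp add: ennreal_plus[symmetric] del: ennreal_plus)
    finally show "(\<integral>\<^sup>+\<omega>. ennreal (?Y l \<omega>) - ennreal (real L) \<partial>M) \<le> ennreal \<epsilon>" .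
  qed (use e in auto)
  then show ?thesis by (intro exI[of _ "real L"]) auto
qed

end

section \<open>Laws of large numbers on growing windows\<close>

lemma closed_erosion:
  assumes "closed W"
  shows "closed (erosion W r)"
proof -
  have "erosion W r = W \<inter> (\<Inter>y\<in>- W. {x. r \<le> dist x y})"
    by (auto simp: erosion_def subset_iff not_less[symmetric])
  moreover have "closed {x. r \<le> dist x y}" for y :: real
    by (intro closed_Collect_le continuous_intros)
  ultimately show ?thesis using assms by (simp add: closed_Int closed_INT)
qed

lemma erosion_mono: "W \<subseteq> W' \<Longrightarrow> erosion W r \<subseteq> erosion W' r"
  by (auto simp: erosion_def)

lemma measure_cell: "measure lborel (cell l) = 1"
  by (simp add: measure_def)

text \<open>The union \<open>U n\<close> of the cells that meet the eroded window \<open>V n\<close> is the region to which the sums over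
  cells extend; it exceeds \<open>V n\<close> by an area of $\# D_n - a_n$.\<close>

locale windowed_pair = mixing_pair +
  fixes W :: "nat \<Rightarrow> real set"
  assumes windows: "\<And>n. compact (W n)" "incseq W"
      "emeasure lborel (\<Union>n. erosion (W n) r) = \<infinity>"
      "(\<lambda>n. real (card (window_cells (W n) r)) / window_area (W n) r) \<longlonglongrightarrow> 1"
begin

abbreviation V where "V n \<equiv> erosion (W n) r"
abbreviation D where "D n \<equiv> window_cells (W n) r"
abbreviation a where "a n \<equiv> window_area (W n) r"
abbreviation U where "U n \<equiv> (\<Union>l\<in>D n. cell l)"

lemma V_borel [measurable, simp]: "V n \<in> sets borel"
  using closed_erosion[OF compact_imp_closed[OF windows(1)]] by (rule borel_closed)

lemma bounded_V [simp]: "bounded (V n)"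
  using compact_imp_bounded[OF windows(1)] by (rule bounded_subset) (auto simp: erosion_def)

lemma finite_D [simp]: "finite (D n)"
  using finite_cell_cover[OF bounded_V[of n]] by (simp add: window_cells_def)

lemma V_subset_U: "V n \<subseteq> U n"
  using subset_cell_cover[of "V n"] by (simp add: window_cells_def)

lemma bounded_U [simp]: "bounded (U n)"
  by auto

lemma U_borel [measurable, simp]: "U n \<in> sets borel"
  by auto

lemma emeasure_V: "emeasure lborel (V n) = ennreal (a n)"
  unfolding window_area_def using emeasure_bounded_finite[OF bounded_V[of n]]
  by (intro emeasure_eq_ennreal_measure) auto

lemma a_nonneg [simp]: "0 \<le> a n" by (simp add: window_area_def)

lemma emeasure_U: "emeasure lborel (U n) = ennreal (card (D n))"
proof -
  have "emeasure lborel (U n) = (\<Sum>l\<in>D n. emeasure lborel (cell l))"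
    by (rule sum_emeasure[symmetric]) (auto simp: disjoint_cells)
  then show ?thesis by (simp add: ennreal_of_nat_eq_real_of_nat)
qed

lemma measure_boundary: "measure lborel (U n - V n) = card (D n) - a n"
proof -
  have "measure lborel (U n - V n) = measure lborel (U n) - measure lborel (V n)"
    using emeasure_U[of n] V_subset_U[of n] by (intro measure_Diff) auto
  then show ?thesis using emeasure_U[of n] by (simp add: window_area_def measure_def)
qed

lemma a_le_card: "a n \<le> card (D n)"
  using measure_boundary[of n] measure_nonneg[of lborel "U n - V n"] by linarith

lemma a_at_top: "filterlim a at_top sequentially"
proof -
  have "(\<lambda>n. emeasure lborel (V n)) \<longlonglongrightarrow> emeasure lborel (\<Union>n. V n)"
    using windows(2) by (intro Lim_emeasure_incseq) (auto simp: incseq_def erosion_mono)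
  then show ?thesis
    by (simp add: emeasure_V windows(3) ennreal_tendsto_top_eq_at_top)
qed

lemma card_D_at_top: "filterlim (\<lambda>n. card (D n)) at_top sequentially"
proof -
  have "\<forall>\<^sub>F n in sequentially. Z \<le> card (D n)" for Z
  proof -
    have "\<forall>\<^sub>F n in sequentially. real Z \<le> a n"
      using a_at_top by (simp add: filterlim_at_top)
    then show ?thesis
    proof eventually_elim
      case (elim n)
      with a_le_card[of n] have "real Z \<le> real (card (D n))" by linarith
      then show ?case by simp
    qed
  qed
  then show ?thesis by (simp add: filterlim_at_top)
qed

lemma eventually_a_pos: "\<forall>\<^sub>F n in sequentially. a n > 0"
  using a_at_top unfolding filterlim_at_top_dense by blast

text \<open>The variables \<open>R n\<close> stand for the contribution of \<open>U n - V n\<close>, whose mean is proportional to its area. Divided by the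
  area $a_n$ of the window it tends to 0 in mean, since $\# D_n / a_n \to 1$; for the same reason
  dividing by $a_n$ or by the number of cells makes no difference in the limit.\<close>

lemma windowed_weak_law:
  fixes Y :: "int \<Rightarrow> 'a \<Rightarrow> real" and R :: "nat \<Rightarrow> 'a \<Rightarrow> real"
  assumes Y: "\<And>l. Y l \<in> borel_measurable (region_sigma M N (dilation (cell l) r))"
      "\<And>l. integrable M (Y l)" "\<And>l \<omega>. \<omega> \<in> space M \<Longrightarrow> 0 \<le> Y l \<omega>" "\<And>l. expectation (Y l) = \<mu>"
    and ui: "\<And>\<epsilon>. 0 < \<epsilon> \<Longrightarrow> \<exists>L\<ge>0. \<forall>l. expectation (\<lambda>\<omega>. max 0 (Y l \<omega> - L)) \<le> \<epsilon>"
    and R: "\<And>n. integrable M (R n)" "\<And>n \<omega>. \<omega> \<in> space M \<Longrightarrow> 0 \<le> R n \<omega>"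
      "\<And>n. expectation (R n) = measure lborel (U n - V n) * \<mu>"
  shows "((\<lambda>(n, \<omega>). ((\<Sum>l\<in>D n. Y l \<omega>) - R n \<omega>) / a n) \<longlongrightarrow> \<mu>) (whp_filter M)"
proof -
  let ?avg = "\<lambda>n \<omega>. (\<Sum>l\<in>D n. Y l \<omega>) / card (D n)"
  note ratio = windows(4)
  have "((\<lambda>(n, \<omega>). ?avg n \<omega>) \<longlongrightarrow> \<mu>) (whp_filter M)"
  proof (rule tendsto_whp_L1)
    show "(\<lambda>n. expectation (\<lambda>\<omega>. \<bar>?avg n \<omega> - \<mu>\<bar>)) \<longlonglongrightarrow> 0"
      by (rule mixing_weak_law[OF Y(2,3,4) ui mixing_product_bound[OF Y(1) Y(1)]
            mixing_coeff_bounds(1)[OF prob_space_axioms] summable_mixing_coeff finite_D card_D_at_top])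
  qed (use Y in auto)
  moreover have "((\<lambda>(n, \<omega>). R n \<omega> / a n) \<longlongrightarrow> 0) (whp_filter M)"
  proof (rule tendsto_whp_L1)
    have "(\<lambda>n. (real (card (D n)) / a n - 1) * \<mu>) \<longlonglongrightarrow> (1 - 1) * \<mu>"
      by (intro tendsto_intros ratio)
    moreover have "\<forall>\<^sub>F n in sequentially. (real (card (D n)) / a n - 1) * \<mu> = expectation (\<lambda>\<omega>. \<bar>R n \<omega> / a n - 0\<bar>)"
      using eventually_a_pos
    proof eventually_elim
      case (elim n)
      have "expectation (\<lambda>\<omega>. \<bar>R n \<omega> / a n - 0\<bar>) = expectation (\<lambda>\<omega>. R n \<omega> / a n)"
        using R(2) elim by (intro Bochner_Integration.integral_cong) auto
      also have "\<dots> = (card (D n) - a n) * \<mu> / a n"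
        by (simp add: R measure_boundary)
      finally show ?case using elim by (simp add: field_simps)
    qed
    ultimately show "(\<lambda>n. expectation (\<lambda>\<omega>. \<bar>R n \<omega> / a n - 0\<bar>)) \<longlonglongrightarrow> 0"
      by (simp add: Lim_transform_eventually)
  qed (use R in auto)
  ultimately have "((\<lambda>z. (case z of (n, \<omega>) \<Rightarrow> real (card (D n)) / a n) * (case z of (n, \<omega>) \<Rightarrow> ?avg n \<omega>)
      - (case z of (n, \<omega>) \<Rightarrow> R n \<omega> / a n)) \<longlongrightarrow> 1 * \<mu> - 0) (whp_filter M)"
    by (intro tendsto_intros tendsto_whp_deterministic ratio)
  then show ?thesis
  proof (simp only: mult_1 diff_0_right, elim Lim_transform_eventually)
    show "\<forall>\<^sub>F z in whp_filter M. (case z of (n, \<omega>) \<Rightarrow> real (card (D n)) / a n) * (case z of (n, \<omega>) \<Rightarrow> ?avg n \<omega>)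
        - (case z of (n, \<omega>) \<Rightarrow> R n \<omega> / a n) = (case z of (n, \<omega>) \<Rightarrow> ((\<Sum>l\<in>D n. Y l \<omega>) - R n \<omega>) / a n)"
      using eventually_whp_sequentially[OF eventually_a_pos]
    proof eventually_elim
      case (elim z)
      then have "card (D (fst z)) \<noteq> 0" using a_le_card[of "fst z"] by auto
      then show ?case by (simp add: case_prod_unfold diff_divide_distrib)
    qed
  qed
qed

lemma intensity_est_consistent:
  assumes i: "i \<in> {1,2}"
  shows "((\<lambda>(n, \<omega>). intensity_est r N (W n) i \<omega>) \<longlongrightarrow> intensity M N i) (whp_filter M)"
proof -
  note [measurable] = measurable_count[OF i]
  have pos: "0 < intensity M N i" using positive_intensity i by auto
  have fin: "emeasure (N i \<omega>) A = ennreal (measure (N i \<omega>) A)" if "\<omega> \<in> space M" "A \<in> sets borel" "bounded A" for \<omega> A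
    using finite_count[OF i that] by (intro emeasure_eq_ennreal_measure) auto
  have mm[measurable]: "(\<lambda>\<omega>. measure (N i \<omega>) A) \<in> borel_measurable M" if "A \<in> sets borel" for A
    unfolding measure_def using that by measurable
  have nn: "(\<integral>\<^sup>+\<omega>. ennreal (measure (N i \<omega>) A) \<partial>M) = ennreal (intensity M N i * measure lborel A)"
    if A: "A \<in> sets borel" "bounded A" for A
  proof -
    have "(\<integral>\<^sup>+\<omega>. ennreal (measure (N i \<omega>) A) \<partial>M) = (\<integral>\<^sup>+\<omega>. emeasure (N i \<omega>) A \<partial>M)"
      using fin[OF _ A] by (intro nn_integral_cong) simp
    also have "\<dots> = ennreal (intensity M N i) * emeasure lborel A" by (rule mean_count[OF i A])
    also have "emeasure lborel A = ennreal (measure lborel A)"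
      using emeasure_bounded_finite[OF A(2)] by (intro emeasure_eq_ennreal_measure) auto
    finally show ?thesis using pos by (simp add: ennreal_mult)
  qed
  have int: "integrable M (\<lambda>\<omega>. measure (N i \<omega>) A)" if A: "A \<in> sets borel" "bounded A" for A
    by (rule integrableI_nonneg) (use A nn in auto)
  have mean: "expectation (\<lambda>\<omega>. measure (N i \<omega>) A) = intensity M N i * measure lborel A"
    if A: "A \<in> sets borel" "bounded A" for A
    by (rule integral_eq_nn_integral[THEN trans]) (use A nn pos in auto)
  have ui: "\<exists>L\<ge>0. \<forall>l. expectation (\<lambda>\<omega>. max 0 (measure (N i \<omega>) (cell l) - L)) \<le> \<epsilon>" if e: "0 < \<epsilon>" for \<epsilon>
  proof -
    have "(\<lambda>k::nat. \<integral>\<^sup>+\<omega>. (emeasure (N i \<omega>) (cell 0) - of_nat k) * 1 \<partial>M) \<longlonglongrightarrow> 0"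
      using mean_count_finite[OF i, of "cell 0"] finite_count[OF i, of _ "cell 0"]
      by (intro nn_integral_excess_tendsto_0) auto
    then have "\<forall>\<^sub>F k::nat in sequentially. (\<integral>\<^sup>+\<omega>. (emeasure (N i \<omega>) (cell 0) - of_nat k) * 1 \<partial>M) < ennreal \<epsilon>"
      using e by (intro order_tendstoD) auto
    then obtain L :: nat where L: "(\<integral>\<^sup>+\<omega>. emeasure (N i \<omega>) (cell 0) - of_nat L \<partial>M) < ennreal \<epsilon>"
      by (auto simp: eventually_sequentially)
    have "expectation (\<lambda>\<omega>. max 0 (measure (N i \<omega>) (cell l) - real L)) \<le> \<epsilon>" for l
    proof (rule expectation_excess_le)
      have "(\<integral>\<^sup>+\<omega>. ennreal (measure (N i \<omega>) (cell l)) - ennreal (real L) \<partial>M) = (\<integral>\<^sup>+\<omega>. emeasure (N i \<omega>) (cell l) - of_nat L \<partial>M)"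
        by (intro nn_integral_cong) (simp add: fin ennreal_of_nat_eq_real_of_nat)
      also have "\<dots> = (\<integral>\<^sup>+\<omega>. emeasure (N i \<omega>) (cell 0) - of_nat L \<partial>M)"
        using stationary_count[OF i, of "cell 0" "\<lambda>x. x - of_nat L" "real_of_int l"] by (simp add: translate_cell)
      finally show "(\<integral>\<^sup>+\<omega>. ennreal (measure (N i \<omega>) (cell l)) - ennreal (real L) \<partial>M) \<le> ennreal \<epsilon>"
        using L by simp
    qed (use int e in auto)
    then show ?thesis by (intro exI[of _ "real L"]) auto
  qed
  have "((\<lambda>(n, \<omega>). ((\<Sum>l\<in>D n. measure (N i \<omega>) (cell l)) - measure (N i \<omega>) (U n - V n)) / a n) \<longlongrightarrow> intensity M N i) (whp_filter M)"
  proof (rule windowed_weak_law)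
    show "(\<lambda>\<omega>. measure (N i \<omega>) (cell l)) \<in> borel_measurable (region_sigma M N (dilation (cell l) r))" for l
      unfolding measure_def using measurable_count_cell_region[OF i] by measurable
    show "expectation (\<lambda>\<omega>. measure (N i \<omega>) (cell l)) = intensity M N i" for l
      by (simp add: mean measure_cell)
    show "expectation (\<lambda>\<omega>. measure (N i \<omega>) (U n - V n)) = measure lborel (U n - V n) * intensity M N i" for n
      by (subst mean) (auto intro: bounded_diff)
    show "integrable M (\<lambda>\<omega>. measure (N i \<omega>) (U n - V n))" for n
      by (rule int) (auto intro: bounded_diff)
  qed (use int ui in auto)
  then show ?thesis
  proof (rule Lim_transform_eventually)
    show "\<forall>\<^sub>F z in whp_filter M. (case z of (n, \<omega>) \<Rightarrow> ((\<Sum>l\<in>D n. measure (N i \<omega>) (cell l)) - measure (N i \<omega>) (U n - V n)) / a n)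
        = (case z of (n, \<omega>) \<Rightarrow> intensity_est r N (W n) i \<omega>)"
      using eventually_whp_space
    proof eventually_elim
      case (elim z)
      obtain n \<omega> where z: "z = (n, \<omega>)" by (cases z)
      then have w: "\<omega> \<in> space M" using elim by simp
      interpret point_configuration "N i \<omega>" using configuration[OF i w] .
      have "measure (N i \<omega>) (U n) = (\<Sum>l\<in>D n. measure (N i \<omega>) (cell l))"
        using finite_count[OF i w] by (intro measure_finite_Union) (auto simp: disjoint_cells less_top)
      moreover have "measure (N i \<omega>) (U n - V n) = measure (N i \<omega>) (U n) - measure (N i \<omega>) (V n)"
        using finite_count[OF i w, of "U n"] V_subset_U[of n] by (intro measure_Diff) (auto simp: less_top)
      ultimately show ?case by (simp add: z intensity_est_def)
    qed
  qed
qed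

text \<open>The weight vanishes where $|u| \ge r$, not only where $|u| > r$, so that the partners of the points of a cell lie in the
  open neighbourhood of the cell on which the mixing condition is formulated.\<close>

lemma cross_sum_weak_law:
  fixes h :: "real \<Rightarrow> real"
  assumes h[measurable]: "h \<in> borel_measurable borel" "\<And>u. 0 \<le> h u" and int: "integrable lborel (\<lambda>u. h u * lam u)"
    and supp: "\<And>u. r \<le> \<bar>u\<bar> \<Longrightarrow> h u = 0"
  shows "((\<lambda>(n, \<omega>). enn2real (cross_sum N h (V n) \<omega>) / a n) \<longlongrightarrow> (LINT u|lborel. h u * lam u)) (whp_filter M)"
proof -
  let ?I = "LINT u|lborel. h u * lam u"
  let ?E = "\<lambda>l. dilation (cell l) r"
  let ?Y = "\<lambda>l \<omega>. enn2real (cross_integral N h (cell l) (?E l) \<omega>)"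
  let ?R = "\<lambda>n \<omega>. enn2real (cross_integral N h (U n - V n) (\<Union>l\<in>D n. ?E l) \<omega>)"
  have sY: "y \<in> ?E l" if "x \<in> cell l" "h (y - x) \<noteq> 0" for x y l
  proof -
    have "\<bar>y - x\<bar> < r" using supp[of "y - x"] that by force
    then show ?thesis using that(1) by (auto simp: dilation_def dist_real_def)
  qed
  \<comment> \<open>The boundary region \<open>U n - V n\<close> has no structure, so the set of possible partners is taken to be
    the neighbourhood of all cells.\<close>
  have sR: "y \<in> (\<Union>l\<in>D n. ?E l)" if "x \<in> U n - V n" "h (y - x) \<noteq> 0" for x y n
    using that sY by blast
  have bR: "bounded (U n - V n)" "bounded (\<Union>l\<in>D n. ?E l)" for n by (auto intro: bounded_diff)
  have "((\<lambda>(n, \<omega>). ((\<Sum>l\<in>D n. ?Y l \<omega>) - ?R n \<omega>) / a n) \<longlongrightarrow> ?I) (whp_filter M)"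
  proof (rule windowed_weak_law)
    show "?Y l \<in> borel_measurable (region_sigma M N (?E l))" for l
    proof -
      have "cross_integral N h (cell l) (?E l) \<in> borel_measurable (region_sigma M N (?E l))"
      proof (rule measurable_cross_integral)
        fix A :: "real set" assume A: "A \<in> sets borel"
        have "A \<inter> cell l \<inter> ?E l = A \<inter> cell l" using cell_subset_dilation[OF r_pos] by blast
        then show "(\<lambda>\<omega>. emeasure (N 1 \<omega>) (A \<inter> cell l)) \<in> borel_measurable (region_sigma M N (?E l))"
          using measurable_count_region_sigma[of 1 "A \<inter> cell l" N "?E l" M] A by simp
        show "(\<lambda>\<omega>. emeasure (N 2 \<omega>) (A \<inter> ?E l)) \<in> borel_measurable (region_sigma M N (?E l))"
          using measurable_count_region_sigma[of 2 A N "?E l" M] A by simp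
      qed auto
      then show ?thesis by measurable
    qed
    show "integrable M (?Y l)" for l
      using sY by (intro cross_integral_real(1)[OF h int]) auto
    show "expectation (?Y l) = ?I" for l
      using cross_integral_real(2)[OF h int, of "cell l" "?E l"] sY by (simp add: measure_cell)
    show "integrable M (?R n)" for n
      by (rule cross_integral_real(1)[OF h int _ bR(1) _ bR(2) sR]) auto
    show "expectation (?R n) = measure lborel (U n - V n) * ?I" for n
      by (rule cross_integral_real(2)[OF h int _ bR(1) _ bR(2) sR]) auto
    show "\<exists>L\<ge>0. \<forall>l. expectation (\<lambda>\<omega>. max 0 (?Y l \<omega> - L)) \<le> \<epsilon>" if "0 < \<epsilon>" for \<epsilon>
      by (rule cross_uniformly_integrable[OF h int supp that])
  qed auto
  then show ?thesis
  proof (rule Lim_transform_eventually)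
    have "AE \<omega> in M. ennreal (?Y l \<omega>) = cross_sum N h (cell l) \<omega>" for l
      using sY by (intro cross_integral_real(3)[OF h int]) auto
    moreover have "AE \<omega> in M. ennreal (?R n \<omega>) = cross_sum N h (U n - V n) \<omega>" for n
      by (rule cross_integral_real(3)[OF h int _ bR(1) _ bR(2) sR]) auto
    ultimately have "AE \<omega> in M. (\<forall>l. ennreal (?Y l \<omega>) = cross_sum N h (cell l) \<omega>) \<and>
       (\<forall>n. ennreal (?R n \<omega>) = cross_sum N h (U n - V n) \<omega>)"
      by (simp add: AE_all_countable)
    from eventually_whp_AE[OF this]
    show "\<forall>\<^sub>F z in whp_filter M. (case z of (n, \<omega>) \<Rightarrow> ((\<Sum>l\<in>D n. ?Y l \<omega>) - ?R n \<omega>) / a n)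
        = (case z of (n, \<omega>) \<Rightarrow> enn2real (cross_sum N h (V n) \<omega>) / a n)"
    proof eventually_elim
      case (elim z)
      obtain n \<omega> where z: "z = (n, \<omega>)" by (cases z)
      have eY: "cross_sum N h (cell l) \<omega> = ennreal (?Y l \<omega>)" and eR: "cross_sum N h (U n - V n) \<omega> = ennreal (?R n \<omega>)" for l
        using elim by (auto simp: z)
      have "V n \<union> (U n - V n) = U n" using V_subset_U by blast
      then have "cross_sum N h (U n) \<omega> = cross_sum N h (V n) \<omega> + cross_sum N h (U n - V n) \<omega>"
        using cross_sum_Un[of "V n" "U n - V n" N h \<omega>] by simp
      then have "cross_sum N h (U n) \<omega> = cross_sum N h (V n) \<omega> + ennreal (?R n \<omega>)"
        by (simp only: eR)
      moreover have "cross_sum N h (U n) \<omega> = ennreal (\<Sum>l\<in>D n. ?Y l \<omega>)"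
        by (subst cross_sum_UN) (auto simp: disjoint_cells eY)
      ultimately have eq: "ennreal (\<Sum>l\<in>D n. ?Y l \<omega>) = cross_sum N h (V n) \<omega> + ennreal (?R n \<omega>)" by simp
      then have "cross_sum N h (V n) \<omega> \<noteq> \<top>" by auto
      then obtain c where c: "cross_sum N h (V n) \<omega> = ennreal c" "0 \<le> c"
        by (cases "cross_sum N h (V n) \<omega>") auto
      then have "ennreal (\<Sum>l\<in>D n. ?Y l \<omega>) = ennreal (c + ?R n \<omega>)" using eq by simp
      then have "(\<Sum>l\<in>D n. ?Y l \<omega>) = c + ?R n \<omega>"
        using c by (subst (asm) ennreal_inj) (auto intro!: sum_nonneg)
      then show ?case using c by (simp add: z)
    qed
  qed
qed

end

section \<open>Pair sums and the quasi-likelihood\<close>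

context windowed_pair
begin

lemma finite_close_pairs:
  assumes w: "\<omega> \<in> space M" and V: "bounded V'"
  shows "finite (close_pairs r N V' \<omega>)"
proof -
  interpret N1: point_configuration "N 1 \<omega>" using configuration[of 1 \<omega>] w by simp
  interpret N2: point_configuration "N 2 \<omega>" using configuration[of 2 \<omega>] w by simp
  obtain B where B: "\<And>x. x \<in> V' \<Longrightarrow> \<bar>x\<bar> \<le> B" using V by (auto simp: bounded_iff)
  have "close_pairs r N V' \<omega> \<subseteq> (points (N 1 \<omega>) \<inter> V') \<times> (points (N 2 \<omega>) \<inter> {- B - r..B + r})"
    using B by (fastforce simp: close_pairs_def abs_le_iff)
  then show ?thesis
    by (rule finite_subset) (intro finite_cartesian_product N1.finite_points_bounded[OF V] N2.finite_points_bounded bounded_closed_interval)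
qed

lemma pair_sum_eq_sum:
  "\<omega> \<in> space M \<Longrightarrow> bounded V' \<Longrightarrow> pair_sum r N h V' \<omega> = (\<Sum>(x, y)\<in>close_pairs r N V' \<omega>. h (y - x))"
  unfolding pair_sum_def using finite_close_pairs by simp

lemma cross_sum_eq_sum:
  assumes w: "\<omega> \<in> space M" "bounded V'" and h: "\<And>u. r < \<bar>u\<bar> \<Longrightarrow> h u = 0" "\<And>u. 0 \<le> h u"
  shows "cross_sum N (\<lambda>u. ennreal (h u)) V' \<omega> = ennreal (\<Sum>(x, y)\<in>close_pairs r N V' \<omega>. h (y - x))"
proof -
  have "cross_sum N (\<lambda>u. ennreal (h u)) V' \<omega> = (\<Sum>(x, y)\<in>close_pairs r N V' \<omega>. ennreal (h (y - x)))"
    unfolding cross_sum_def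
  proof (rule nn_integral_count_space')
    show "finite (close_pairs r N V' \<omega>)" by (rule finite_close_pairs[OF w])
    show "(case p of (x, y) \<Rightarrow> ennreal (h (y - x))) = 0"
      if "p \<in> {(x, y). x \<in> points (N 1 \<omega>) \<and> y \<in> points (N 2 \<omega>) \<and> x \<in> V'}" "p \<notin> close_pairs r N V' \<omega>" for p
    proof -
      have "r < \<bar>snd p - fst p\<bar>" using that by (auto simp: close_pairs_def)
      from h(1)[OF this] show ?thesis by (simp add: case_prod_unfold)
    qed
  qed (auto simp: close_pairs_def)
  also have "\<dots> = ennreal (\<Sum>(x, y)\<in>close_pairs r N V' \<omega>. h (y - x))"
    unfolding case_prod_unfold using h(2) by (intro sum_ennreal) auto
  finally show ?thesis .
qed

text \<open>The cross-intensity identity gives mean 0 to the number of pairs with difference in a null set.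
  Properties of $g(u;\theta)$ that hold for almost every $u$ are therefore available at all
  differences that occur in a pair sum.\<close>

lemma AE_differences_avoid_null_set:
  assumes Z[measurable]: "Z \<in> sets borel" and null: "emeasure lborel Z = 0"
  shows "AE \<omega> in M. \<forall>(x, y)\<in>close_pairs r N UNIV \<omega>. y - x \<notin> Z"
proof -
  \<comment> \<open>Cut off to \<open>{-r..r}\<close> so that the partners of the points of a cell form a bounded set.\<close>
  let ?h = "\<lambda>u. indicator (Z \<inter> {-r..r}) u :: real"
  let ?E = "\<lambda>l. {real_of_int l - 1/2 - r..real_of_int l + 1/2 + r}"
  have sup: "y \<in> ?E l" if "x \<in> cell l" "?h (y - x) \<noteq> 0" for x y l
    using that by (auto simp: cell_def indicator_def split: if_splits)
  have lam: "lam \<in> borel_measurable borel"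
    using cross_intensity by (auto simp: is_cross_intensity_def)
  have nullZ: "AE u in lborel. ?h u * lam u = 0"
  proof -
    have "AE u in lborel. u \<notin> Z"
      by (rule AE_not_in) (use Z null in \<open>auto intro: null_setsI\<close>)
    then show ?thesis by eventually_elim (auto simp: indicator_def)
  qed
  have int: "integrable lborel (\<lambda>u. ?h u * lam u)" and I: "(LINT u|lborel. ?h u * lam u) = 0"
  proof -
    show "integrable lborel (\<lambda>u. ?h u * lam u)"
      by (rule integrable_cong_AE_imp[where g="\<lambda>u. 0"]) (use lam nullZ in auto)
    show "(LINT u|lborel. ?h u * lam u) = 0" by (rule integral_eq_zero_AE[OF nullZ])
  qed
  have "AE \<omega> in M. cross_sum N ?h (cell l) \<omega> = 0" for l
  proof -
    let ?X = "\<lambda>\<omega>. enn2real (cross_integral N ?h (cell l) (?E l) \<omega>)"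
    have h: "?h \<in> borel_measurable borel" "\<And>u. 0 \<le> ?h u" by auto
    have "integrable M ?X" "expectation ?X = 0"
      using cross_integral_real(1)[OF h int _ _ _ _ sup, of "cell l" l] cross_integral_real(2)[OF h int _ _ _ _ sup, of "cell l" l] I
      by auto
    then have "AE \<omega> in M. ?X \<omega> = 0" by (subst (asm) integral_nonneg_eq_0_iff_AE) auto
    moreover have "AE \<omega> in M. ennreal (?X \<omega>) = cross_sum N ?h (cell l) \<omega>"
      by (rule cross_integral_real(3)[OF h int _ _ _ _ sup]) auto
    ultimately show ?thesis by eventually_elim simp
  qed
  then have "AE \<omega> in M. \<forall>l. cross_sum N ?h (cell l) \<omega> = 0" by (simp add: AE_all_countable)
  then show ?thesis
  proof eventually_elim
    case (elim \<omega>)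
    show ?case
    proof (clarify)
      fix x y assume xy: "(x, y) \<in> close_pairs r N UNIV \<omega>" and "y - x \<in> Z"
      let ?S = "{(x', y'). x' \<in> points (N 1 \<omega>) \<and> y' \<in> points (N 2 \<omega>) \<and> x' \<in> cell \<lceil>x - 1/2\<rceil>}"
      have "(\<integral>\<^sup>+z. ennreal (?h (snd z - fst z)) \<partial>count_space ?S) = 0"
        using elim unfolding cross_sum_def by (simp add: case_prod_unfold)
      then have "AE z in count_space ?S. ennreal (?h (snd z - fst z)) = 0"
        by (subst (asm) nn_integral_0_iff_AE) auto
      moreover have "(x, y) \<in> ?S" using xy cell_ceiling by (auto simp: close_pairs_def)
      ultimately have "?h (y - x) = 0" by (auto simp: AE_count_space)
      moreover have "?h (y - x) = 1"
        using \<open>y - x \<in> Z\<close> xy by (auto simp: close_pairs_def indicator_def)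
      ultimately show False by simp
    qed
  qed
qed

text \<open>Positive and negative part are treated separately. Both are cut off to the open interval
  $(-r,r)$, which changes nothing almost surely because $\{-r,r\}$ is a null set.\<close>

lemma pair_sum_weak_law:
  assumes h[measurable]: "h \<in> borel_measurable borel" and int: "set_integrable lborel {-r..r} (\<lambda>u. h u * lam u)"
  shows "((\<lambda>(n, \<omega>). pair_sum r N h (V n) \<omega> / a n) \<longlongrightarrow> (LINT u:{-r..r}|lborel. h u * lam u)) (whp_filter M)"
proof -
  define part where "part k u = indicator {-r<..<r} u * max 0 (k u)" for k :: "real \<Rightarrow> real" and u
  have lam[measurable]: "lam \<in> borel_measurable borel" and lam0: "\<And>u. 0 \<le> lam u"
    using cross_intensity by (auto simp: is_cross_intensity_def)
  have part_int: "integrable lborel (\<lambda>u. part k u * lam u)"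
    if [measurable]: "k \<in> borel_measurable borel" and k: "\<And>u. \<bar>k u\<bar> = \<bar>h u\<bar>" for k
  proof (rule Bochner_Integration.integrable_bound)
    show "integrable lborel (\<lambda>u. indicator {-r..r} u *\<^sub>R (h u * lam u))"
      using int by (simp add: set_integrable_def)
    show "AE u in lborel. norm (part k u * lam u) \<le> norm (indicator {-r..r} u *\<^sub>R (h u * lam u))"
      using lam0 k by (intro AE_I2)
        (auto simp: part_def indicator_def abs_mult k[symmetric] intro!: mult_right_mono)
  qed (simp add: part_def)
  have law: "((\<lambda>(n, \<omega>). enn2real (cross_sum N (part k) (V n) \<omega>) / a n) \<longlongrightarrow> (LINT u|lborel. part k u * lam u)) (whp_filter M)"
    if [measurable]: "k \<in> borel_measurable borel" and k: "\<And>u. \<bar>k u\<bar> = \<bar>h u\<bar>" for k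
    by (rule cross_sum_weak_law[OF _ _ part_int]) (use that in \<open>auto simp: part_def indicator_def\<close>)
  let ?hn = "\<lambda>u. - h u"
  have "(LINT u:{-r..r}|lborel. h u * lam u) = (LINT u|lborel. part h u * lam u - part ?hn u * lam u)"
    unfolding set_lebesgue_integral_def
  proof (rule integral_cong_AE)
    have "AE u in lborel. u \<noteq> r \<and> u \<noteq> - r" by (auto intro: AE_conjI AE_lborel_singleton)
    then show "AE u in lborel. indicator {-r..r} u *\<^sub>R (h u * lam u) = part h u * lam u - part ?hn u * lam u"
      by eventually_elim (auto simp: part_def indicator_def max_def)
  qed (auto simp: part_def)
  also have "\<dots> = (LINT u|lborel. part h u * lam u) - (LINT u|lborel. part ?hn u * lam u)"
    by (rule Bochner_Integration.integral_diff) (auto intro!: part_int)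
  finally have lim: "(LINT u:{-r..r}|lborel. h u * lam u) = (LINT u|lborel. part h u * lam u) - (LINT u|lborel. part ?hn u * lam u)" .
  have "((\<lambda>z. (case z of (n, \<omega>) \<Rightarrow> enn2real (cross_sum N (part h) (V n) \<omega>) / a n) -
      (case z of (n, \<omega>) \<Rightarrow> enn2real (cross_sum N (part ?hn) (V n) \<omega>) / a n))
      \<longlongrightarrow> (LINT u:{-r..r}|lborel. h u * lam u)) (whp_filter M)"
    unfolding lim by (intro tendsto_diff law) auto
  then show ?thesis
  proof (rule Lim_transform_eventually)
    have "AE \<omega> in M. \<forall>(x, y)\<in>close_pairs r N UNIV \<omega>. y - x \<notin> {-r, r}"
      by (rule AE_differences_avoid_null_set) (auto simp: emeasure_lborel_countable)
    with AE_space have "AE \<omega> in M. \<omega> \<in> space M \<and> (\<forall>(x, y)\<in>close_pairs r N UNIV \<omega>. y - x \<notin> {-r, r})"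
      by eventually_elim simp
    from eventually_whp_AE[OF this]
    show "\<forall>\<^sub>F z in whp_filter M.
        (case z of (n, \<omega>) \<Rightarrow> enn2real (cross_sum N (part h) (V n) \<omega>) / a n) -
        (case z of (n, \<omega>) \<Rightarrow> enn2real (cross_sum N (part ?hn) (V n) \<omega>) / a n)
        = (case z of (n, \<omega>) \<Rightarrow> pair_sum r N h (V n) \<omega> / a n)"
    proof eventually_elim
      case (elim z)
      obtain n \<omega> where z: "z = (n, \<omega>)" by (cases z)
      have w: "\<omega> \<in> space M" and no: "\<forall>(x, y)\<in>close_pairs r N UNIV \<omega>. y - x \<notin> {-r, r}"
        using elim by (auto simp: z)
      let ?P = "close_pairs r N (V n) \<omega>"
      have cs: "enn2real (cross_sum N (part k) (V n) \<omega>) = (\<Sum>(x, y)\<in>?P. part k (y - x))" for k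
      proof -
        have p0: "0 \<le> part k u" for u by (simp add: part_def)
        have "cross_sum N (part k) (V n) \<omega> = ennreal (\<Sum>(x, y)\<in>?P. part k (y - x))"
          by (rule cross_sum_eq_sum[OF w bounded_V]) (auto simp: part_def indicator_def)
        moreover have "0 \<le> (\<Sum>(x, y)\<in>?P. part k (y - x))"
          unfolding case_prod_unfold by (intro sum_nonneg p0)
        ultimately show ?thesis by simp
      qed
      have "(\<Sum>(x, y)\<in>?P. part h (y - x)) - (\<Sum>(x, y)\<in>?P. part ?hn (y - x)) = (\<Sum>(x, y)\<in>?P. h (y - x))"
        unfolding sum_subtractf[symmetric]
      proof (rule sum.cong)
        fix p assume p: "p \<in> ?P"
        then have "p \<in> close_pairs r N UNIV \<omega>" by (auto simp: close_pairs_def)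
        with no have "snd p - fst p \<notin> {-r, r}" by auto
        with p have "\<bar>snd p - fst p\<bar> < r" by (auto simp: close_pairs_def abs_if split: if_splits)
        then have "snd p - fst p \<in> {-r<..<r}" by (auto simp: abs_less_iff)
        then show "(case p of (x, y) \<Rightarrow> part h (y - x)) - (case p of (x, y) \<Rightarrow> part ?hn (y - x)) = (case p of (x, y) \<Rightarrow> h (y - x))"
          by (simp add: part_def case_prod_unfold max_def del: greaterThanLessThan_iff)
      qed simp
      then show ?case by (simp add: z cs pair_sum_eq_sum[OF w] diff_divide_distrib[symmetric])
    qed
  qed
qed

text \<open>On this event no logarithm takes the value $-\infty$, and the extended criterion is a real number.\<close>

lemma quasi_loglik_eq:
  assumes w: "\<omega> \<in> space M"
    and pos: "\<And>x y. (x, y) \<in> close_pairs r N (V n) \<omega> \<Longrightarrow> 0 < g (y - x) \<theta>"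
    and est: "0 < intensity_est r N (W n) 1 \<omega>" "0 < intensity_est r N (W n) 2 \<omega>"
  shows "quasi_loglik r N g (W n) \<omega> \<theta> = ereal (pair_sum r N (\<lambda>u. ln (g u \<theta>)) (V n) \<omega>
    + real (card (close_pairs r N (V n) \<omega>)) * (ln (intensity_est r N (W n) 1 \<omega>) + ln (intensity_est r N (W n) 2 \<omega>))
    - a n * intensity_est r N (W n) 1 \<omega> * intensity_est r N (W n) 2 \<omega> * (LINT u:{-r..r}|lborel. g u \<theta>))"
proof -
  let ?P = "close_pairs r N (V n) \<omega>"
  let ?l = "\<lambda>i. intensity_est r N (W n) i \<omega>"
  have "(\<Sum>(x, y)\<in>?P. elog (g (y - x) \<theta>) + elog (?l 1) + elog (?l 2))
      = (\<Sum>p\<in>?P. ereal ((case p of (x, y) \<Rightarrow> ln (g (y - x) \<theta>)) + (ln (?l 1) + ln (?l 2))))"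
  proof (rule sum.cong)
    fix p assume "p \<in> ?P"
    then have "0 < g (snd p - fst p) \<theta>" using pos[of "fst p" "snd p"] by simp
    then show "(case p of (x, y) \<Rightarrow> elog (g (y - x) \<theta>) + elog (?l 1) + elog (?l 2))
        = ereal ((case p of (x, y) \<Rightarrow> ln (g (y - x) \<theta>)) + (ln (?l 1) + ln (?l 2)))"
      using est by (simp add: elog_def case_prod_unfold add.assoc)
  qed simp
  also have "\<dots> = ereal (\<Sum>p\<in>?P. (case p of (x, y) \<Rightarrow> ln (g (y - x) \<theta>)) + (ln (?l 1) + ln (?l 2)))"
    by (rule sum_ereal)
  also have "\<dots> = ereal (pair_sum r N (\<lambda>u. ln (g u \<theta>)) (V n) \<omega> + real (card ?P) * (ln (?l 1) + ln (?l 2)))"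
    by (simp add: sum.distrib pair_sum_eq_sum[OF w])
  finally show ?thesis unfolding quasi_loglik_def by simp
qed

end

section \<open>Consistency of maximisers of Lipschitz criteria and the limiting contrast\<close>

text \<open>Wald's argument. Around a parameter other than \<open>\<theta>s\<close> there is a ball, of a radius proportional to
  the gap \<open>L \<theta>s - L \<theta>\<close>, on which the criterion eventually stays below its value at \<open>\<theta>s\<close>: convergence at the
  centre and the Lipschitz bound each use up a quarter of the gap, and convergence at \<open>\<theta>s\<close> another one.
  Finitely many such balls cover the parameters at distance at least $\epsilon$.\<close>

lemma m_estimator_consistent:
  fixes Ln :: "'z \<Rightarrow> 'b::metric_space \<Rightarrow> real"
  assumes K: "compact K" "\<theta>s \<in> K"
    and conv: "\<And>\<theta>. \<theta> \<in> K \<Longrightarrow> ((\<lambda>z. Ln z \<theta>) \<longlongrightarrow> L \<theta>) F"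
    and lip: "\<forall>\<^sub>F z in F. \<forall>\<theta>\<in>K. \<forall>\<theta>'\<in>K. Ln z \<theta> - Ln z \<theta>' \<le> R z * dist \<theta> \<theta>'"
    and R: "(R \<longlongrightarrow> \<rho>) F"
    and sep: "\<And>\<theta>. \<theta> \<in> K \<Longrightarrow> \<theta> \<noteq> \<theta>s \<Longrightarrow> L \<theta> < L \<theta>s"
    and est: "\<forall>\<^sub>F z in F. est z \<in> K \<and> Ln z \<theta>s \<le> Ln z (est z)"
    and e: "0 < \<epsilon>"
  shows "\<forall>\<^sub>F z in F. dist (est z) \<theta>s \<le> \<epsilon>"
proof -
  define K' where "K' = K - ball \<theta>s \<epsilon>"
  have K': "compact K'" unfolding K'_def using K(1) by (rule compact_diff) simp
  define d where "d \<theta> = (L \<theta>s - L \<theta>) / (4 * (\<bar>\<rho>\<bar> + 1))" for \<theta>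
  have sub: "\<theta> \<in> K \<and> \<theta> \<noteq> \<theta>s" if "\<theta> \<in> K'" for \<theta>
    using that e by (auto simp: K'_def)
  have d: "d \<theta> > 0" if "\<theta> \<in> K'" for \<theta>
    using sep[of \<theta>] sub[OF that] by (auto simp: d_def intro!: divide_pos_pos)
  \<comment> \<open>The radius \<open>d \<theta>\<close> makes the Lipschitz bound a quarter of the gap once the factor is below
    \<open>\<bar>\<rho>\<bar> + 1\<close>.\<close>
  have near: "\<forall>\<^sub>F z in F. \<forall>\<theta>'\<in>K \<inter> ball \<theta> (d \<theta>). Ln z \<theta>' < Ln z \<theta>s" if th: "\<theta> \<in> K'" for \<theta>
  proof -
    have thK: "\<theta> \<in> K" using sub[OF th] by simp
    define \<eta> where "\<eta> = L \<theta>s - L \<theta>"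
    have \<eta>: "\<eta> > 0" using sep[of \<theta>] sub[OF th] by (auto simp: \<eta>_def)
    have "\<forall>\<^sub>F z in F. Ln z \<theta> < L \<theta> + \<eta> / 4"
      by (rule order_tendstoD(2)[OF conv[OF thK]]) (use \<eta> in simp)
    moreover have "\<forall>\<^sub>F z in F. L \<theta>s - \<eta> / 4 < Ln z \<theta>s"
      by (rule order_tendstoD(1)[OF conv[OF K(2)]]) (use \<eta> in simp)
    moreover have "\<forall>\<^sub>F z in F. R z < \<bar>\<rho>\<bar> + 1"
      by (rule order_tendstoD(2)[OF R]) simp
    ultimately show ?thesis using lip
    proof eventually_elim
      case (elim z)
      show ?case
      proof
        fix \<theta>' assume t: "\<theta>' \<in> K \<inter> ball \<theta> (d \<theta>)"
        have "Ln z \<theta>' - Ln z \<theta> \<le> R z * dist \<theta>' \<theta>" using elim(4) t thK by blast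
        also have "\<dots> \<le> (\<bar>\<rho>\<bar> + 1) * dist \<theta>' \<theta>" using elim(3) by (intro mult_right_mono) auto
        also have "\<dots> \<le> (\<bar>\<rho>\<bar> + 1) * d \<theta>" using t by (intro mult_left_mono) (auto simp: dist_commute)
        also have "\<dots> = \<eta> / 4" by (simp add: d_def \<eta>_def field_simps)
        finally have "Ln z \<theta>' \<le> Ln z \<theta> + \<eta> / 4" by simp
        also have "\<dots> < L \<theta> + \<eta> / 4 + \<eta> / 4" using elim(1) by simp
        also have "\<dots> = L \<theta>s - \<eta> / 2" by (simp add: \<eta>_def field_simps)
        also have "\<dots> < L \<theta>s - \<eta> / 4" using \<eta> by simp
        also have "\<dots> < Ln z \<theta>s" by (rule elim(2))
        finally show "Ln z \<theta>' < Ln z \<theta>s" .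
      qed
    qed
  qed
  have "K' \<subseteq> (\<Union>\<theta>\<in>K'. ball \<theta> (d \<theta>))" using d by auto
  from compactE_image[OF K' _ this] obtain T where T: "T \<subseteq> K'" "finite T" "K' \<subseteq> (\<Union>\<theta>\<in>T. ball \<theta> (d \<theta>))"
    by auto
  have "\<forall>\<^sub>F z in F. \<forall>\<theta>\<in>T. \<forall>\<theta>'\<in>K \<inter> ball \<theta> (d \<theta>). Ln z \<theta>' < Ln z \<theta>s"
    using T near by (intro eventually_ball_finite) auto
  then show ?thesis using est
  proof eventually_elim
    case (elim z)
    show ?case
    proof (rule ccontr)
      assume "\<not> dist (est z) \<theta>s \<le> \<epsilon>"
      then have "est z \<in> K'" using elim(2) by (auto simp: K'_def dist_commute)
      then obtain \<theta> where "\<theta> \<in> T" "est z \<in> ball \<theta> (d \<theta>)" using T(3) by auto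
      then have "Ln z (est z) < Ln z \<theta>s" using elim by blast
      then show False using elim(2) by simp
    qed
  qed
qed

text \<open>The inequality $\log x \le x - 1$ at $x = a/b$, with equality only for $x = 1$, says that
  $b \log a - a \le b \log b - b$ with equality only for $a = b$. Here $a$ and $b$ are the values
  of the two functions, and the integrals are equal only if they agree almost everywhere.\<close>

lemma log_score_strict:
  fixes f f0 :: "'a \<Rightarrow> real"
  assumes int: "integrable M f" "integrable M f0" "integrable M (\<lambda>x. ln (f x) * f0 x)" "integrable M (\<lambda>x. ln (f0 x) * f0 x)"
    and pos: "AE x in M. 0 < f x \<and> 0 < f0 x"
    and ne: "\<not> (AE x in M. f x = f0 x)"
  shows "(LINT x|M. ln (f x) * f0 x) - (LINT x|M. f x) < (LINT x|M. ln (f0 x) * f0 x) - (LINT x|M. f0 x)"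
proof -
  let ?\<phi> = "\<lambda>x. ln (f0 x) * f0 x - f0 x - (ln (f x) * f0 x - f x)"
  have i: "integrable M ?\<phi>" using int by auto
  have pt: "0 \<le> b * ln b - b - (b * ln a - a) \<and> (b * ln b - b - (b * ln a - a) = 0 \<longrightarrow> a = b)"
    if "0 < a" "0 < b" for a b :: real
  proof -
    have eq: "b * ln b - b - (b * ln a - a) = b * (a / b - 1 - ln (a / b))"
      using that by (simp add: ln_div field_simps)
    have "ln (a / b) \<le> a / b - 1" using that by (intro ln_le_minus_one) auto
    moreover have "a = b" if "ln (a / b) = a / b - 1"
      using ln_eq_minus_one[of "a / b"] that \<open>0 < a\<close> \<open>0 < b\<close> by simp
    ultimately show ?thesis unfolding eq using that by auto
  qed
  have nn: "AE x in M. 0 \<le> ?\<phi> x"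
    using pos by eventually_elim (use pt in \<open>auto simp: mult.commute\<close>)
  have "(LINT x|M. ?\<phi> x) \<noteq> 0"
  proof
    assume "(LINT x|M. ?\<phi> x) = 0"
    then have "AE x in M. ?\<phi> x = 0" using integral_nonneg_eq_0_iff_AE[OF i nn] by simp
    with pos have "AE x in M. f x = f0 x"
    proof eventually_elim
      case (elim x)
      then show ?case using pt[of "f x" "f0 x"] by (simp add: mult.commute)
    qed
    with ne show False ..
  qed
  moreover have "0 \<le> (LINT x|M. ?\<phi> x)" using nn by (rule integral_nonneg_AE)
  ultimately have "0 < (LINT x|M. ?\<phi> x)" by simp
  then show ?thesis using int by simp
qed

lemma frechet_derivative_eq_grad:
  fixes f :: "real^'p \<Rightarrow> real"
  assumes "f differentiable (at x)"
  shows "frechet_derivative f (at x) v = grad f x \<bullet> v"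
proof -
  interpret D: bounded_linear "frechet_derivative f (at x)"
    using assms frechet_derivative_works has_derivative_bounded_linear by blast
  have "frechet_derivative f (at x) v = frechet_derivative f (at x) (\<Sum>i\<in>UNIV. v $ i *\<^sub>R axis i 1)"
    by (simp add: basis_expansion scalar_mult_eq_scaleR[symmetric])
  also have "\<dots> = (\<Sum>i\<in>UNIV. v $ i * frechet_derivative f (at x) (axis i 1))"
    by (simp add: D.sum D.scaleR)
  also have "\<dots> = grad f x \<bullet> v"
    by (simp add: inner_vec_def grad_def mult.commute)
  finally show ?thesis .
qed

text \<open>The mean value inequality on the convex set, carried over to the closure by continuity.\<close>

lemma lipschitz_on_closure_of_grad:
  fixes f :: "real^'p \<Rightarrow> real"
  assumes S: "convex S" and f: "\<And>x. x \<in> S \<Longrightarrow> f differentiable (at x)" "continuous_on (closure S) f"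
    and B: "\<And>x. x \<in> S \<Longrightarrow> norm (grad f x) \<le> B" "0 \<le> B"
    and xy: "x \<in> closure S" "y \<in> closure S"
  shows "\<bar>f x - f y\<bar> \<le> B * dist x y"
proof -
  have "B-lipschitz_on S f"
  proof (rule lipschitz_onI)
    fix x y assume xy: "x \<in> S" "y \<in> S"
    have "norm (f x - f y) \<le> B * norm (x - y)"
    proof (rule differentiable_bound[OF S _ _ xy])
      fix z assume z: "z \<in> S"
      show "(f has_derivative frechet_derivative f (at z)) (at z within S)"
        using f(1)[OF z] frechet_derivative_works has_derivative_at_withinI by blast
      show "onorm (frechet_derivative f (at z)) \<le> B"
      proof (rule onorm_bound[OF B(2)])
        fix v
        have "norm (frechet_derivative f (at z) v) \<le> norm (grad f z) * norm v"
          unfolding frechet_derivative_eq_grad[OF f(1)[OF z]] by (simp add: Cauchy_Schwarz_ineq2)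
        also have "\<dots> \<le> B * norm v" using B(1)[OF z] by (intro mult_right_mono) auto
        finally show "norm (frechet_derivative f (at z) v) \<le> B * norm v" .
      qed
    qed
    then show "dist (f x) (f y) \<le> B * dist x y" by (simp add: dist_norm)
  qed (rule B(2))
  then have "B-lipschitz_on (closure S) f" by (rule lipschitz_on_closure) (rule f(2))
  from lipschitz_onD[OF this xy] show ?thesis by (simp add: dist_real_def)
qed

section \<open>Consistency\<close>

text \<open>Positivity of the family holds for almost every \<open>u\<close>, and then for all parameters at once; the null
  set of exceptional \<open>u\<close> is avoided by all differences in a pair sum almost surely.\<close>

locale parametric_pair = windowed_pair +
  fixes g :: "real \<Rightarrow> real^'p \<Rightarrow> real" and \<Theta> :: "(real^'p) set" and \<theta>s :: "real^'p" and fB1 fB2 :: "real \<Rightarrow> real"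
  assumes family: "\<And>\<theta>. \<theta> \<in> closure \<Theta> \<Longrightarrow> (\<lambda>u. g u \<theta>) \<in> borel_measurable borel"
    and true_param: "\<theta>s \<in> \<Theta>" "\<And>u. lam u = intensity M N 1 * intensity M N 2 * g u \<theta>s"
    and parameter_space: "bounded \<Theta>" "convex \<Theta>"
    and identifiability: "\<And>\<theta>. \<theta> \<in> closure \<Theta> \<Longrightarrow>
      (AE u in lborel. u \<in> {-r..r} \<longrightarrow> g u \<theta> = g u \<theta>s) \<Longrightarrow> \<theta> = \<theta>s"
    and positive: "AE u in lborel. u \<in> {-r..r} \<longrightarrow> (\<forall>\<theta>\<in>closure \<Theta>. 0 < g u \<theta>)"
    and smooth: "\<And>u. u \<in> {-r..r} \<Longrightarrow> continuous_on (closure \<Theta>) (g u)"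
      "\<And>u \<theta>. u \<in> {-r..r} \<Longrightarrow> \<theta> \<in> \<Theta> \<Longrightarrow> g u differentiable (at \<theta>)"
    and bound1: "\<And>u. u \<in> {-r..r} \<Longrightarrow> 0 \<le> fB1 u" "\<And>u \<theta>. u \<in> {-r..r} \<Longrightarrow> \<theta> \<in> \<Theta> \<Longrightarrow> \<bar>g u \<theta>\<bar> \<le> fB1 u"
      "\<And>u \<theta>. u \<in> {-r..r} \<Longrightarrow> \<theta> \<in> \<Theta> \<Longrightarrow> norm (grad (g u) \<theta>) \<le> fB1 u" "set_integrable lborel {-r..r} fB1"
    and bound2: "\<And>u. u \<in> {-r..r} \<Longrightarrow> 0 \<le> fB2 u" "\<And>u \<theta>. u \<in> {-r..r} \<Longrightarrow> \<theta> \<in> \<Theta> \<Longrightarrow> \<bar>ln (g u \<theta>)\<bar> \<le> fB2 u"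
      "\<And>u \<theta>. u \<in> {-r..r} \<Longrightarrow> \<theta> \<in> \<Theta> \<Longrightarrow> norm (grad (\<lambda>\<theta>. ln (g u \<theta>)) \<theta>) \<le> fB2 u"
      "set_borel_measurable borel {-r..r} fB2" "set_integrable lborel {-r..r} (\<lambda>u. fB2 u * g u \<theta>s)"
begin

abbreviation K where "K \<equiv> closure \<Theta>"

lemma \<theta>s_in_K: "\<theta>s \<in> K"
  using true_param(1) closure_subset by blast

lemma g_lipschitz:
  assumes "u \<in> {-r..r}" "\<theta> \<in> K" "\<theta>' \<in> K"
  shows "\<bar>g u \<theta> - g u \<theta>'\<bar> \<le> fB1 u * dist \<theta> \<theta>'"
  using assms by (intro lipschitz_on_closure_of_grad[OF parameter_space(2)] smooth bound1) auto

lemma ln_g_lipschitz: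
  assumes u: "u \<in> {-r..r}" and pos: "\<And>\<theta>. \<theta> \<in> K \<Longrightarrow> 0 < g u \<theta>" and K: "\<theta> \<in> K" "\<theta>' \<in> K"
  shows "\<bar>ln (g u \<theta>) - ln (g u \<theta>')\<bar> \<le> fB2 u * dist \<theta> \<theta>'"
proof (rule lipschitz_on_closure_of_grad[OF parameter_space(2) _ _ bound2(3)[OF u] bound2(1)[OF u] K])
  fix \<theta> assume th: "\<theta> \<in> \<Theta>"
  then have "0 < g u \<theta>" using pos closure_subset by blast
  moreover obtain f' where "(g u has_derivative f') (at \<theta>)" using smooth(2)[OF u th] by (auto simp: differentiable_def)
  ultimately have "((\<lambda>\<theta>. ln (g u \<theta>)) has_derivative (\<lambda>v. f' v * inverse (g u \<theta>))) (at \<theta>)"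
    by (intro has_derivative_ln)
  then show "(\<lambda>\<theta>. ln (g u \<theta>)) differentiable at \<theta>" by (auto simp: differentiable_def)
next
  show "continuous_on K (\<lambda>\<theta>. ln (g u \<theta>))"
    using pos by (intro continuous_on_ln smooth(1)[OF u]) force
qed

lemma set_integrable_g:
  assumes th: "\<theta> \<in> K"
  shows "set_integrable lborel {-r..r} (\<lambda>u. g u \<theta>)"
  unfolding set_integrable_def
proof (rule Bochner_Integration.integrable_bound)
  show "integrable lborel (\<lambda>u. (1 + dist \<theta> \<theta>s) * (indicator {-r..r} u *\<^sub>R fB1 u))"
    using bound1(4) by (simp add: set_integrable_def)
  have "\<bar>g u \<theta>\<bar> \<le> (1 + dist \<theta> \<theta>s) * fB1 u" if u: "u \<in> {-r..r}" for u
    using g_lipschitz[OF u th \<theta>s_in_K] bound1(2)[OF u true_param(1)] by (simp add: algebra_simps)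
  then show "AE u in lborel. norm (indicator {-r..r} u *\<^sub>R g u \<theta>) \<le> norm ((1 + dist \<theta> \<theta>s) * (indicator {-r..r} u *\<^sub>R fB1 u))"
    using bound1(1) by (intro AE_I2) (auto simp: indicator_def abs_mult)
qed (use family[OF th] in measurable)

text \<open>The bound on the logarithm at the true parameter and the Lipschitz bound control the logarithm on
  the whole closure of the parameter space.\<close>

lemma set_integrable_ln_g:
  assumes th: "\<theta> \<in> K"
  shows "set_integrable lborel {-r..r} (\<lambda>u. ln (g u \<theta>) * g u \<theta>s)"
  unfolding set_integrable_def
proof (rule Bochner_Integration.integrable_bound)
  show "integrable lborel (\<lambda>u. (1 + dist \<theta> \<theta>s) * (indicator {-r..r} u *\<^sub>R (fB2 u * g u \<theta>s)))"
    using bound2(5) by (simp add: set_integrable_def)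
  show "AE u in lborel. norm (indicator {-r..r} u *\<^sub>R (ln (g u \<theta>) * g u \<theta>s))
      \<le> norm ((1 + dist \<theta> \<theta>s) * (indicator {-r..r} u *\<^sub>R (fB2 u * g u \<theta>s)))"
    using positive
  proof eventually_elim
    case (elim u)
    show ?case
    proof (cases "u \<in> {-r..r}")
      case True
      then have pos: "\<And>\<theta>. \<theta> \<in> K \<Longrightarrow> 0 < g u \<theta>" using elim by auto
      have "\<bar>ln (g u \<theta>)\<bar> \<le> (1 + dist \<theta> \<theta>s) * fB2 u"
        using ln_g_lipschitz[OF True pos th \<theta>s_in_K] bound2(2)[OF True true_param(1)] by (simp add: algebra_simps)
      then have "\<bar>ln (g u \<theta>)\<bar> * g u \<theta>s \<le> (1 + dist \<theta> \<theta>s) * fB2 u * g u \<theta>s"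
        using pos[OF \<theta>s_in_K] by (intro mult_right_mono) auto
      then show ?thesis using True pos[OF \<theta>s_in_K] bound2(1)[OF True] by (simp add: abs_mult mult.assoc)
    qed simp
  qed
qed (use family[OF th] family[OF \<theta>s_in_K] in measurable)

definition contrast :: "real^'p \<Rightarrow> real" where
  "contrast \<theta> = (LINT u:{-r..r}|lborel. ln (g u \<theta>) * lam u)
     - intensity M N 1 * intensity M N 2 * (LINT u:{-r..r}|lborel. g u \<theta>)"

lemma contrast_strict_max:
  assumes th: "\<theta> \<in> K" and ne: "\<theta> \<noteq> \<theta>s"
  shows "contrast \<theta> < contrast \<theta>s"
proof -
  let ?c = "intensity M N 1 * intensity M N 2"
  let ?R = "restrict_space lborel {-r..r}"
  have c: "0 < ?c" using positive_intensity by simp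
  have int: "integrable ?R f \<longleftrightarrow> set_integrable lborel {-r..r} f" for f :: "real \<Rightarrow> real"
    by (simp add: integrable_restrict_space set_integrable_def)
  have LR: "(LINT u:{-r..r}|lborel. f u) = (LINT u|?R. f u)" for f :: "real \<Rightarrow> real"
    by (simp add: integral_restrict_space set_lebesgue_integral_def)
  \<comment> \<open>The true cross-intensity carries the factor \<open>?c\<close>, too, so the contrast is a multiple of the score.\<close>
  have eq: "contrast \<theta> = ?c * ((LINT u|?R. ln (g u \<theta>) * g u \<theta>s) - (LINT u|?R. g u \<theta>))" for \<theta>
  proof -
    have "(LINT u|?R. ln (g u \<theta>) * lam u) = (LINT u|?R. ?c * (ln (g u \<theta>) * g u \<theta>s))"
      by (intro Bochner_Integration.integral_cong) (auto simp: true_param(2))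
    then show ?thesis unfolding contrast_def LR by (simp add: right_diff_distrib)
  qed
  have "(LINT u|?R. ln (g u \<theta>) * g u \<theta>s) - (LINT u|?R. g u \<theta>)
      < (LINT u|?R. ln (g u \<theta>s) * g u \<theta>s) - (LINT u|?R. g u \<theta>s)"
  proof (rule log_score_strict)
    show "AE u in ?R. 0 < g u \<theta> \<and> 0 < g u \<theta>s"
      using positive th \<theta>s_in_K by (subst AE_restrict_space_iff) (auto elim: eventually_mono)
    show "\<not> (AE u in ?R. g u \<theta> = g u \<theta>s)"
      using identifiability[OF th] ne by (subst AE_restrict_space_iff) auto
  qed (use th \<theta>s_in_K set_integrable_g set_integrable_ln_g in \<open>auto simp: int\<close>)
  then show ?thesis unfolding eq using c by (rule mult_strict_left_mono)
qed

text \<open>The quasi-likelihood divided by the area of the window, without the terms that involve the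
  logarithms of the estimated intensities; these do not depend on the parameter.\<close>

definition normalized_loglik :: "nat \<times> 'a \<Rightarrow> real^'p \<Rightarrow> real" where
  "normalized_loglik = (\<lambda>(n, \<omega>) \<theta>. pair_sum r N (\<lambda>u. ln (g u \<theta>)) (V n) \<omega> / a n
     - intensity_est r N (W n) 1 \<omega> * intensity_est r N (W n) 2 \<omega> * (LINT u:{-r..r}|lborel. g u \<theta>))"

lemma normalized_loglik_tendsto:
  assumes th: "\<theta> \<in> K"
  shows "((\<lambda>z. normalized_loglik z \<theta>) \<longlongrightarrow> contrast \<theta>) (whp_filter M)"
proof -
  have "set_integrable lborel {-r..r} (\<lambda>u. (intensity M N 1 * intensity M N 2) * (ln (g u \<theta>) * g u \<theta>s))"
    using set_integrable_ln_g[OF th] by simp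
  then have "set_integrable lborel {-r..r} (\<lambda>u. ln (g u \<theta>) * lam u)"
    by (simp add: true_param(2) mult_ac)
  then have "((\<lambda>(n, \<omega>). pair_sum r N (\<lambda>u. ln (g u \<theta>)) (V n) \<omega> / a n)
      \<longlongrightarrow> (LINT u:{-r..r}|lborel. ln (g u \<theta>) * lam u)) (whp_filter M)"
    by (intro pair_sum_weak_law) (use family[OF th] in measurable)
  from tendsto_diff[OF this tendsto_mult[OF tendsto_mult[OF intensity_est_consistent[of 1] intensity_est_consistent[of 2]] tendsto_const]]
  show ?thesis unfolding contrast_def normalized_loglik_def by (simp add: case_prod_unfold)
qed

definition lipschitz_factor :: "nat \<times> 'a \<Rightarrow> real" where
  "lipschitz_factor = (\<lambda>(n, \<omega>). pair_sum r N (\<lambda>u. indicator {-r..r} u * fB2 u) (V n) \<omega> / a n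
     + intensity_est r N (W n) 1 \<omega> * intensity_est r N (W n) 2 \<omega> * (LINT u:{-r..r}|lborel. fB1 u))"

lemma lipschitz_factor_tendsto: "\<exists>\<rho>. (lipschitz_factor \<longlongrightarrow> \<rho>) (whp_filter M)"
proof -
  let ?f = "\<lambda>u. indicator {-r..r} u * fB2 u"
  have "set_integrable lborel {-r..r} (\<lambda>u. (intensity M N 1 * intensity M N 2) * (fB2 u * g u \<theta>s))"
    using bound2(5) by simp
  then have "set_integrable lborel {-r..r} (\<lambda>u. ?f u * lam u)"
    unfolding set_integrable_def
    by (rule Bochner_Integration.integrable_cong[THEN iffD1, rotated 2]) (auto simp: true_param(2) indicator_def)
  then have "((\<lambda>(n, \<omega>). pair_sum r N ?f (V n) \<omega> / a n)
      \<longlongrightarrow> (LINT u:{-r..r}|lborel. ?f u * lam u)) (whp_filter M)"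
    using bound2(4) by (intro pair_sum_weak_law) (simp_all add: set_borel_measurable_def)
  from tendsto_add[OF this tendsto_mult[OF tendsto_mult[OF intensity_est_consistent[of 1] intensity_est_consistent[of 2]] tendsto_const[of "LINT u:{-r..r}|lborel. fB1 u"]]]
  show ?thesis unfolding lipschitz_factor_def by (auto simp: case_prod_unfold)
qed

text \<open>The event on which the criterion is real-valued and the pointwise bounds can be used at every pair.\<close>

lemma eventually_good:
  "\<forall>\<^sub>F (n, \<omega>) in whp_filter M. \<omega> \<in> space M \<and> 0 < a n \<and>
     0 < intensity_est r N (W n) 1 \<omega> \<and> 0 < intensity_est r N (W n) 2 \<omega> \<and>
     (\<forall>(x, y)\<in>close_pairs r N (V n) \<omega>. \<forall>\<theta>\<in>K. 0 < g (y - x) \<theta>)"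
proof -
  from AE_E[OF positive] obtain Z where Z: "{u \<in> space lborel. \<not> (u \<in> {-r..r} \<longrightarrow> (\<forall>\<theta>\<in>K. 0 < g u \<theta>))} \<subseteq> Z"
      "emeasure lborel Z = 0" "Z \<in> sets lborel" .
  have "AE \<omega> in M. \<forall>(x, y)\<in>close_pairs r N UNIV \<omega>. y - x \<notin> Z"
    using Z by (intro AE_differences_avoid_null_set) auto
  from eventually_whp_AE[OF this] eventually_whp_space eventually_whp_sequentially[OF eventually_a_pos]
    order_tendstoD(1)[OF intensity_est_consistent[of 1] positive_intensity(1), simplified]
    order_tendstoD(1)[OF intensity_est_consistent[of 2] positive_intensity(2), simplified]
  show ?thesis
  proof eventually_elim
    case (elim z)
    obtain n \<omega> where z: "z = (n, \<omega>)" by (cases z)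
    have "0 < g (y - x) \<theta>" if "(x, y) \<in> close_pairs r N (V n) \<omega>" "\<theta> \<in> K" for x y \<theta>
    proof -
      have "y - x \<in> {-r..r}" "(x, y) \<in> close_pairs r N UNIV \<omega>"
        using that by (auto simp: close_pairs_def abs_le_iff)
      moreover from this elim(1) have "y - x \<notin> Z" by (auto simp: z)
      ultimately show ?thesis using Z(1) that(2) by auto
    qed
    then show ?case using elim by (auto simp: z)
  qed
qed

lemma normalized_loglik_lipschitz:
  "\<forall>\<^sub>F z in whp_filter M. \<forall>\<theta>\<in>K. \<forall>\<theta>'\<in>K.
     normalized_loglik z \<theta> - normalized_loglik z \<theta>' \<le> lipschitz_factor z * dist \<theta> \<theta>'"
  using eventually_good
proof eventually_elim
  case (elim z)
  obtain n \<omega> where z: "z = (n, \<omega>)" by (cases z)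
  let ?P = "close_pairs r N (V n) \<omega>"
  let ?l = "intensity_est r N (W n) 1 \<omega> * intensity_est r N (W n) 2 \<omega>"
  have w: "\<omega> \<in> space M" and a: "0 < a n" and l: "0 < ?l"
    and pos: "\<And>x y \<theta>. (x, y) \<in> ?P \<Longrightarrow> \<theta> \<in> K \<Longrightarrow> 0 < g (y - x) \<theta>"
    using elim by (auto simp: z)
  show ?case
  proof (intro ballI)
    fix \<theta> \<theta>' assume K: "\<theta> \<in> K" "\<theta>' \<in> K"
    let ?S = "\<lambda>\<theta>. pair_sum r N (\<lambda>u. ln (g u \<theta>)) (V n) \<omega>"
    let ?B = "pair_sum r N (\<lambda>u. indicator {-r..r} u * fB2 u) (V n) \<omega>"
    let ?G = "\<lambda>\<theta>. LINT u:{-r..r}|lborel. g u \<theta>"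
    have "?S \<theta> - ?S \<theta>' = (\<Sum>(x, y)\<in>?P. ln (g (y - x) \<theta>) - ln (g (y - x) \<theta>'))"
      by (simp add: pair_sum_eq_sum[OF w] case_prod_unfold sum_subtractf)
    also have "\<dots> \<le> (\<Sum>(x, y)\<in>?P. indicator {-r..r} (y - x) * fB2 (y - x) * dist \<theta> \<theta>')"
    proof (rule sum_mono, clarify)
      fix x y assume xy: "(x, y) \<in> ?P"
      then have u: "y - x \<in> {-r..r}" by (auto simp: close_pairs_def abs_le_iff)
      from ln_g_lipschitz[OF u pos[OF xy] K]
      show "ln (g (y - x) \<theta>) - ln (g (y - x) \<theta>') \<le> indicator {-r..r} (y - x) * fB2 (y - x) * dist \<theta> \<theta>'"
        using u by simp
    qed
    also have "\<dots> = ?B * dist \<theta> \<theta>'"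
      by (simp add: pair_sum_eq_sum[OF w] case_prod_unfold sum_distrib_right)
    finally have 1: "(?S \<theta> - ?S \<theta>') / a n \<le> ?B * dist \<theta> \<theta>' / a n"
      using a by (intro divide_right_mono) auto
    have "?G \<theta>' - ?G \<theta> = (LINT u:{-r..r}|lborel. g u \<theta>' - g u \<theta>)"
      using K by (intro set_integral_diff(2)[symmetric] set_integrable_g)
    also have "\<dots> \<le> (LINT u:{-r..r}|lborel. fB1 u * dist \<theta> \<theta>')"
    proof (rule set_integral_mono)
      show "set_integrable lborel {-r..r} (\<lambda>u. g u \<theta>' - g u \<theta>)"
        using K by (intro set_integral_diff(1) set_integrable_g)
      show "set_integrable lborel {-r..r} (\<lambda>u. fB1 u * dist \<theta> \<theta>')"
        using bound1(4) by simp
      show "g u \<theta>' - g u \<theta> \<le> fB1 u * dist \<theta> \<theta>'" if "u \<in> {-r..r}" for u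
        using g_lipschitz[OF that K] by simp
    qed
    also have "\<dots> = (LINT u:{-r..r}|lborel. fB1 u) * dist \<theta> \<theta>'" by simp
    finally have 2: "?l * (?G \<theta>' - ?G \<theta>) \<le> ?l * ((LINT u:{-r..r}|lborel. fB1 u) * dist \<theta> \<theta>')"
      using l by (intro mult_left_mono) auto
    have "normalized_loglik z \<theta> - normalized_loglik z \<theta>' = (?S \<theta> - ?S \<theta>') / a n + ?l * (?G \<theta>' - ?G \<theta>)"
      by (simp add: z normalized_loglik_def diff_divide_distrib right_diff_distrib)
    also have "\<dots> \<le> ?B * dist \<theta> \<theta>' / a n + ?l * ((LINT u:{-r..r}|lborel. fB1 u) * dist \<theta> \<theta>')"
      using 1 2 by (rule add_mono)
    also have "\<dots> = lipschitz_factor z * dist \<theta> \<theta>'"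
      by (simp add: z lipschitz_factor_def distrib_right)
    finally show "normalized_loglik z \<theta> - normalized_loglik z \<theta>' \<le> lipschitz_factor z * dist \<theta> \<theta>'" .
  qed
qed

lemma QMLE_maximizes:
  assumes est: "\<And>n. is_QMLE M r N g \<Theta> (W n) (\<theta>hat n)"
  shows "\<forall>\<^sub>F z in whp_filter M. (case z of (n, \<omega>) \<Rightarrow> \<theta>hat n \<omega>) \<in> K \<and>
    normalized_loglik z \<theta>s \<le> normalized_loglik z (case z of (n, \<omega>) \<Rightarrow> \<theta>hat n \<omega>)"
  using eventually_good
proof eventually_elim
  case (elim z)
  obtain n \<omega> where z: "z = (n, \<omega>)" by (cases z)
  have w: "\<omega> \<in> space M" and a: "0 < a n" 
    and l: "0 < intensity_est r N (W n) 1 \<omega>" "0 < intensity_est r N (W n) 2 \<omega>"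
    and pos: "\<And>x y \<theta>. (x, y) \<in> close_pairs r N (V n) \<omega> \<Longrightarrow> \<theta> \<in> K \<Longrightarrow> 0 < g (y - x) \<theta>"
    using elim by (auto simp: z)
  have max: "is_arg_max (quasi_loglik r N g (W n) \<omega>) (\<lambda>\<theta>. \<theta> \<in> K) (\<theta>hat n \<omega>)"
    using est[of n] w by (auto simp: is_QMLE_def)
  then have K: "\<theta>hat n \<omega> \<in> K" by (simp add: is_arg_max_def)
  define c where "c = real (card (close_pairs r N (V n) \<omega>)) *
    (ln (intensity_est r N (W n) 1 \<omega>) + ln (intensity_est r N (W n) 2 \<omega>))"
  \<comment> \<open>The remainder \<open>c\<close> is the same for all parameters, so both criteria order them alike.\<close>
  have eq: "quasi_loglik r N g (W n) \<omega> \<theta> = ereal (a n * normalized_loglik z \<theta> + c)" if "\<theta> \<in> K" for \<theta>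
    using quasi_loglik_eq[where g=g and n=n and \<theta>=\<theta>, OF w pos[OF _ that] l] a
    by (simp add: c_def z normalized_loglik_def right_diff_distrib mult.assoc)
  have "\<not> quasi_loglik r N g (W n) \<omega> (\<theta>hat n \<omega>) < quasi_loglik r N g (W n) \<omega> \<theta>s"
    using max \<theta>s_in_K by (auto simp: is_arg_max_def)
  then have "a n * normalized_loglik z \<theta>s \<le> a n * normalized_loglik z (\<theta>hat n \<omega>)"
    by (simp add: eq K \<theta>s_in_K not_less)
  then show ?case using a K by (simp add: z)
qed

lemma QMLE_consistent:
  assumes est: "\<And>n. is_QMLE M r N g \<Theta> (W n) (\<theta>hat n)"
  shows "tendsto_in_prob M \<theta>hat \<theta>s"
proof (rule tendsto_in_prob_whp[OF prob_space_axioms])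
  fix \<epsilon> :: real assume e: "0 < \<epsilon>"
  obtain \<rho> where \<rho>: "(lipschitz_factor \<longlongrightarrow> \<rho>) (whp_filter M)" using lipschitz_factor_tendsto ..
  have "compact K" using parameter_space(1) by simp
  from m_estimator_consistent[OF this \<theta>s_in_K normalized_loglik_tendsto normalized_loglik_lipschitz \<rho>
      contrast_strict_max QMLE_maximizes[OF est] e]
  show "\<forall>\<^sub>F (n, \<omega>) in whp_filter M. dist (\<theta>hat n \<omega>) \<theta>s \<le> \<epsilon>"
    by (simp add: case_prod_unfold)
qed

end

theorem theorem4p1:
  fixes M :: "'w measure"
    and N :: "nat \<Rightarrow> 'w \<Rightarrow> real measure"
    and g :: "real \<Rightarrow> real^'p \<Rightarrow> real"
    and \<Theta> :: "(real^'p) set"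
    and \<theta>s :: "real^'p"
    and r \<delta> :: real
    and W :: "nat \<Rightarrow> real set"
    and fB1 fB2 :: "real \<Rightarrow> real"
    and \<theta>hat :: "nat \<Rightarrow> 'w \<Rightarrow> real^'p"
  assumes prob: "prob_space M"
    and process: "bivariate_point_process M N" "stationary M N"
    and intensities: "intensity M N 1 > 0" "intensity M N 2 > 0"
    and r: "r > 0"
    and family: "\<And>\<theta>. \<theta> \<in> closure \<Theta> \<Longrightarrow> (\<lambda>u. g u \<theta>) \<in> borel_measurable borel"
      "\<And>u \<theta>. \<theta> \<in> closure \<Theta> \<Longrightarrow> g u \<theta> \<ge> 0"
    and true_param: "\<theta>s \<in> \<Theta>" "is_cross_correlation M N (\<lambda>u. g u \<theta>s)"
    and windows: "\<And>n. compact (W n)" "incseq W"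
      "emeasure lborel (\<Union>n. erosion (W n) r) = \<infinity>"
      "(\<lambda>n. real (card (window_cells (W n) r)) / window_area (W n) r) \<longlonglongrightarrow> 1"
    and parameter_space: "bounded \<Theta>" "open \<Theta>" "convex \<Theta>"
    and identifiability: "\<And>\<theta>. \<theta> \<in> closure \<Theta> \<Longrightarrow>
      (AE u in lborel. u \<in> {-r..r} \<longrightarrow> g u \<theta> = g u \<theta>s) \<Longrightarrow> \<theta> = \<theta>s"
    and reg_i: "essinf (restrict_space lborel {-r..r}) (\<lambda>u. INF \<theta>\<in>closure \<Theta>. ereal (g u \<theta>)) > 0"
    and reg_ii: "\<And>u. u \<in> {-r..r} \<Longrightarrow> continuous_on (closure \<Theta>) (g u)"
      "\<And>u. u \<in> {-r..r} \<Longrightarrow> C2_on (g u) \<Theta>"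
    and reg_iii: "\<And>u. u \<in> {-r..r} \<Longrightarrow> fB1 u \<ge> 0"
      "\<And>u \<theta> i. u \<in> {-r..r} \<Longrightarrow> \<theta> \<in> \<Theta> \<Longrightarrow> i \<le> 2 \<Longrightarrow> deriv_norm i (g u) \<theta> \<le> fB1 u"
      "set_integrable lborel {-r..r} fB1"
    and reg_iv: "\<And>u. u \<in> {-r..r} \<Longrightarrow> fB2 u \<ge> 0"
      "\<And>u \<theta> i. u \<in> {-r..r} \<Longrightarrow> \<theta> \<in> \<Theta> \<Longrightarrow> i \<le> 2 \<Longrightarrow>
         deriv_norm i (\<lambda>\<theta>'. ln (g u \<theta>')) \<theta> \<le> fB2 u"
      "set_borel_measurable borel {-r..r} fB2"
      "set_integrable lborel {-r..r} (\<lambda>u. fB2 u * g u \<theta>s)"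
    and delta: "\<delta> > 0"
    and mixing: "summable (\<lambda>m. mixing_coeff M N 2 \<infinity> (Suc m) r powr (\<delta> / (2 + \<delta>)))"
    and moments: "\<And>i. i \<in> {1,2} \<Longrightarrow> finite_Lp_norm M (2 + \<delta>) (\<lambda>\<omega>. measure (N i \<omega>) (cell 0))"
      "\<And>j \<theta>. j \<in> {0,1,2} \<Longrightarrow> \<theta> \<in> \<Theta> \<Longrightarrow>
         finite_Lp_norm M (2 + \<delta>)
           (pair_sum r N (\<lambda>u. deriv_norm j (\<lambda>\<theta>'. ln (g u \<theta>')) \<theta>) (cell 0))"
    and estimator: "\<And>n. is_QMLE M r N g \<Theta> (W n) (\<theta>hat n)"
  shows "tendsto_in_prob M \<theta>hat \<theta>s"
proof -
  obtain lam where lam: "is_cross_intensity M N lam"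
      "\<And>u. g u \<theta>s = lam u / (intensity M N 1 * intensity M N 2)"
    using true_param(2) by (auto simp: is_cross_correlation_def)
  interpret prob_space M by (rule prob)
  interpret parametric_pair M N r \<delta> lam W g \<Theta> \<theta>s fB1 fB2
  proof unfold_locales
    show "AE u in lborel. u \<in> {-r..r} \<longrightarrow> (\<forall>\<theta>\<in>closure \<Theta>. 0 < g u \<theta>)"
    proof -
      \<comment> \<open>A positive essential infimum exceeds 0, so the infimum is positive for almost every \<open>u\<close>.\<close>
      have "\<forall>\<^sub>F u in ae_filter (restrict_space lborel {-r..r}). 0 < (INF \<theta>\<in>closure \<Theta>. ereal (g u \<theta>))"
        using reg_i unfolding essinf_def by (rule less_LiminfD)
      then have "AE u in restrict_space lborel {-r..r}. \<forall>\<theta>\<in>closure \<Theta>. 0 < g u \<theta>"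
      proof eventually_elim
        case (elim u)
        show ?case
        proof
          fix \<theta> assume "\<theta> \<in> closure \<Theta>"
          then have "(INF \<theta>\<in>closure \<Theta>. ereal (g u \<theta>)) \<le> ereal (g u \<theta>)" by (rule INF_lower)
          with elim have "0 < ereal (g u \<theta>)" by (rule less_le_trans)
          then show "0 < g u \<theta>" by simp
        qed
      qed
      then show ?thesis by (subst (asm) AE_restrict_space_iff) auto
    qed
    show "g u differentiable (at \<theta>)" if "u \<in> {-r..r}" "\<theta> \<in> \<Theta>" for u \<theta>
      using reg_ii(2)[OF that(1)] that(2) by (simp add: C2_on_def)
    show "lam u = intensity M N 1 * intensity M N 2 * g u \<theta>s" for u
      using lam(2)[of u] intensities by simp
    show "\<bar>g u \<theta>\<bar> \<le> fB1 u" "norm (grad (g u) \<theta>) \<le> fB1 u"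
      "\<bar>ln (g u \<theta>)\<bar> \<le> fB2 u" "norm (grad (\<lambda>\<theta>. ln (g u \<theta>)) \<theta>) \<le> fB2 u"
      if "u \<in> {-r..r}" "\<theta> \<in> \<Theta>" for u \<theta>
      using reg_iii(2)[OF that, of 0] reg_iii(2)[OF that, of 1] reg_iv(2)[OF that, of 0] reg_iv(2)[OF that, of 1]
      by (simp_all add: deriv_norm_def)
  qed (fact process intensities r lam(1) delta mixing moments(1) windows family(1) true_param(1)
      parameter_space(1,3) identifiability reg_ii(1) reg_iii(1,3) reg_iv(1,3,4))+
  show ?thesis by (rule QMLE_consistent) (rule estimator)
qed

end
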